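(* Let $M$ be a connected smooth manifold of dimension $n\ge 3$ and let $S$ be a spray on $M$ of non-vanishing Ricci curvature (i.e. $\operatorname{Tr}\Phi$ vanishes nowhere on $T_0M$), where $\Phi$ is the Jacobi endomorphism of $S$. Then $S$ is isotropic (i.e. $\Phi=RJ-\alpha\otimes\mathbb{C}$ with $R$ the Ricci scalar and $\alpha$ a semi-basic $1$-form on $T_0M$), satisfies the algebraic condition $\operatorname{rank}\,dd_J(\operatorname{Tr}\Phi)=2n$, and satisfies the condition $d_J\alpha=0$, if and only if the following five conditions are equivalent: \begin{itemize} \item[(i)] $S$ is Finsler metrizable; \item[(ii)] $S$ is metrizable by a Finsler metric of non-vanishing scalar flag curvature; \item[(iii)] $S$ is Finsler metrizable by an Einstein metric; \item[(iv)] $S$ is metrizable by a Finsler metric of non-zero constant flag curvature; \item[(v)] $S$ is Ricci constant. \end{itemize}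
   Context: $M$ is a $C^\infty$ real connected $n$-dimensional manifold; $T_0M=TM\setminus\{0\}$ is the tangent bundle with the zero section removed, with induced coordinates $(x^i,y^i)$. Summation over repeated indices is understood, and $\mathcal{L}_S$ denotes the Lie derivative along $S$. The tangent structure and the Liouville vector field are $J=\frac{\partial}{\partial y^i}\otimes dx^i$ and $\mathbb{C}=y^i\frac{\partial}{\partial y^i}$. A spray is a smooth vector field $S$ on $T_0M$ with $JS=\mathbb{C}$ and $[\mathbb{C},S]=S$; locally $S=y^i\frac{\partial}{\partial x^i}-2G^i(x,y)\frac{\partial}{\partial y^i}$ with $G^i$ smooth and $2$-homogeneous in $y$. The horizontal and vertical projectors of $S$ are $h=\frac12(\operatorname{Id}-\mathcal{L}_SJ)$, $v=\frac12(\operatorname{Id}+\mathcal{L}_SJ)$; locally $h(\partial/\partial x^i)=\frac{\delta}{\delta x^i}=\frac{\partial}{\partial x^i}-\frac{\partial G^j}{\partial y^i}\frac{\partial}{\partial y^j}$ and $h(\partial/\partial y^i)=0$. The Jacobi endomorphism of $S$ is the vector-valued semi-basic $1$-form $\Phi=v\circ\mathcal{L}_Sh=R^i_j\frac{\partial}{\partial y^i}\otimes dx^j$, with $$R^i_j=2\frac{\partial G^i}{\partial x^j}-S\!\left(\frac{\partial G^i}{\partial y^j}\right)-\frac{\partial G^i}{\partial y^r}\frac{\partial G^r}{\partial y^j}.$$ The Ricci curvature is $\operatorname{Ric}=\operatorname{Tr}(\Phi)=R^i_i$, and the Ricci scalar is the function $R$ with $\operatorname{Ric}=(n-1)R$.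 A semi-basic $1$-form is one locally of the form $\alpha=\alpha_i(x,y)dx^i$. For a vector-valued $1$-form $L$, $d_L=i_L\circ d-d\circ i_L$ is the Frölicher–Nijenhuis derivation, where $i_L$ is the algebraic derivation of forms that vanishes on functions and sends a $1$-form $\omega$ to $\omega\circ L$. On functions, $d_Lf=df\circ L$; thus $d_Jf=\frac{\partial f}{\partial y^i}dx^i$ and $d_hf=\frac{\delta f}{\delta x^i}dx^i$; for semi-basic $\alpha$, $d_J\alpha=\frac{\partial\alpha_j}{\partial y^i}dx^i\wedge dx^j$. The rank of $dd_J(\operatorname{Tr}\Phi)$ is its rank as a $2$-form on the $2n$-dimensional manifold $T_0M$. The spray $S$ is Ricci constant if $d_hR=0$. A Finsler function (also called Finsler metric) is a continuous function $F:TM\to\mathbb{R}$ such that: (1) $F$ is smooth and strictly positive on $T_0M$; (2) $F(x,\lambda y)=\lambda F(x,y)$ for all $\lambda\ge0$, $(x,y)\in TM$; (3) the matrix $g_{ij}=\frac12\frac{\partial^2F^2}{\partial y^i\partial y^j}$ has rank $n$ on $T_0M$. Its geodesic spray is the unique vector field $S$ on $T_0M$ with $i_Sdd_JF^2=-dF^2$ (equivalently $\mathcal{L}_Sd_JF^2=dF^2$). A spray $S$ is Finsler metrizable if there is a Finsler function $F$ satisfying this equation; one then says $S$ is metrizable by $F$. Let $F$ be a Finsler function with geodesic spray $S$ and Jacobi endomorphism $\Phi$. $F$ has scalar (respectively constant) flag curvature $\kappa$ if $\kappa$ is a scalar function on $T_0M$ (respectively a constant) such that $\Phi=\kappa\left(F^2J-F\,d_JF\otimes\mathbb{C}\right)$.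 $F$ is an Einstein metric if there is $\lambda\in C^\infty(M)$ such that the Ricci scalar of $S$ satisfies $R(x,y)=\lambda(x)F^2(x,y)$.
   Formalization: In the converse direction, "the five conditions are equivalent" is supplemented by the assumption that at least one of (i)–(v) holds; otherwise a spray satisfying none of them makes them vacuously equivalent and the claim fails. *)

theory Defs
  imports "HOL-Analysis.Analysis"
begin

section \<open>Smooth maps on open sets\<close>

fun Ck_on :: "nat \<Rightarrow> 'a::euclidean_space set \<Rightarrow> ('a \<Rightarrow> 'b::real_normed_vector) \<Rightarrow> bool" where
  "Ck_on 0 X f \<longleftrightarrow> continuous_on X f"
| "Ck_on (Suc k) X f \<longleftrightarrow> (\<forall>x\<in>X. f differentiable (at x)) \<and>
     (\<forall>w. Ck_on k X (\<lambda>x. frechet_derivative f (at x) w))"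

text \<open>Only meaningful for an open set \<open>X\<close>; all uses below are of this kind.\<close>

definition smooth_on :: "'a::euclidean_space set \<Rightarrow> ('a \<Rightarrow> 'b::real_normed_vector) \<Rightarrow> bool" where
  "smooth_on X f \<longleftrightarrow> (\<forall>k. Ck_on k X f)"


section \<open>Charts, atlases and tangent bundles\<close>

text \<open>A chart is a pair of a domain and a coordinate map, the latter being relevant only on the
  domain.\<close>

type_synonym ('p, 'e) chart = "'p set \<times> ('p \<Rightarrow> 'e)"

definition chart_im :: "('p, 'e) chart \<Rightarrow> 'e set" where
  "chart_im c = snd c ` fst c"

definition chart_inv :: "('p, 'e) chart \<Rightarrow> 'e \<Rightarrow> 'p" where
  "chart_inv c = inv_into (fst c) (snd c)"

definition transition :: "('p, 'e) chart \<Rightarrow> ('p, 'e) chart \<Rightarrow> 'e \<Rightarrow> 'e" where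
  "transition c c' = snd c' \<circ> chart_inv c"

text \<open>The manifold is the whole type \<open>'m\<close>. The atlas need not be maximal.\<close>

definition smooth_atlas ::
    "('m::{t2_space, second_countable_topology}, 'e::euclidean_space) chart set \<Rightarrow> bool" where
  "smooth_atlas A \<longleftrightarrow>
     (\<Union>c\<in>A. fst c) = UNIV \<and>
     (\<forall>c\<in>A. open (fst c) \<and> open (chart_im c) \<and>
        homeomorphism (fst c) (chart_im c) (snd c) (chart_inv c)) \<and>
     (\<forall>c\<in>A. \<forall>c'\<in>A. smooth_on (snd c ` (fst c \<inter> fst c')) (transition c c'))"

text \<open>A tangent vector at \<open>p\<close> is given by its components in all charts around \<open>p\<close>, which are
  related by the derivatives of the coordinate changes. For charts not containing \<open>p\<close> the
  components are set to 0, so that a tangent vector is determined by its components in any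
  single chart around \<open>p\<close>.\<close>

type_synonym ('p, 'e) tvec = "('p, 'e) chart \<Rightarrow> 'e"

definition tangent_space ::
    "('p, 'e::euclidean_space) chart set \<Rightarrow> 'p \<Rightarrow> ('p, 'e) tvec set" where
  "tangent_space A p = {v.
     (\<forall>c\<in>A. \<forall>c'\<in>A. p \<in> fst c \<and> p \<in> fst c' \<longrightarrow>
        v c' = frechet_derivative (transition c c') (at (snd c p)) (v c)) \<and>
     (\<forall>c. \<not> (c \<in> A \<and> p \<in> fst c) \<longrightarrow> v c = 0)}"

definition tangent_bundle ::
    "('p, 'e::euclidean_space) chart set \<Rightarrow> ('p \<times> ('p, 'e) tvec) set" where
  "tangent_bundle A = Sigma (\<Union>c\<in>A. fst c) (tangent_space A)"

text \<open>The slit tangent bundle is \<open>TM\<close> with the zero section removed.\<close>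

definition slit_bundle ::
    "('p, 'e::euclidean_space) chart set \<Rightarrow> ('p \<times> ('p, 'e) tvec) set" where
  "slit_bundle A = {(p, v) \<in> tangent_bundle A. v \<noteq> (\<lambda>_. 0)}"

text \<open>The induced coordinates \<open>(x, y)\<close> on \<open>TM\<close> and on the slit tangent bundle.\<close>

definition tangent_chart :: "('p, 'e::euclidean_space) chart set \<Rightarrow> ('p, 'e) chart \<Rightarrow>
    ('p \<times> ('p, 'e) tvec, 'e \<times> 'e) chart" where
  "tangent_chart A c =
     ({u \<in> tangent_bundle A. fst u \<in> fst c}, \<lambda>(p, v). (snd c p, v c))"

definition slit_chart :: "('p, 'e::euclidean_space) chart set \<Rightarrow> ('p, 'e) chart \<Rightarrow>
    ('p \<times> ('p, 'e) tvec, 'e \<times> 'e) chart" where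
  "slit_chart A c =
     ({u \<in> slit_bundle A. fst u \<in> fst c}, \<lambda>(p, v). (snd c p, v c))"

definition slit_atlas :: "('p, 'e::euclidean_space) chart set \<Rightarrow>
    ('p \<times> ('p, 'e) tvec, 'e \<times> 'e) chart set" where
  "slit_atlas A = slit_chart A ` A"


section \<open>Functions, vector fields and 1-forms on a manifold\<close>

definition local_fun :: "('p \<Rightarrow> 'b) \<Rightarrow> ('p, 'e) chart \<Rightarrow> 'e \<Rightarrow> 'b" where
  "local_fun f c z = f (chart_inv c z)"

definition smooth_fun :: "('p, 'e::euclidean_space) chart set \<Rightarrow> ('p \<Rightarrow> real) \<Rightarrow> bool" where
  "smooth_fun B f \<longleftrightarrow> (\<forall>c\<in>B. smooth_on (chart_im c) (local_fun f c))"

definition local_vf :: "('p \<Rightarrow> ('p, 'e) tvec) \<Rightarrow> ('p, 'e) chart \<Rightarrow> 'e \<Rightarrow> 'e" where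
  "local_vf X c z = X (chart_inv c z) c"

definition smooth_vector_field ::
    "('p, 'e::euclidean_space) chart set \<Rightarrow> ('p \<Rightarrow> ('p, 'e) tvec) \<Rightarrow> bool" where
  "smooth_vector_field B X \<longleftrightarrow>
     (\<forall>p \<in> (\<Union>c\<in>B. fst c). X p \<in> tangent_space B p) \<and>
     (\<forall>c\<in>B. smooth_on (chart_im c) (local_vf X c))"

text \<open>A 1-form is likewise given at each point by its representatives in the charts around that
  point: \<open>\<omega> p c\<close> is a linear form on component vectors in the chart \<open>c\<close>.\<close>

definition local_form ::
    "('p \<Rightarrow> ('p, 'e) chart \<Rightarrow> 'e \<Rightarrow> real) \<Rightarrow> ('p, 'e) chart \<Rightarrow> 'e \<Rightarrow> 'e \<Rightarrow> real" where
  "local_form \<omega> c z = \<omega> (chart_inv c z) c"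

definition smooth_one_form :: "('p, 'e::euclidean_space) chart set \<Rightarrow>
    ('p \<Rightarrow> ('p, 'e) chart \<Rightarrow> 'e \<Rightarrow> real) \<Rightarrow> bool" where
  "smooth_one_form B \<omega> \<longleftrightarrow>
     (\<forall>c\<in>B. \<forall>p\<in>fst c. linear (\<omega> p c)) \<and>
     (\<forall>c\<in>B. \<forall>c'\<in>B. \<forall>p \<in> fst c \<inter> fst c'. \<forall>w.
        \<omega> p c w = \<omega> p c' (frechet_derivative (transition c c') (at (snd c p)) w)) \<and>
     (\<forall>c\<in>B. \<forall>w. smooth_on (chart_im c) (\<lambda>z. local_form \<omega> c z w))"


section \<open>Tensor calculus in a coordinate domain\<close>

text \<open>Vector fields, 1-forms, 2-forms and vector-valued 1-forms on an open subset of a Euclidean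
  space are functions of the point \<open>z\<close>, followed by the tangent vectors they are evaluated on.\<close>

definition dderiv :: "('e::euclidean_space \<Rightarrow> 'b::real_normed_vector) \<Rightarrow> 'e \<Rightarrow> 'e \<Rightarrow> 'b" where
  "dderiv f z w = frechet_derivative f (at z) w"

definition lie_bracket :: "('e::euclidean_space \<Rightarrow> 'e) \<Rightarrow> ('e \<Rightarrow> 'e) \<Rightarrow> 'e \<Rightarrow> 'e" where
  "lie_bracket X Y z = dderiv Y z (X z) - dderiv X z (Y z)"

text \<open>\<open>(\<L>\<^sub>S L)(W) = [S, L W] - L [S, W]\<close>; the value at a point depends only on the value of \<open>W\<close>
  there, so \<open>W\<close> may be taken constant.\<close>

definition lie_endo :: "('e::euclidean_space \<Rightarrow> 'e) \<Rightarrow> ('e \<Rightarrow> 'e \<Rightarrow> 'e) \<Rightarrow> 'e \<Rightarrow> 'e \<Rightarrow> 'e" where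
  "lie_endo S L z w = lie_bracket S (\<lambda>z'. L z' w) z - L z (lie_bracket S (\<lambda>_. w) z)"

definition ext_d :: "('e::euclidean_space \<Rightarrow> 'e \<Rightarrow> real) \<Rightarrow> 'e \<Rightarrow> 'e \<Rightarrow> 'e \<Rightarrow> real" where
  "ext_d \<omega> z w w' = dderiv (\<lambda>z'. \<omega> z' w') z w - dderiv (\<lambda>z'. \<omega> z' w) z w'"

text \<open>The derivation \<open>d\<^sub>L = i\<^sub>L d - d i\<^sub>L\<close> on functions and on 1-forms.\<close>

definition dL_fun :: "('e::euclidean_space \<Rightarrow> 'e \<Rightarrow> 'e) \<Rightarrow> ('e \<Rightarrow> real) \<Rightarrow> 'e \<Rightarrow> 'e \<Rightarrow> real" where
  "dL_fun L f z w = dderiv f z (L z w)"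

definition dL_form ::
    "('e::euclidean_space \<Rightarrow> 'e \<Rightarrow> 'e) \<Rightarrow> ('e \<Rightarrow> 'e \<Rightarrow> real) \<Rightarrow> 'e \<Rightarrow> 'e \<Rightarrow> 'e \<Rightarrow> real" where
  "dL_form L \<omega> z w w' =
     (ext_d \<omega> z (L z w) w' + ext_d \<omega> z w (L z w')) - ext_d (\<lambda>z' u. \<omega> z' (L z' u)) z w w'"

text \<open>The rank of the linear map \<open>w \<mapsto> B(w, \<cdot>)\<close>, the dual space being identified with \<open>'e\<close> by the
  inner product.\<close>

definition form_rank :: "('e::euclidean_space \<Rightarrow> 'e \<Rightarrow> real) \<Rightarrow> nat" where
  "form_rank B = dim (range (\<lambda>w. \<Sum>b\<in>Basis. B w b *\<^sub>R b))"


section \<open>Objects attached to a spray, in induced coordinates\<close>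

text \<open>Points and tangent vectors are pairs: \<open>(x, y)\<close> is a point and \<open>(a, b)\<close> stands for
  \<open>a\<^sup>i \<partial>/\<partial>x\<^sup>i + b\<^sup>i \<partial>/\<partial>y\<^sup>i\<close>. The argument \<open>S\<close> is a local representative of the spray.\<close>

definition JJ :: "'e::euclidean_space \<times> 'e \<Rightarrow> 'e \<times> 'e \<Rightarrow> 'e \<times> 'e" where
  "JJ z w = (0, fst w)"

definition CC :: "'e::euclidean_space \<times> 'e \<Rightarrow> 'e \<times> 'e" where
  "CC z = (0, snd z)"

definition hproj ::
    "('e::euclidean_space \<times> 'e \<Rightarrow> 'e \<times> 'e) \<Rightarrow> 'e \<times> 'e \<Rightarrow> 'e \<times> 'e \<Rightarrow> 'e \<times> 'e" where
  "hproj S z w = (1/2) *\<^sub>R (w - lie_endo S JJ z w)"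

definition vproj ::
    "('e::euclidean_space \<times> 'e \<Rightarrow> 'e \<times> 'e) \<Rightarrow> 'e \<times> 'e \<Rightarrow> 'e \<times> 'e \<Rightarrow> 'e \<times> 'e" where
  "vproj S z w = (1/2) *\<^sub>R (w + lie_endo S JJ z w)"

definition jacobi_endo ::
    "('e::euclidean_space \<times> 'e \<Rightarrow> 'e \<times> 'e) \<Rightarrow> 'e \<times> 'e \<Rightarrow> 'e \<times> 'e \<Rightarrow> 'e \<times> 'e" where
  "jacobi_endo S z w = vproj S z (lie_endo S (hproj S) z w)"

text \<open>The trace \<open>R\<^sup>i\<^sub>i\<close> of a semi-basic \<open>R\<^sup>i\<^sub>j \<partial>/\<partial>y\<^sup>i \<otimes> dx\<^sup>j\<close>. (As an endomorphism of the tangent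
  space of \<open>TM\<close> such an object is nilpotent; this is not the trace meant.)\<close>

definition semibasic_trace :: "('e::euclidean_space \<times> 'e \<Rightarrow> 'e \<times> 'e) \<Rightarrow> real" where
  "semibasic_trace L = (\<Sum>b\<in>Basis. snd (L (b, 0)) \<bullet> b)"

definition Ric :: "('e::euclidean_space \<times> 'e \<Rightarrow> 'e \<times> 'e) \<Rightarrow> 'e \<times> 'e \<Rightarrow> real" where
  "Ric S z = semibasic_trace (jacobi_endo S z)"

definition ricci_scalar :: "('e::euclidean_space \<times> 'e \<Rightarrow> 'e \<times> 'e) \<Rightarrow> 'e \<times> 'e \<Rightarrow> real" where
  "ricci_scalar S z = Ric S z / (real DIM('e) - 1)"


section \<open>Sprays and Finsler functions on a manifold\<close>

type_synonym ('m, 'n) mchart = "('m, real ^ 'n) chart"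
type_synonym ('m, 'n) tm = "'m \<times> ('m, real ^ 'n) tvec"
type_synonym ('m, 'n) tmchart = "(('m, 'n) tm, (real ^ 'n) \<times> (real ^ 'n)) chart"
type_synonym ('m, 'n) tmfield = "('m, 'n) tm \<Rightarrow> (('m, 'n) tm, (real ^ 'n) \<times> (real ^ 'n)) tvec"
type_synonym ('m, 'n) tmform =
  "('m, 'n) tm \<Rightarrow> ('m, 'n) tmchart \<Rightarrow> (real ^ 'n) \<times> (real ^ 'n) \<Rightarrow> real"

definition spray :: "('m, 'n::finite) mchart set \<Rightarrow> ('m, 'n) tmfield \<Rightarrow> bool" where
  "spray A S \<longleftrightarrow> smooth_vector_field (slit_atlas A) S \<and>
     (\<forall>c\<in>slit_atlas A. \<forall>z\<in>chart_im c.
        JJ z (local_vf S c z) = CC z \<and> lie_bracket CC (local_vf S c) z = local_vf S c z)"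

definition nonvanishing_ricci :: "('m, 'n::finite) mchart set \<Rightarrow> ('m, 'n) tmfield \<Rightarrow> bool" where
  "nonvanishing_ricci A S \<longleftrightarrow>
     (\<forall>c\<in>slit_atlas A. \<forall>z\<in>chart_im c. Ric (local_vf S c) z \<noteq> 0)"

definition semibasic :: "('m, 'n::finite) mchart set \<Rightarrow> ('m, 'n) tmform \<Rightarrow> bool" where
  "semibasic A \<alpha> \<longleftrightarrow> smooth_one_form (slit_atlas A) \<alpha> \<and>
     (\<forall>c\<in>slit_atlas A. \<forall>z\<in>chart_im c. \<forall>w. local_form \<alpha> c z (JJ z w) = 0)"

definition isotropic_with ::
    "('m, 'n::finite) mchart set \<Rightarrow> ('m, 'n) tmfield \<Rightarrow> ('m, 'n) tmform \<Rightarrow> bool" where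
  "isotropic_with A S \<alpha> \<longleftrightarrow> semibasic A \<alpha> \<and>
     (\<forall>c\<in>slit_atlas A. \<forall>z\<in>chart_im c. \<forall>w.
        jacobi_endo (local_vf S c) z w =
          ricci_scalar (local_vf S c) z *\<^sub>R JJ z w - local_form \<alpha> c z w *\<^sub>R CC z)"

definition dJ_closed :: "('m, 'n::finite) mchart set \<Rightarrow> ('m, 'n) tmform \<Rightarrow> bool" where
  "dJ_closed A \<alpha> \<longleftrightarrow>
     (\<forall>c\<in>slit_atlas A. \<forall>z\<in>chart_im c. \<forall>w w'. dL_form JJ (local_form \<alpha> c) z w w' = 0)"

text \<open>\<open>rank dd\<^sub>J(Tr \<Phi>) = 2n\<close> at every point of the slit tangent bundle.\<close>

definition ricci_full_rank :: "('m, 'n::finite) mchart set \<Rightarrow> ('m, 'n) tmfield \<Rightarrow> bool" where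
  "ricci_full_rank A S \<longleftrightarrow>
     (\<forall>c\<in>slit_atlas A. \<forall>z\<in>chart_im c.
        form_rank (ext_d (dL_fun JJ (Ric (local_vf S c))) z) = 2 * CARD('n))"

definition ricci_constant :: "('m, 'n::finite) mchart set \<Rightarrow> ('m, 'n) tmfield \<Rightarrow> bool" where
  "ricci_constant A S \<longleftrightarrow>
     (\<forall>c\<in>slit_atlas A. \<forall>z\<in>chart_im c. \<forall>w.
        dL_fun (hproj (local_vf S c)) (ricci_scalar (local_vf S c)) z w = 0)"

text \<open>\<open>g\<^sub>i\<^sub>j = 1/2 \<partial>\<^sup>2f/\<partial>y\<^sup>i\<partial>y\<^sup>j\<close>, applied below to \<open>f = F\<^sup>2\<close>.\<close>

definition y_hessian ::
    "((real ^ 'n) \<times> (real ^ 'n) \<Rightarrow> real) \<Rightarrow> (real ^ 'n::finite) \<times> (real ^ 'n) \<Rightarrow> real ^ 'n ^ 'n" where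
  "y_hessian f z =
     (\<chi> i j. (1/2) * dderiv (\<lambda>z'. dderiv f z' (0, axis j 1)) z (0, axis i 1))"

text \<open>A function on \<open>TM\<close> is a function on the pairs \<open>(p, v)\<close>, of which only the values on
  \<open>tangent_bundle A\<close> matter.\<close>

definition finsler_function :: "('m, 'n::finite) mchart set \<Rightarrow> (('m, 'n) tm \<Rightarrow> real) \<Rightarrow> bool" where
  "finsler_function A F \<longleftrightarrow>
     (\<forall>c\<in>A. continuous_on (chart_im (tangent_chart A c)) (local_fun F (tangent_chart A c))) \<and>
     smooth_fun (slit_atlas A) F \<and>
     (\<forall>u\<in>slit_bundle A. F u > 0) \<and>
     (\<forall>(p, v)\<in>tangent_bundle A. \<forall>r\<ge>0. F (p, \<lambda>c. r *\<^sub>R v c) = r * F (p, v)) \<and>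
     (\<forall>c\<in>slit_atlas A. \<forall>z\<in>chart_im c.
        rank (y_hessian (\<lambda>z. (local_fun F c z)\<^sup>2) z) = CARD('n))"

text \<open>\<open>S\<close> is the geodesic spray of \<open>F\<close>, i.e. \<open>i\<^sub>S dd\<^sub>J F\<^sup>2 = - dF\<^sup>2\<close>.\<close>

definition metrizable_by ::
    "('m, 'n::finite) mchart set \<Rightarrow> ('m, 'n) tmfield \<Rightarrow> (('m, 'n) tm \<Rightarrow> real) \<Rightarrow> bool" where
  "metrizable_by A S F \<longleftrightarrow> finsler_function A F \<and>
     (\<forall>c\<in>slit_atlas A. \<forall>z\<in>chart_im c. \<forall>w.
        ext_d (dL_fun JJ (\<lambda>z. (local_fun F c z)\<^sup>2)) z (local_vf S c z) w =
          - dderiv (\<lambda>z. (local_fun F c z)\<^sup>2) z w)"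

text \<open>\<open>\<Phi> = \<kappa> (F\<^sup>2 J - F d\<^sub>J F \<otimes> \<C>)\<close>; used for \<open>F\<close> with geodesic spray \<open>S\<close>.\<close>

definition scalar_flag_curvature :: "('m, 'n::finite) mchart set \<Rightarrow> ('m, 'n) tmfield \<Rightarrow>
    (('m, 'n) tm \<Rightarrow> real) \<Rightarrow> (('m, 'n) tm \<Rightarrow> real) \<Rightarrow> bool" where
  "scalar_flag_curvature A S F \<kappa> \<longleftrightarrow> smooth_fun (slit_atlas A) \<kappa> \<and>
     (\<forall>c\<in>slit_atlas A. \<forall>z\<in>chart_im c. \<forall>w.
        jacobi_endo (local_vf S c) z w =
          local_fun \<kappa> c z *\<^sub>R ((local_fun F c z)\<^sup>2 *\<^sub>R JJ z w
            - (local_fun F c z * dL_fun JJ (local_fun F c) z w) *\<^sub>R CC z))"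

definition einstein_metric :: "('m, 'n::finite) mchart set \<Rightarrow> ('m, 'n) tmfield \<Rightarrow>
    (('m, 'n) tm \<Rightarrow> real) \<Rightarrow> bool" where
  "einstein_metric A S F \<longleftrightarrow> (\<exists>l :: 'm \<Rightarrow> real. smooth_fun A l \<and>
     (\<forall>c\<in>slit_atlas A. \<forall>z\<in>chart_im c.
        ricci_scalar (local_vf S c) z = l (fst (chart_inv c z)) * (local_fun F c z)\<^sup>2))"

definition all_equivalent :: "bool list \<Rightarrow> bool" where
  "all_equivalent Ps \<longleftrightarrow> (\<forall>P\<in>set Ps. \<forall>Q\<in>set Ps. P \<longleftrightarrow> Q)"

end

theory Submission
  imports Defs
begin

text \<open>In induced coordinates write \<open>z = (x, y)\<close>, let \<open>\<delta>\<^sub>a\<close> be the horizontal field with \<open>x\<close>-component the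
  constant vector \<open>a\<close>, and let \<open>R\<^sub>a\<close> be the derivative of \<open>R\<close> in the fibre direction \<open>a\<close>. Everything
  rests on two remarks.

  First, for a function \<open>L\<close> that is 2-homogeneous in \<open>y\<close>, the geodesic equation
  \<open>i\<^sub>S dd\<^sub>J L = - dL\<close> says exactly that \<open>d\<^sub>h L = 0\<close> (\<open>geodesic_iff_horizontal\<close>). Second, if \<open>S\<close> is isotropic with
  \<open>d\<^sub>J \<alpha> = 0\<close>, then homogeneity of \<open>\<Phi>\<close> and \<open>\<Phi>(S) = 0\<close> force \<open>\<alpha> = (1/2) d\<^sub>J R\<close>, so that
  \<open>\<Phi> = R J - (1/2) d\<^sub>J R \<otimes> \<C>\<close> is determined by \<open>R\<close> alone (\<open>\<Phi>_R\<close>). This has the shape of constant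
  flag curvature \<open>k = \<plusminus>1\<close> for \<open>F\<^sup>2 = \<bar>R\<bar>\<close>.

  Hence (v) implies (iv): \<open>R\<close> is horizontally constant and 2-homogeneous, its sign is constant because
  the manifold and the punctured fibres are connected, and the rank condition makes
  \<open>F = \<surd>\<bar>R\<bar>\<close> a Finsler function; \<open>F\<close> metrizes \<open>S\<close> by the first remark. It is well defined
  because \<open>R = \<alpha>(S)\<close> is visibly independent of the chart.

  That (iv) implies (ii) and (iii), and each of these (i), is immediate. That (i) implies (v) is a
  lemma of Schur type. Let \<open>L = F\<^sup>2\<close>, so \<open>d\<^sub>h L = 0\<close>. The commutator \<open>[S, \<delta>\<^sub>a]\<close> shows
  \<open>dL \<circ> \<Phi> = 0\<close>, that is \<open>R\<^sub>a L = R L\<^sub>a\<close>, so \<open>R / L\<close> depends on \<open>x\<close> only. The curvature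
  \<open>[\<delta>\<^sub>a, \<delta>\<^sub>b]\<close> is expressed by \<open>\<Phi>\<close>, and its Bianchi identity yields \<open>\<delta>\<^sub>c R\<^sub>a = \<delta>\<^sub>a R\<^sub>c\<close> when
  \<open>n \<ge> 3\<close> (\<open>mixed_sym\<close>). Together these give \<open>\<mu>\<^sub>c L\<^sub>a = \<mu>\<^sub>a L\<^sub>c\<close>, where \<open>\<mu>\<close> is the differential of
  \<open>R / L\<close> at \<open>x\<close>. At a vector \<open>y \<noteq> 0\<close> in the kernel of \<open>\<mu>\<close>, taking \<open>a = y\<close> gives \<open>2 L \<mu>\<^sub>c = 0\<close>, so
  \<open>\<mu> = 0\<close> and \<open>R\<close> is horizontally constant (\<open>schur\<close>).

  Conversely, if the conditions hold then (iv) provides \<open>F\<close> and \<open>k \<noteq> 0\<close>. Taking traces,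
  \<open>R = k F\<^sup>2\<close>, so \<open>\<alpha> = (k/2) d\<^sub>J F\<^sup>2\<close> witnesses isotropy and is \<open>d\<^sub>J\<close>-closed, and the rank of
  \<open>dd\<^sub>J Ric\<close> is full because the fibre Hessian of \<open>F\<^sup>2\<close> is nondegenerate.\<close>

section \<open>Calculus of smooth maps\<close>

lemma dderiv_eq: "(f has_derivative f') (at z) \<Longrightarrow> dderiv f z w = f' w"
  unfolding dderiv_def using frechet_derivative_at by metis

lemma Ck_on_Suc_I:
  assumes "\<And>x. x \<in> X \<Longrightarrow> (f has_derivative f' x) (at x)"
    and "\<And>w. Ck_on k X (\<lambda>x. frechet_derivative f (at x) w)"
  shows "Ck_on (Suc k) X f"
  using assms by (auto simp: differentiable_def)

lemma Ck_on_cong: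
  assumes "open X" "\<And>x. x \<in> X \<Longrightarrow> f x = g x"
  shows "Ck_on k X f \<longleftrightarrow> Ck_on k X g"
  using assms(2)
proof (induction k arbitrary: f g)
  case 0
  then show ?case by (simp cong: continuous_on_cong)
next
  case (Suc k)
  have h: "(f has_derivative f') (at x) \<longleftrightarrow> (g has_derivative f') (at x)" if "x \<in> X" for x f'
    using has_derivative_transform_within_open[of f f' x UNIV X g]
      has_derivative_transform_within_open[of g f' x UNIV X f] assms(1) that Suc.prems by auto
  have fr: "frechet_derivative f (at x) = frechet_derivative g (at x)" if "x \<in> X" for x
    unfolding frechet_derivative_def using h[OF that] by simp
  have "Ck_on k X (\<lambda>x. frechet_derivative f (at x) w) \<longleftrightarrow> Ck_on k X (\<lambda>x. frechet_derivative g (at x) w)" for w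
    by (rule Suc.IH) (simp add: fr)
  with h show ?case by (simp add: differentiable_def)
qed

lemma Ck_on_SucI:
  assumes "open X" "\<And>x. x \<in> X \<Longrightarrow> (f has_derivative f' x) (at x)"
    and "\<And>w. Ck_on k X (\<lambda>x. f' x w)"
  shows "Ck_on (Suc k) X f"
proof (rule Ck_on_Suc_I[OF assms(2)])
  fix w
  show "Ck_on k X (\<lambda>x. frechet_derivative f (at x) w)"
    using Ck_on_cong[OF assms(1), of "\<lambda>x. frechet_derivative f (at x) w" "\<lambda>x. f' x w"]
      assms(2,3) dderiv_eq[unfolded dderiv_def] by metis
qed

lemma Ck_on_SucD:
  assumes "Ck_on (Suc k) X f"
  shows "x \<in> X \<Longrightarrow> (f has_derivative dderiv f x) (at x)"
    and "Ck_on k X (\<lambda>x. dderiv f x w)"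
  using assms by (auto simp: dderiv_def[abs_def] frechet_derivative_works)

lemma Ck_on_Suc_imp: "Ck_on (Suc k) X f \<Longrightarrow> Ck_on k X f"
proof (induction k arbitrary: f)
  case 0
  then show ?case
    by (auto intro!: differentiable_imp_continuous_on differentiable_at_imp_differentiable_on)
next
  case (Suc k)
  then show ?case by simp
qed

lemma Ck_on_const: "open X \<Longrightarrow> Ck_on k X (\<lambda>_. c)"
  by (induction k arbitrary: c) (auto intro!: Ck_on_SucI derivative_eq_intros simp del: Ck_on.simps(2))

lemma Ck_on_linear:
  assumes "open X" "bounded_linear T" "Ck_on k X f"
  shows "Ck_on k X (\<lambda>x. T (f x))"
  using assms(3)
proof (induction k arbitrary: f)
  case 0
  then show ?case using bounded_linear.continuous_on[OF assms(2)] by auto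
next
  case (Suc k)
  show ?case
    by (rule Ck_on_SucI[OF assms(1), where f' = "\<lambda>x w. T (dderiv f x w)"])
      (auto intro: bounded_linear.has_derivative[OF assms(2)] Suc.IH Ck_on_SucD[OF Suc.prems])
qed

lemma Ck_on_add:
  assumes "open X" "Ck_on k X f" "Ck_on k X g"
  shows "Ck_on k X (\<lambda>x. f x + g x)"
  using assms(2,3)
proof (induction k arbitrary: f g)
  case 0
  then show ?case by (auto intro: continuous_intros)
next
  case (Suc k)
  show ?case
    by (rule Ck_on_SucI[OF assms(1), where f' = "\<lambda>x w. dderiv f x w + dderiv g x w"])
      (auto intro: has_derivative_add Suc.IH Ck_on_SucD[OF Suc.prems(1)] Ck_on_SucD[OF Suc.prems(2)])
qed

lemma Ck_on_bilinear:
  assumes "open X" "bounded_bilinear p" "Ck_on k X f" "Ck_on k X g"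
  shows "Ck_on k X (\<lambda>x. p (f x) (g x))"
  using assms(3,4)
proof (induction k arbitrary: f g)
  case 0
  then show ?case using bounded_bilinear.continuous_on[OF assms(2)] by auto
next
  case (Suc k)
  show ?case
    by (rule Ck_on_SucI[OF assms(1), where f' = "\<lambda>x w. p (f x) (dderiv g x w) + p (dderiv f x w) (g x)"])
      (auto intro!: bounded_bilinear.FDERIV[OF assms(2)] Ck_on_add[OF assms(1)] Suc.IH
        intro: Ck_on_SucD[OF Suc.prems(1)] Ck_on_SucD[OF Suc.prems(2)] Ck_on_Suc_imp Suc.prems
        simp del: Ck_on.simps(2))
qed

lemma smooth_on_cong:
  "open X \<Longrightarrow> (\<And>x. x \<in> X \<Longrightarrow> f x = g x) \<Longrightarrow> smooth_on X f \<longleftrightarrow> smooth_on X g"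
  unfolding smooth_on_def using Ck_on_cong by metis

lemma smooth_onD:
  assumes "smooth_on X f"
  shows "x \<in> X \<Longrightarrow> (f has_derivative dderiv f x) (at x)"
    and "smooth_on X (\<lambda>x. dderiv f x w)"
    and "continuous_on X f"
proof -
  have "Ck_on (Suc k) X f" for k
    using assms unfolding smooth_on_def by blast
  note * = Ck_on_SucD[OF this]
  show "x \<in> X \<Longrightarrow> (f has_derivative dderiv f x) (at x)" by (rule *(1))
  show "smooth_on X (\<lambda>x. dderiv f x w)" unfolding smooth_on_def using *(2) by blast
  have "Ck_on 0 X f" using assms unfolding smooth_on_def by blast
  then show "continuous_on X f" by simp
qed

lemma linear_dderiv: "smooth_on X f \<Longrightarrow> x \<in> X \<Longrightarrow> linear (dderiv f x)"
  by (rule has_derivative_linear[OF smooth_onD(1)])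

context
  fixes X :: "'a::euclidean_space set"
  assumes X: "open X"
begin

lemma smooth_on_const: "smooth_on X (\<lambda>_. c)"
  unfolding smooth_on_def using Ck_on_const[OF X] by blast

lemma smooth_on_linear: "bounded_linear T \<Longrightarrow> smooth_on X f \<Longrightarrow> smooth_on X (\<lambda>x. T (f x))"
  unfolding smooth_on_def using Ck_on_linear[OF X] by blast

lemma smooth_on_add: "smooth_on X f \<Longrightarrow> smooth_on X g \<Longrightarrow> smooth_on X (\<lambda>x. f x + g x)"
  unfolding smooth_on_def using Ck_on_add[OF X] by blast

lemma smooth_on_bilinear:
  "bounded_bilinear p \<Longrightarrow> smooth_on X f \<Longrightarrow> smooth_on X g \<Longrightarrow> smooth_on X (\<lambda>x. p (f x) (g x))"
  unfolding smooth_on_def using Ck_on_bilinear[OF X] by blast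

lemmas smooth_on_scaleR = smooth_on_bilinear[OF bounded_bilinear_scaleR]
  and smooth_on_mult = smooth_on_bilinear[OF bounded_bilinear_mult]
  and smooth_on_inner = smooth_on_bilinear[OF bounded_bilinear_inner]
  and smooth_on_uminus = smooth_on_linear[OF bounded_linear_minus[OF bounded_linear_ident]]
  and smooth_on_snd = smooth_on_linear[OF bounded_linear_snd]

lemma smooth_on_diff:
  "smooth_on X f \<Longrightarrow> smooth_on X g \<Longrightarrow> smooth_on X (\<lambda>x. f x - g x)"
  using smooth_on_add[of f "\<lambda>x. - g x"] smooth_on_uminus[of g] by simp

lemma smooth_on_Pair:
  fixes f :: "'a \<Rightarrow> 'b::real_normed_vector" and g :: "'a \<Rightarrow> 'c::real_normed_vector"
  assumes "smooth_on X f" "smooth_on X g"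
  shows "smooth_on X (\<lambda>x. (f x, g x))"
proof -
  have "bounded_linear (\<lambda>u::'b. (u, 0::'c))" "bounded_linear (\<lambda>u::'c. (0::'b, u))"
    by (auto intro!: bounded_linear_Pair bounded_linear_ident bounded_linear_zero)
  from smooth_on_add[OF smooth_on_linear[OF this(1) assms(1)] smooth_on_linear[OF this(2) assms(2)]]
  show ?thesis by simp
qed

lemma smooth_on_sum:
  "(\<And>i. i \<in> I \<Longrightarrow> smooth_on X (f i)) \<Longrightarrow> smooth_on X (\<lambda>x. \<Sum>i\<in>I. f i x)"
  by (induction I rule: infinite_finite_induct) (auto intro: smooth_on_const smooth_on_add)

lemma Ck_on_id: "Ck_on k X (\<lambda>x. x)"
proof (cases k)
  case (Suc j)
  then show ?thesis
    by (auto intro!: Ck_on_SucI[OF X] derivative_eq_intros Ck_on_const[OF X] simp del: Ck_on.simps(2))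
qed (simp add: continuous_on_id)

lemma smooth_on_id: "smooth_on X (\<lambda>x. x)"
  unfolding smooth_on_def using Ck_on_id by blast

text \<open>The derivative of a power is again a power times smooth factors, so the exponent has to vary in
  the induction. This covers square roots of positive functions.\<close>

lemma Ck_on_powr:
  fixes f :: "'a \<Rightarrow> real"
  assumes "smooth_on X f" "\<And>x. x \<in> X \<Longrightarrow> f x > 0"
  shows "Ck_on k X (\<lambda>x. f x powr r)"
proof (induction k arbitrary: r)
  case 0
  then show ?case
    using smooth_onD(3)[OF assms(1)] assms(2) by (force intro!: continuous_intros)
next
  case (Suc k)
  show ?case
  proof (rule Ck_on_SucI[OF X, where f' = "\<lambda>x w. r * f x powr (r - 1) * dderiv f x w"])
    fix x assume "x \<in> X"
    from has_derivative_powr[OF smooth_onD(1)[OF assms(1) this] has_derivative_const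
        assms(2)[OF this], of r]
    show "((\<lambda>x. f x powr r) has_derivative (\<lambda>w. r * f x powr (r - 1) * dderiv f x w)) (at x)"
      using assms(2)[OF \<open>x \<in> X\<close>]
      by (simp add: powr_diff field_simps)
  next
    fix w
    have "Ck_on k X (\<lambda>x. dderiv f x w)"
      using smooth_onD(2)[OF assms(1)] unfolding smooth_on_def by blast
    with Suc show "Ck_on k X (\<lambda>x. r * f x powr (r - 1) * dderiv f x w)"
      by (intro Ck_on_bilinear[OF X bounded_bilinear_mult] Ck_on_const[OF X])
  qed
qed

lemma smooth_on_powr:
  fixes f :: "'a \<Rightarrow> real"
  shows "smooth_on X f \<Longrightarrow> (\<And>x. x \<in> X \<Longrightarrow> f x > 0) \<Longrightarrow> smooth_on X (\<lambda>x. f x powr r)"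
  unfolding smooth_on_def using Ck_on_powr unfolding smooth_on_def by blast

lemma dderiv_cong:
  assumes "\<And>x. x \<in> X \<Longrightarrow> f x = g x" "z \<in> X"
  shows "dderiv f z = dderiv g z"
proof -
  have "(f has_derivative f') (at z) \<longleftrightarrow> (g has_derivative f') (at z)" for f'
    using has_derivative_transform_within_open[of f f' z UNIV X g]
      has_derivative_transform_within_open[of g f' z UNIV X f] X assms by auto
  then show ?thesis unfolding dderiv_def[abs_def] frechet_derivative_def by simp
qed

lemma dderiv_expand:
  fixes g :: "'a \<Rightarrow> 'b::real_normed_vector"
  assumes "smooth_on X g" "z \<in> X"
  shows "dderiv g z w = (\<Sum>b\<in>Basis. (w \<bullet> b) *\<^sub>R dderiv g z b)"
proof -
  interpret linear "dderiv g z" by (rule linear_dderiv[OF assms])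
  have "dderiv g z w = dderiv g z (\<Sum>b\<in>Basis. (w \<bullet> b) *\<^sub>R b)" by (simp add: euclidean_representation)
  also have "\<dots> = (\<Sum>b\<in>Basis. (w \<bullet> b) *\<^sub>R dderiv g z b)" by (simp add: sum scale)
  finally show ?thesis .
qed

lemma smooth_on_dderiv_field:
  assumes "smooth_on X g" "smooth_on X V"
  shows "smooth_on X (\<lambda>z. dderiv g z (V z))"
proof -
  have "smooth_on X (\<lambda>z. \<Sum>b\<in>Basis. (V z \<bullet> b) *\<^sub>R dderiv g z b)"
    by (intro smooth_on_sum smooth_on_scaleR smooth_on_inner assms smooth_on_const smooth_onD(2))
  then show ?thesis
    by (subst smooth_on_cong[OF X]) (auto intro: dderiv_expand[OF assms(1)])
qed

text \<open>The product rule for differentiating a function twice, the first time along a direction that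
  itself depends on the point.\<close>

lemma has_derivative_dderiv_field:
  fixes g :: "'a \<Rightarrow> 'b::real_normed_vector"
  assumes g: "smooth_on X g" and z: "z \<in> X" and V: "(V has_derivative V') (at z)"
  shows "((\<lambda>x. dderiv g x (V x)) has_derivative
    (\<lambda>w. dderiv (\<lambda>x. dderiv g x (V z)) z w + dderiv g z (V' w))) (at z)"
proof -
  let ?D = "\<lambda>b. dderiv (\<lambda>x. dderiv g x b) z"
  have 1: "((\<lambda>x. \<Sum>b\<in>Basis. (V x \<bullet> b) *\<^sub>R dderiv g x b) has_derivative
      (\<lambda>w. \<Sum>b\<in>Basis. (V z \<bullet> b) *\<^sub>R ?D b w + (V' w \<bullet> b) *\<^sub>R dderiv g z b)) (at z)"
    by (intro has_derivative_sum has_derivative_scaleR smooth_onD(1)[OF smooth_onD(2)[OF g] z]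
        has_derivative_inner_left V)
  have 2: "((\<lambda>x. \<Sum>b\<in>Basis. (v \<bullet> b) *\<^sub>R dderiv g x b) has_derivative
      (\<lambda>w. \<Sum>b\<in>Basis. (v \<bullet> b) *\<^sub>R ?D b w)) (at z)" for v
    by (intro has_derivative_sum has_derivative_scaleR_right smooth_onD(1)[OF smooth_onD(2)[OF g] z])
  have 3: "dderiv (\<lambda>x. dderiv g x (V z)) z w = (\<Sum>b\<in>Basis. (V z \<bullet> b) *\<^sub>R ?D b w)" for w
    using dderiv_cong[of "\<lambda>x. dderiv g x (V z)", OF dderiv_expand[OF g] z] dderiv_eq[OF 2] by simp
  have "((\<lambda>x. dderiv g x (V x)) has_derivative
      (\<lambda>w. \<Sum>b\<in>Basis. (V z \<bullet> b) *\<^sub>R ?D b w + (V' w \<bullet> b) *\<^sub>R dderiv g z b)) (at z)"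
    by (rule has_derivative_transform_within_open[OF 1 X z]) (rule dderiv_expand[OF g, symmetric])
  then show ?thesis
    by (simp add: 3 sum.distrib dderiv_expand[OF g z, of "V' _"])
qed

end

text \<open>By the mean value theorem, the second difference over a small parallelogram evaluates either
  mixed derivative at a nearby point; the parallelogram then shrinks to a point.\<close>

lemma schwarz_real:
  fixes g :: "'a::euclidean_space \<Rightarrow> real"
  assumes X: "open X" and g: "smooth_on X g" and z: "z \<in> X"
  shows "dderiv (\<lambda>x. dderiv g x u) z w = dderiv (\<lambda>x. dderiv g x w) z u"
proof -
  have key: "\<exists>p q. dist p z < e \<and> dist q z < e \<and>
      dderiv (\<lambda>x. dderiv g x u) p w = dderiv (\<lambda>x. dderiv g x w) q u" if "e > 0" for e
  proof -
    obtain r where r: "r > 0" "ball z r \<subseteq> X" using X z by (auto simp: open_contains_ball)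
    define d where "d = min e r / (2 * (norm u + norm w + 1))"
    have pos: "norm u + norm w + 1 > 0" by (meson add_nonneg_pos add_nonneg_nonneg norm_ge_zero zero_less_one)
    have d: "d > 0" unfolding d_def using r that pos by (simp add: divide_pos_pos)
    define P where "P s t = z + s *\<^sub>R u + t *\<^sub>R w" for s t :: real
    have near: "dist (P s t) z < min e r" if "0 \<le> s" "s \<le> d" "0 \<le> t" "t \<le> d" for s t
    proof -
      have "dist (P s t) z \<le> norm (s *\<^sub>R u) + norm (t *\<^sub>R w)"
        unfolding P_def dist_norm by (metis add.assoc add_diff_cancel_left' norm_triangle_ineq)
      also have "\<dots> \<le> d * norm u + d * norm w"
        using that by (simp add: add_mono mult_right_mono)
      also have "\<dots> < d * (2 * (norm u + norm w + 1))"
        using d by (simp add: algebra_simps add_pos_nonneg)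
          (smt (verit) mult_nonneg_nonneg norm_ge_zero)
      also have "\<dots> = min e r" unfolding d_def using pos by simp
      finally show ?thesis .
    qed
    have inX: "P s t \<in> X" if "0 \<le> s" "s \<le> d" "0 \<le> t" "t \<le> d" for s t
      using near[OF that] r by (auto simp: dist_commute)
    have Ds: "((\<lambda>s. k (P s t)) has_real_derivative dderiv k (P s t) u) (at s)"
      if "0 \<le> s" "s \<le> d" "0 \<le> t" "t \<le> d" "smooth_on X k" for s t and k :: "'a \<Rightarrow> real"
    proof -
      have "((\<lambda>s. P s t) has_derivative (\<lambda>h. h *\<^sub>R u)) (at s)"
        unfolding P_def by (auto intro!: derivative_eq_intros)
      from has_derivative_compose[OF this smooth_onD(1)[OF that(5) inX[OF that(1-4)]]]
      show ?thesis
        using linear_cmul[OF linear_dderiv[OF that(5) inX[OF that(1-4)]]]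
        by (simp add: has_field_derivative_def mult_commute_abs)
    qed
    have Dt: "((\<lambda>t. k (P s t)) has_real_derivative dderiv k (P s t) w) (at t)"
      if "0 \<le> s" "s \<le> d" "0 \<le> t" "t \<le> d" "smooth_on X k" for s t and k :: "'a \<Rightarrow> real"
    proof -
      have "((\<lambda>t. P s t) has_derivative (\<lambda>h. h *\<^sub>R w)) (at t)"
        unfolding P_def by (auto intro!: derivative_eq_intros)
      from has_derivative_compose[OF this smooth_onD(1)[OF that(5) inX[OF that(1-4)]]]
      show ?thesis
        using linear_cmul[OF linear_dderiv[OF that(5) inX[OF that(1-4)]]]
        by (simp add: has_field_derivative_def mult_commute_abs)
    qed
    define \<Delta> where "\<Delta> = g (P d d) - g (P 0 d) - g (P d 0) + g (P 0 0)"
    \<comment> \<open>the second difference equals the mixed derivative, in either order, up to the factor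
       \<open>d * d\<close>, at some intermediate point\<close>
    have "\<exists>s>0. s < d \<and> (g (P d d) - g (P d 0)) - (g (P 0 d) - g (P 0 0)) =
        (d - 0) * (dderiv g (P s d) u - dderiv g (P s 0) u)"
      using d by (intro MVT2) (auto intro!: DERIV_diff Ds g)
    then obtain s where s: "0 < s" "s < d" "\<Delta> = d * (dderiv g (P s d) u - dderiv g (P s 0) u)"
      unfolding \<Delta>_def by (auto simp: algebra_simps)
    have "\<exists>t>0. t < d \<and> dderiv g (P s d) u - dderiv g (P s 0) u =
        (d - 0) * dderiv (\<lambda>x. dderiv g x u) (P s t) w"
      using d s by (intro MVT2) (auto intro!: Dt smooth_onD(2) g)
    then obtain t where t: "0 < t" "t < d" "\<Delta> = d * (d * dderiv (\<lambda>x. dderiv g x u) (P s t) w)"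
      using s by auto
    have "\<exists>t>0. t < d \<and> (g (P d d) - g (P 0 d)) - (g (P d 0) - g (P 0 0)) =
        (d - 0) * (dderiv g (P d t) w - dderiv g (P 0 t) w)"
      using d by (intro MVT2) (auto intro!: DERIV_diff Dt g)
    then obtain t' where t': "0 < t'" "t' < d" "\<Delta> = d * (dderiv g (P d t') w - dderiv g (P 0 t') w)"
      unfolding \<Delta>_def by (auto simp: algebra_simps)
    have "\<exists>s>0. s < d \<and> dderiv g (P d t') w - dderiv g (P 0 t') w =
        (d - 0) * dderiv (\<lambda>x. dderiv g x w) (P s t') u"
      using d t' by (intro MVT2) (auto intro!: Ds smooth_onD(2) g)
    then obtain s' where s': "0 < s'" "s' < d" "\<Delta> = d * (d * dderiv (\<lambda>x. dderiv g x w) (P s' t') u)"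
      using t' by auto
    have "dderiv (\<lambda>x. dderiv g x u) (P s t) w = dderiv (\<lambda>x. dderiv g x w) (P s' t') u"
      using t(3) s'(3) d by simp
    moreover have "dist (P s t) z < e" "dist (P s' t') z < e"
      using near[of s t] near[of s' t'] s t s' t' by auto
    ultimately show ?thesis by blast
  qed
  define a where "a = (\<lambda>x. dderiv (\<lambda>x. dderiv g x u) x w)"
  define b where "b = (\<lambda>x. dderiv (\<lambda>x. dderiv g x w) x u)"
  have ca: "isCont a z" and cb: "isCont b z"
    unfolding a_def b_def using X z g
    by (auto intro!: continuous_on_interior[of X] smooth_onD(3)[OF smooth_onD(2)[OF smooth_onD(2)]]
        simp: interior_open)
  have "\<exists>p q. dist p z < inverse (Suc n) \<and> dist q z < inverse (Suc n) \<and> a p = b q" for n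
    using key[of "inverse (Suc n)"] unfolding a_def b_def by simp
  then obtain p q where pq: "\<And>n. dist (p n) z < inverse (Suc n)" "\<And>n. dist (q n) z < inverse (Suc n)"
    "\<And>n. a (p n) = b (q n)" by metis
  have lim: "p \<longlonglongrightarrow> z" "q \<longlonglongrightarrow> z"
    using pq(1,2)
    by (auto intro!: metric_tendsto_imp_tendsto[OF LIMSEQ_inverse_real_of_nat] always_eventually
        intro: less_imp_le)
  have "(\<lambda>n. a (p n)) \<longlonglongrightarrow> a z" "(\<lambda>n. b (q n)) \<longlonglongrightarrow> b z"
    using ca cb lim by (auto intro: isCont_tendsto_compose)
  then have "a z = b z" using pq(3) LIMSEQ_unique by simp
  then show ?thesis unfolding a_def b_def .
qed

lemma dderiv_linear:
  assumes "bounded_linear T" "smooth_on X g" "z \<in> X"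
  shows "dderiv (\<lambda>x. T (g x)) z w = T (dderiv g z w)"
  by (rule dderiv_eq) (rule bounded_linear.has_derivative[OF assms(1) smooth_onD(1)[OF assms(2,3)]])

lemma schwarz:
  fixes g :: "'a::euclidean_space \<Rightarrow> 'b::euclidean_space"
  assumes X: "open X" and g: "smooth_on X g" and z: "z \<in> X"
  shows "dderiv (\<lambda>x. dderiv g x u) z w = dderiv (\<lambda>x. dderiv g x w) z u"
proof (rule euclidean_eqI)
  fix b :: 'b assume "b \<in> Basis"
  let ?gb = "\<lambda>x. g x \<bullet> b"
  have bl: "bounded_linear (\<lambda>x. x \<bullet> b)" by (rule bounded_linear_inner_left)
  have gb: "smooth_on X ?gb" by (rule smooth_on_linear[OF X bl g])
  have *: "dderiv (\<lambda>x. dderiv ?gb x u) z w = dderiv (\<lambda>x. dderiv g x u) z w \<bullet> b" for u w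
  proof -
    have "dderiv (\<lambda>x. dderiv ?gb x u) z = dderiv (\<lambda>x. dderiv g x u \<bullet> b) z"
      by (rule dderiv_cong[OF X _ z]) (rule dderiv_linear[OF bl g])
    then show ?thesis using dderiv_linear[OF bl smooth_onD(2)[OF g] z] by simp
  qed
  show "dderiv (\<lambda>x. dderiv g x u) z w \<bullet> b = dderiv (\<lambda>x. dderiv g x w) z u \<bullet> b"
    using schwarz_real[OF X gb z, of u w] by (simp add: *)
qed

text \<open>This turns computations with second derivatives into computations with brackets of vector
  fields.\<close>

lemma commutator_lie_bracket:
  fixes g :: "'a::euclidean_space \<Rightarrow> 'b::euclidean_space"
  assumes X: "open X" and g: "smooth_on X g" and V: "smooth_on X V" and W: "smooth_on X W"
    and z: "z \<in> X"
  shows "dderiv (\<lambda>x. dderiv g x (W x)) z (V z) - dderiv (\<lambda>x. dderiv g x (V x)) z (W z) =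
    dderiv g z (lie_bracket V W z)"
proof -
  interpret linear "dderiv g z" by (rule linear_dderiv[OF g z])
  show ?thesis
    using dderiv_eq[OF has_derivative_dderiv_field[OF X g z smooth_onD(1)[OF V z]]]
      dderiv_eq[OF has_derivative_dderiv_field[OF X g z smooth_onD(1)[OF W z]]]
      schwarz[OF X g z, of "V z" "W z"]
    by (simp add: lie_bracket_def diff)
qed

lemma dderiv_const: "dderiv (\<lambda>x. c) z w = 0"
  by (rule dderiv_eq) (rule has_derivative_const)

context
  fixes X :: "'a::euclidean_space set" and z :: 'a
  assumes z: "z \<in> X"
begin

lemma dderiv_diff:
  "smooth_on X g \<Longrightarrow> smooth_on X k \<Longrightarrow> dderiv (\<lambda>x. g x - k x) z w = dderiv g z w - dderiv k z w"
  by (rule dderiv_eq) (intro has_derivative_diff smooth_onD(1)[OF _ z])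

lemma dderiv_bilinear:
  "bounded_bilinear p \<Longrightarrow> smooth_on X g \<Longrightarrow> smooth_on X k \<Longrightarrow>
    dderiv (\<lambda>x. p (g x) (k x)) z w = p (g z) (dderiv k z w) + p (dderiv g z w) (k z)"
  by (rule dderiv_eq) (intro bounded_bilinear.FDERIV smooth_onD(1)[OF _ z])

lemmas dderiv_scaleR = dderiv_bilinear[OF bounded_bilinear_scaleR]
  and dderiv_mult = dderiv_bilinear[OF bounded_bilinear_mult]

lemma dderiv_sum:
  "(\<And>i. i \<in> I \<Longrightarrow> smooth_on X (g i)) \<Longrightarrow> dderiv (\<lambda>x. \<Sum>i\<in>I. g i x) z w = (\<Sum>i\<in>I. dderiv (g i) z w)"
  by (rule dderiv_eq) (intro has_derivative_sum smooth_onD(1)[OF _ z])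

lemma dderiv_Pair:
  "smooth_on X g \<Longrightarrow> smooth_on X k \<Longrightarrow> dderiv (\<lambda>x. (g x, k x)) z w = (dderiv g z w, dderiv k z w)"
  by (rule dderiv_eq) (intro has_derivative_Pair smooth_onD(1)[OF _ z])

lemma dderiv_plus: "smooth_on X g \<Longrightarrow> dderiv g z (u + w) = dderiv g z u + dderiv g z w"
  and dderiv_minus: "smooth_on X g \<Longrightarrow> dderiv g z (u - w) = dderiv g z u - dderiv g z w"
  and dderiv_scale: "smooth_on X g \<Longrightarrow> dderiv g z (r *\<^sub>R w) = r *\<^sub>R dderiv g z w"
  and dderiv_uminus: "smooth_on X g \<Longrightarrow> dderiv g z (- w) = - dderiv g z w"
  using linear_add[OF linear_dderiv] linear_diff[OF linear_dderiv] linear_scale[OF linear_dderiv]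
    linear_neg[OF linear_dderiv] z by blast+

lemma dderiv_zero: "smooth_on X g \<Longrightarrow> dderiv g z 0 = 0"
  using linear_0[OF linear_dderiv] z by blast

end

lemma dderiv_field:
  fixes g :: "'a::euclidean_space \<Rightarrow> 'b::real_normed_vector"
  assumes "open X" "z \<in> X" "smooth_on X g" "smooth_on X V"
  shows "dderiv (\<lambda>x. dderiv g x (V x)) z w =
    dderiv (\<lambda>x. dderiv g x (V z)) z w + dderiv g z (dderiv V z w)"
  using assms by (intro dderiv_eq has_derivative_dderiv_field[of X] smooth_onD(1)[of X])

lemma dderiv_snd: "dderiv snd z w = snd w"
  by (auto intro!: dderiv_eq bounded_linear_imp_has_derivative bounded_linear_snd)

section \<open>The Jacobi endomorphism in induced coordinates\<close>

text \<open>The coordinate form of a spray, on the part of the tangent bundle over the open set \<open>U\<close> where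
  \<open>y \<noteq> 0\<close>.\<close>

locale local_spray =
  fixes U :: "'e::euclidean_space set" and S :: "'e \<times> 'e \<Rightarrow> 'e \<times> 'e"
  assumes open_U: "open U"
    and smooth_S: "smooth_on (U \<times> - {0}) S"
    and fst_S: "z \<in> U \<times> - {0} \<Longrightarrow> fst (S z) = snd z"
    and bracket_S: "z \<in> U \<times> - {0} \<Longrightarrow> lie_bracket CC S z = S z"
begin

abbreviation "D \<equiv> U \<times> - {0 :: 'e}"

text \<open>In the usual notation \<open>f = - 2 G\<close>, and \<open>P a = - N a\<close> where \<open>N\<close> is the matrix of the
  \<open>\<partial>G\<^sup>j / \<partial>y\<^sup>i\<close>; the signs are chosen so that \<open>hor a\<close>, the field \<open>\<delta>\<^sub>a\<close>, is \<open>(a, P a)\<close>.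
  The vector \<open>\<Phi> a\<close> has the components \<open>R\<^sup>i\<^sub>j a\<^sup>j\<close>.\<close>

definition f :: "'e \<times> 'e \<Rightarrow> 'e" where "f z = snd (S z)"

definition P :: "'e \<Rightarrow> 'e \<times> 'e \<Rightarrow> 'e" where "P a z = (1/2) *\<^sub>R dderiv f z (0, a)"

definition hor :: "'e \<Rightarrow> 'e \<times> 'e \<Rightarrow> 'e \<times> 'e" where "hor a z = (a, P a z)"

definition \<Phi> :: "'e \<Rightarrow> 'e \<times> 'e \<Rightarrow> 'e" where
  "\<Phi> a z = dderiv (P a) z (S z) - dderiv f z (a, 0) - P (P a z) z"

lemma open_D: "open D"
  by (intro open_Times open_U open_Compl closed_singleton)

lemma smooth_f: "smooth_on D f"
  unfolding f_def by (rule smooth_on_snd[OF open_D smooth_S])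

lemma S_eq: "z \<in> D \<Longrightarrow> S z = (snd z, f z)"
  unfolding f_def using fst_S by (metis prod.collapse)

lemma smooth_y: "smooth_on D snd"
  using smooth_on_snd[OF open_D smooth_on_id[OF open_D]] by simp

lemma smooth_P: "smooth_on D (P a)"
  unfolding P_def by (intro smooth_on_scaleR smooth_on_const smooth_onD(2) smooth_f open_D)

lemma smooth_P_field: "smooth_on D V \<Longrightarrow> smooth_on D (\<lambda>z. P (V z) z)"
  unfolding P_def
  by (intro smooth_on_scaleR smooth_on_const smooth_on_dderiv_field smooth_on_Pair smooth_f open_D)

lemma smooth_hor: "smooth_on D (hor a)"
  unfolding hor_def by (intro smooth_on_Pair smooth_on_const smooth_P open_D)

lemma smooth_ver: "smooth_on D (\<lambda>_. (0, a))"
  by (rule smooth_on_const[OF open_D])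

lemma smooth_\<Phi>: "smooth_on D (\<Phi> a)"
  unfolding \<Phi>_def
  by (intro smooth_on_diff smooth_on_dderiv_field smooth_P smooth_P_field smooth_S smooth_onD(2)
      smooth_f open_D)

lemma linear_P: "z \<in> D \<Longrightarrow> linear (\<lambda>a. P a z)"
proof (rule linearI)
  fix a b :: 'e and r :: real assume z: "z \<in> D"
  show "P (a + b) z = P a z + P b z"
    using dderiv_plus[OF z smooth_f, of "(0, a)" "(0, b)"] by (simp add: P_def scaleR_right_distrib)
  show "P (r *\<^sub>R a) z = r *\<^sub>R P a z"
    using dderiv_scale[OF z smooth_f, of r "(0, a)"] by (simp add: P_def)
qed

lemmas P_plus = linear_add[OF linear_P] and P_scale = linear_scale[OF linear_P]
  and P_minus = linear_diff[OF linear_P] and P_uminus = linear_neg[OF linear_P]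

lemma dderiv_P_field:
  assumes "z \<in> D" "smooth_on D V"
  shows "dderiv (\<lambda>x. P (V x) x) z w = dderiv (P (V z)) z w + P (dderiv V z w) z"
proof -
  have sm: "smooth_on D (\<lambda>x. dderiv f x (0, V x))"
    by (intro smooth_on_dderiv_field smooth_on_Pair smooth_on_const smooth_f open_D assms)
  have "dderiv (\<lambda>x. P (V x) x) z w = (1/2) *\<^sub>R dderiv (\<lambda>x. dderiv f x (0, V x)) z w"
    unfolding P_def by (rule dderiv_linear[OF bounded_linear_scaleR_right sm assms(1)])
  also have "\<dots> = (1/2) *\<^sub>R (dderiv (\<lambda>x. dderiv f x (0, V z)) z w + dderiv f z (dderiv (\<lambda>x. (0, V x)) z w))"
    by (subst dderiv_field[OF open_D assms(1) smooth_f])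
      (auto intro!: smooth_on_Pair smooth_on_const open_D assms)
  also have "dderiv (\<lambda>x. (0, V x)) z w = (0, dderiv V z w)"
    by (subst dderiv_Pair[OF assms(1)]) (auto intro!: smooth_on_const open_D assms simp: dderiv_const)
  also have "(1/2) *\<^sub>R (dderiv (\<lambda>x. dderiv f x (0, V z)) z w + dderiv f z (0, dderiv V z w)) =
      dderiv (P (V z)) z w + P (dderiv V z w) z"
    unfolding P_def
    by (subst dderiv_linear[OF bounded_linear_scaleR_right smooth_onD(2)[OF smooth_f] assms(1)])
      (simp add: scaleR_right_distrib)
  finally show ?thesis .
qed

lemma dderiv_P: "z \<in> D \<Longrightarrow> dderiv (P a) z w = (1/2) *\<^sub>R dderiv (\<lambda>x. dderiv f x (0, a)) z w"
  unfolding P_def by (rule dderiv_linear[OF bounded_linear_scaleR_right smooth_onD(2)[OF smooth_f]])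

lemma dderiv_P_sym: "z \<in> D \<Longrightarrow> dderiv (P a) z (0, b) = dderiv (P b) z (0, a)"
  using schwarz[OF open_D smooth_f, of z "(0, a)" "(0, b)"] by (simp add: dderiv_P)

text \<open>The condition \<open>[\<C>, S] = S\<close> is Euler's relation for \<open>f\<close>, which is 2-homogeneous. The relations
  below for \<open>P\<close>, which is 1-homogeneous, are its derivatives.\<close>

lemma euler_f:
  assumes z: "z \<in> D"
  shows "dderiv f z (0, snd z) = 2 *\<^sub>R f z"
proof -
  have 1: "dderiv f z (0, snd z) = snd (dderiv S z (0, snd z))"
    unfolding f_def by (rule dderiv_linear[OF bounded_linear_snd smooth_S z])
  have 2: "dderiv CC z (S z) = (0, snd (S z))"
    unfolding CC_def
    by (rule dderiv_eq) (auto intro!: derivative_eq_intros)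
  have "dderiv S z (0, snd z) = S z + (0, snd (S z))"
    using bracket_S[OF z] unfolding lie_bracket_def 2 by (simp add: CC_def diff_eq_eq)
  then show ?thesis
    unfolding 1 by (simp add: f_def scaleR_2)
qed

lemma P_y: "z \<in> D \<Longrightarrow> P (snd z) z = f z"
  unfolding P_def by (simp add: euler_f)

lemma dderiv_f_split: "z \<in> D \<Longrightarrow> dderiv f z (a, b) = dderiv f z (a, 0) + 2 *\<^sub>R P b z"
  unfolding P_def using dderiv_plus[OF _ smooth_f, of z "(a, 0)" "(0, b)"] by simp

lemma dderiv_P_y:
  assumes z: "z \<in> D"
  shows "dderiv (P (snd z)) z (a, b) = dderiv f z (a, 0) + P b z"
proof -
  have "dderiv f z (a, b) = dderiv (\<lambda>x. P (snd x) x) z (a, b)"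
    using dderiv_cong[OF open_D _ z, of f "\<lambda>x. P (snd x) x"] P_y by auto
  also have "\<dots> = dderiv (P (snd z)) z (a, b) + P b z"
    using dderiv_P_field[OF z smooth_y, of "(a, b)"] by (simp add: dderiv_snd)
  finally show ?thesis using dderiv_f_split[OF z, of a b] by (simp add: scaleR_2 eq_diff_eq add.assoc[symmetric])
qed

lemma euler_P: "z \<in> D \<Longrightarrow> dderiv (P a) z (0, snd z) = P a z"
  using dderiv_P_sym[of z a "snd z"] dderiv_P_y[of z 0 a] dderiv_zero[OF _ smooth_f, of z]
  by (simp add: zero_prod_def)

lemma hor_y: "z \<in> D \<Longrightarrow> hor (snd z) z = S z"
  unfolding hor_def by (simp add: P_y S_eq)

subsection \<open>Brackets\<close>

lemma dderiv_S: "z \<in> D \<Longrightarrow> dderiv S z w = (snd w, dderiv f z w)"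
proof -
  assume z: "z \<in> D"
  have "dderiv S z w = dderiv (\<lambda>x. (snd x, f x)) z w"
    using dderiv_cong[OF open_D _ z, of S "\<lambda>x. (snd x, f x)"] S_eq by simp
  also have "\<dots> = (snd w, dderiv f z w)"
    by (subst dderiv_Pair[OF z smooth_y smooth_f]) (simp add: dderiv_snd)
  finally show ?thesis .
qed

lemma dderiv_hor: "z \<in> D \<Longrightarrow> dderiv (hor a) z w = (0, dderiv (P a) z w)"
  unfolding hor_def
  by (subst dderiv_Pair[OF _ smooth_on_const[OF open_D] smooth_P]) (auto simp: dderiv_const)

lemma bracket_S_hor:
  "z \<in> D \<Longrightarrow> lie_bracket S (hor a) z = hor (- P a z) z + (0, \<Phi> a z)"
  unfolding lie_bracket_def
  by (simp add: dderiv_S dderiv_hor hor_def dderiv_f_split[of z a "P a z"] \<Phi>_def P_uminus scaleR_2)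

lemma bracket_S_ver:
  "z \<in> D \<Longrightarrow> lie_bracket S (\<lambda>_. (0, a)) z = - (hor a z + (0, P a z))"
  unfolding lie_bracket_def
  by (simp add: dderiv_S dderiv_const hor_def P_def scaleR_right_distrib[symmetric] scaleR_2[symmetric])

lemma bracket_ver_hor:
  "z \<in> D \<Longrightarrow> lie_bracket (\<lambda>_. (0, b)) (hor a) z = (0, dderiv (P a) z (0, b))"
  unfolding lie_bracket_def by (simp add: dderiv_const dderiv_hor)

text \<open>The curvature of the nonlinear connection: horizontal fields do not commute, and \<open>\<Omega>\<close> is the
  vertical field measuring this.\<close>

definition \<Omega> :: "'e \<Rightarrow> 'e \<Rightarrow> 'e \<times> 'e \<Rightarrow> 'e" where
  "\<Omega> a b z = dderiv (P b) z (hor a z) - dderiv (P a) z (hor b z)"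

lemma bracket_hor_hor: "z \<in> D \<Longrightarrow> lie_bracket (hor a) (hor b) z = (0, \<Omega> a b z)"
  unfolding lie_bracket_def \<Omega>_def by (simp add: dderiv_hor)

text \<open>The brackets are used through the following rules for exchanging derivatives of a function.\<close>

lemma swap_S_ver:
  fixes g :: "_ \<Rightarrow> 'b::euclidean_space"
  assumes "z \<in> D" "smooth_on D g"
  shows "dderiv (\<lambda>x. dderiv g x (S x)) z (0, b) =
    dderiv (\<lambda>x. dderiv g x (0, b)) z (S z) + dderiv g z (hor b z) + dderiv g z (0, P b z)"
  using commutator_lie_bracket[OF open_D assms(2) smooth_S smooth_ver[of b] assms(1)]
  unfolding bracket_S_ver[OF assms(1)] dderiv_uminus[OF assms] dderiv_plus[OF assms]
  by (simp add: algebra_simps)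

lemma swap_ver_hor:
  fixes g :: "_ \<Rightarrow> 'b::euclidean_space"
  assumes "z \<in> D" "smooth_on D g"
  shows "dderiv (\<lambda>x. dderiv g x (hor a x)) z (0, b) =
    dderiv (\<lambda>x. dderiv g x (0, b)) z (hor a z) + dderiv g z (0, dderiv (P a) z (0, b))"
  using commutator_lie_bracket[OF open_D assms(2) smooth_ver[of b] smooth_hor[of a] assms(1)]
  by (simp add: bracket_ver_hor assms algebra_simps)

lemma swap_hor_hor:
  fixes g :: "_ \<Rightarrow> 'b::euclidean_space"
  assumes "z \<in> D" "smooth_on D g"
  shows "dderiv (\<lambda>x. dderiv g x (hor b x)) z (hor a z) - dderiv (\<lambda>x. dderiv g x (hor a x)) z (hor b z) =
    dderiv g z (0, \<Omega> a b z)"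
  using commutator_lie_bracket[OF open_D assms(2) smooth_hor[of a] smooth_hor[of b] assms(1)]
  by (simp add: bracket_hor_hor assms algebra_simps)

lemma swap_S_hor:
  fixes g :: "_ \<Rightarrow> 'b::euclidean_space"
  assumes "z \<in> D" "smooth_on D g"
  shows "dderiv (\<lambda>x. dderiv g x (hor a x)) z (S z) - dderiv (\<lambda>x. dderiv g x (S x)) z (hor a z) =
    dderiv g z (hor (- P a z) z) + dderiv g z (0, \<Phi> a z)"
  using commutator_lie_bracket[OF open_D assms(2) smooth_S smooth_hor[of a] assms(1)]
  unfolding bracket_S_hor[OF assms(1)] dderiv_plus[OF assms] .

lemma dderiv_hor_split:
  fixes g :: "_ \<Rightarrow> 'b::euclidean_space"
  assumes "z \<in> D" "smooth_on D g"
  shows "dderiv g z (a, 0) = dderiv g z (hor a z) - dderiv g z (0, P a z)"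
  using dderiv_minus[OF assms, of "hor a z" "(0, P a z)"] by (simp add: hor_def)

subsection \<open>Identification with the invariantly defined objects\<close>

lemma lie_endo_JJ:
  assumes z: "z \<in> D"
  shows "lie_endo S JJ z w = (- fst w, snd w - 2 *\<^sub>R P (fst w) z)"
  using z unfolding lie_endo_def lie_bracket_def JJ_def
  by (simp add: dderiv_const dderiv_S P_def)

lemma hproj_eq: "z \<in> D \<Longrightarrow> hproj S z w = hor (fst w) z"
  unfolding hproj_def by (cases w) (simp add: lie_endo_JJ hor_def scaleR_2[symmetric])

lemma vproj_eq: "z \<in> D \<Longrightarrow> vproj S z w = (0, snd w - P (fst w) z)"
  unfolding vproj_def
  by (cases w) (simp add: lie_endo_JJ scaleR_right_distrib scaleR_right_diff_distrib flip: scaleR_left_distrib)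

lemma jacobi_endo_eq:
  assumes z: "z \<in> D"
  shows "jacobi_endo S z w = (0, \<Phi> (fst w) z)"
proof -
  have "dderiv (\<lambda>x. hproj S x w) z = dderiv (hor (fst w)) z"
    by (rule dderiv_cong[OF open_D _ z]) (rule hproj_eq)
  then have "lie_endo S (hproj S) z w = lie_bracket S (hor (fst w)) z - hor (fst (lie_bracket S (\<lambda>_. w) z)) z"
    unfolding lie_endo_def lie_bracket_def using z by (simp add: hproj_eq)
  then show ?thesis
    unfolding jacobi_endo_def using z
    by (simp add: vproj_eq bracket_S_hor hor_def P_minus P_plus P_uminus)
qed

lemma Ric_eq: "z \<in> D \<Longrightarrow> Ric S z = (\<Sum>b\<in>Basis. \<Phi> b z \<bullet> b)"
  unfolding Ric_def semibasic_trace_def by (simp add: jacobi_endo_eq)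

lemma smooth_Ric: "smooth_on D (Ric S)"
  using smooth_on_cong[OF open_D Ric_eq]
  by (auto intro!: smooth_on_sum smooth_on_inner smooth_on_const smooth_\<Phi> open_D)

lemma smooth_ricci_scalar: "smooth_on D (ricci_scalar S)"
  unfolding ricci_scalar_def
  using smooth_on_mult[OF open_D smooth_Ric smooth_on_const[OF open_D, of "inverse (real DIM('e) - 1)"]]
  by (simp add: divide_inverse)

subsection \<open>Identities of the Jacobi endomorphism\<close>

lemma \<Phi>_y: "z \<in> D \<Longrightarrow> \<Phi> (snd z) z = 0"
  unfolding \<Phi>_def by (simp add: P_y S_eq dderiv_P_y)

text \<open>The terms are arranged so that both the antisymmetric part in \<open>a, b\<close> and the contraction
  \<open>b = y\<close> can be read off.\<close>

lemma dderiv_\<Phi>_ver: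
  assumes z: "z \<in> D"
  shows "dderiv (\<Phi> a) z (0, b) = dderiv (\<lambda>x. dderiv (P a) x (0, b)) z (S z)
    + dderiv (P a) z (hor b z) + dderiv (P a) z (0, P b z)
    - 2 *\<^sub>R dderiv (P b) z (hor a z) + dderiv (P b) z (0, P a z) - P (dderiv (P a) z (0, b)) z"
proof -
  have 1: "dderiv (\<lambda>x. dderiv f x (a, 0)) z (0, b) = 2 *\<^sub>R dderiv (P b) z (a, 0)"
    using schwarz[OF open_D smooth_f z, of "(a, 0)" "(0, b)"]
      dderiv_linear[OF bounded_linear_scaleR_right smooth_onD(2)[OF smooth_f] z, of "1/2"]
    unfolding P_def by simp
  have s1: "smooth_on D (\<lambda>x. dderiv (P a) x (S x))"
    by (intro smooth_on_dderiv_field smooth_P smooth_S open_D)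
  have s2: "smooth_on D (\<lambda>x. dderiv f x (a, 0))"
    by (rule smooth_onD(2)[OF smooth_f])
  have "dderiv (\<Phi> a) z (0, b) = dderiv (\<lambda>x. dderiv (P a) x (S x)) z (0, b)
    - dderiv (\<lambda>x. dderiv f x (a, 0)) z (0, b) - dderiv (\<lambda>x. P (P a x) x) z (0, b)"
    unfolding \<Phi>_def
    by (simp only: dderiv_diff[OF z smooth_on_diff[OF open_D s1 s2] smooth_P_field[OF smooth_P]]
        dderiv_diff[OF z s1 s2])
  then show ?thesis
    by (simp add: 1 swap_S_ver[OF z smooth_P] dderiv_P_field[OF z smooth_P] dderiv_hor_split[OF z smooth_P, of b a]
        dderiv_P_sym[OF z, of "P a z"] scaleR_2 algebra_simps)
qed

text \<open>The curvature is recovered from the Jacobi endomorphism: this is the identity \<open>[J, \<Phi>] = 3 \<Omega>\<close>, up to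
  sign conventions, obtained by antisymmetrizing the previous formula, in which the symmetric terms drop out.\<close>

lemma \<Omega>_eq:
  assumes z: "z \<in> D"
  shows "3 *\<^sub>R \<Omega> a b z = dderiv (\<Phi> b) z (0, a) - dderiv (\<Phi> a) z (0, b)"
proof -
  have "dderiv (\<lambda>x. dderiv (P b) x (0, a)) z = dderiv (\<lambda>x. dderiv (P a) x (0, b)) z"
    by (rule dderiv_cong[OF open_D _ z]) (rule dderiv_P_sym)
  then show ?thesis
    unfolding dderiv_\<Phi>_ver[OF z] \<Omega>_def
    by (simp add: dderiv_P_sym[OF z, of b a] scaleR_2 algebra_simps)
      (simp add: scaleR_left_distrib[of 1 2, simplified] scaleR_2)
qed

text \<open>Homogeneity of \<open>\<Phi>\<close> of degree 2, in infinitesimal form; \<open>\<delta>\<^sub>y = S\<close> makes the contraction of the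
  formula above collapse.\<close>

lemma euler_\<Phi>:
  assumes z: "z \<in> D"
  shows "dderiv (\<Phi> a) z (0, snd z) = 2 *\<^sub>R \<Phi> a z"
proof -
  have "dderiv (P a) z (S z) = dderiv (\<lambda>x. dderiv (P a) x (0, snd x)) z (S z)"
    using dderiv_cong[OF open_D _ z, of "P a" "\<lambda>x. dderiv (P a) x (0, snd x)"] euler_P by simp
  also have "\<dots> = dderiv (\<lambda>x. dderiv (P a) x (0, snd z)) z (S z) + dderiv (P a) z (dderiv (\<lambda>x. (0, snd x)) z (S z))"
    by (rule dderiv_field[OF open_D z smooth_P]) (intro smooth_on_Pair smooth_on_const smooth_y open_D)
  also have "dderiv (\<lambda>x. (0, snd x)) z (S z) = (0, f z)"
    by (subst dderiv_Pair[OF z smooth_on_const[OF open_D] smooth_y]) (simp add: dderiv_const dderiv_snd S_eq[OF z])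
  \<comment> \<open>Here the second argument stays frozen at \<open>snd z\<close>, whereas Euler's relation lets it vary; the
     difference is the term with \<open>f\<close>.\<close>
  finally have *: "dderiv (\<lambda>x. dderiv (P a) x (0, snd z)) z (S z) = dderiv (P a) z (S z) - dderiv (P a) z (0, f z)"
    by simp
  have h: "dderiv (P (snd z)) z (hor a z) = dderiv f z (a, 0) + P (P a z) z"
    unfolding hor_def by (rule dderiv_P_y[OF z])
  have v: "dderiv (P (snd z)) z (0, P a z) = P (P a z) z"
    using dderiv_P_y[OF z, of 0 "P a z"] dderiv_zero[OF z smooth_f] by (simp add: zero_prod_def)
  show ?thesis
    unfolding dderiv_\<Phi>_ver[OF z] * h v hor_y[OF z] P_y[OF z] euler_P[OF z]
    by (simp add: \<Phi>_def scaleR_2 algebra_simps)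
qed

text \<open>Since \<open>\<Omega> a b = \<delta>\<^sub>a (P b) - \<delta>\<^sub>b (P a)\<close>, the cyclic sum on the left pairs up into commutators
  \<open>[\<delta>\<^sub>c, \<delta>\<^sub>a]\<close> acting on \<open>P b\<close>, and these are derivatives along \<open>\<Omega> c a\<close>.\<close>

lemma bianchi:
  assumes z: "z \<in> D"
  shows "dderiv (\<Omega> a b) z (hor c z) + dderiv (\<Omega> b c) z (hor a z) + dderiv (\<Omega> c a) z (hor b z) =
    dderiv (P c) z (0, \<Omega> a b z) + dderiv (P a) z (0, \<Omega> b c z) + dderiv (P b) z (0, \<Omega> c a z)"
proof -
  have *: "dderiv (\<Omega> a b) z w = dderiv (\<lambda>x. dderiv (P b) x (hor a x)) z w - dderiv (\<lambda>x. dderiv (P a) x (hor b x)) z w" for a b w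
    unfolding \<Omega>_def by (rule dderiv_diff[OF z]) (intro smooth_on_dderiv_field smooth_P smooth_hor open_D)+
  show ?thesis
    unfolding * swap_hor_hor[OF z smooth_P, symmetric] by (simp add: algebra_simps)
qed

end

section \<open>Functions on the slit tangent bundle of a coordinate domain\<close>

text \<open>The hypothesis says that \<open>g / L\<close> has derivative 0 along the fibre; a punctured fibre is connected
  from dimension 2 on.\<close>

lemma fiber_proportional:
  fixes g L :: "'e::euclidean_space \<times> 'e \<Rightarrow> real"
  assumes dim: "DIM('e) \<ge> 2"
    and g: "smooth_on (U \<times> - {0}) g" and L: "smooth_on (U \<times> - {0}) L"
    and L0: "\<And>z. z \<in> U \<times> - {0} \<Longrightarrow> L z \<noteq> 0"
    and ratio: "\<And>z a. z \<in> U \<times> - {0} \<Longrightarrow> L z * dderiv g z (0, a) = g z * dderiv L z (0, a)"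
    and x: "x \<in> U" and y: "y \<noteq> 0" "y' \<noteq> 0"
  shows "g (x, y) / L (x, y) = g (x, y') / L (x, y')"
proof (rule has_derivative_zero_unique_connected[where f = "\<lambda>y. g (x, y) / L (x, y)"])
  show "open (- {0 :: 'e})" by (intro open_Compl closed_singleton)
  show "connected (- {0 :: 'e})" using dim by (intro connected_punctured_universe)
  show "y \<in> - {0}" "y' \<in> - {0}" using y by auto
  fix y :: 'e assume "y \<in> - {0}"
  then have z: "(x, y) \<in> U \<times> - {0}" using x by auto
  have d: "((\<lambda>y. k (x, y)) has_derivative (\<lambda>a. dderiv k (x, y) (0, a))) (at y)"
    if "smooth_on (U \<times> - {0}) k" for k :: "'e \<times> 'e \<Rightarrow> real"
  proof -
    have "((\<lambda>y. (x, y)) has_derivative (\<lambda>a. (0, a))) (at y)"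
      by (auto intro!: derivative_eq_intros)
    from has_derivative_compose[OF this, of k "dderiv k (x, y)"] smooth_onD(1)[OF that z]
    show ?thesis by simp
  qed
  show "((\<lambda>y. g (x, y) / L (x, y)) has_derivative (\<lambda>h. 0)) (at y)"
    by (rule has_derivative_eq_rhs[OF has_derivative_divide[OF d[OF g] d[OF L] L0[OF z]]])
      (use ratio[OF z] L0[OF z] in \<open>simp add: fun_eq_iff divide_simps\<close>, simp add: algebra_simps)
qed

lemma homogeneous_of_euler:
  fixes g :: "'e::euclidean_space \<times> 'e \<Rightarrow> real"
  assumes g: "smooth_on (U \<times> - {0}) g"
    and euler: "\<And>z. z \<in> U \<times> - {0} \<Longrightarrow> dderiv g z (0, snd z) = 2 * g z"
    and x: "x \<in> U" "y \<noteq> 0" and t: "t > 0"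
  shows "g (x, t *\<^sub>R y) = t\<^sup>2 * g (x, y)"
proof -
  have "\<exists>c. \<forall>s\<in>{0<..}. g (x, s *\<^sub>R y) / s\<^sup>2 = c"
  proof (rule has_field_derivative_zero_constant)
    fix s :: real assume s: "s \<in> {0<..}"
    then have z: "(x, s *\<^sub>R y) \<in> U \<times> - {0}" using x by auto
    have "((\<lambda>s. g (x, s *\<^sub>R y)) has_derivative (\<lambda>h. dderiv g (x, s *\<^sub>R y) (0, h *\<^sub>R y))) (at s)"
    proof -
      have "((\<lambda>s. (x, s *\<^sub>R y)) has_derivative (\<lambda>h. (0, h *\<^sub>R y))) (at s)"
        by (auto intro!: derivative_eq_intros)
      from has_derivative_compose[OF this, of g "dderiv g (x, s *\<^sub>R y)"] smooth_onD(1)[OF g z]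
      show ?thesis by simp
    qed
    moreover have "dderiv g (x, s *\<^sub>R y) (0, h *\<^sub>R y) = 2 * g (x, s *\<^sub>R y) / s * h" for h
      using euler[OF z] dderiv_scale[OF z g, of s "(0, y)"] dderiv_scale[OF z g, of h "(0, y)"] s
      by (simp add: field_simps)
    ultimately have "((\<lambda>s. g (x, s *\<^sub>R y)) has_real_derivative 2 * g (x, s *\<^sub>R y) / s) (at s)"
      by (simp only: has_field_derivative_def)
    then show "((\<lambda>s. g (x, s *\<^sub>R y) / s\<^sup>2) has_real_derivative 0) (at s within {0<..})"
      by (rule DERIV_cong[OF DERIV_divide[OF DERIV_subset]])
        (use s in \<open>auto intro!: derivative_eq_intros simp: power2_eq_square field_simps\<close>)
  qed (simp add: convex_real_interval)
  then obtain c where "\<forall>s\<in>{0<..}. g (x, s *\<^sub>R y) / s\<^sup>2 = c" ..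
  from bspec[OF this, of t] bspec[OF this, of 1] t show ?thesis by (simp add: field_simps)
qed

lemma euler_of_homogeneous:
  fixes g :: "'e::euclidean_space \<times> 'e \<Rightarrow> real"
  assumes g: "smooth_on (U \<times> - {0}) g" and z: "z \<in> U \<times> - {0}"
    and hom: "\<And>t. t > 0 \<Longrightarrow> g (fst z, t *\<^sub>R snd z) = t\<^sup>2 * g z"
  shows "dderiv g z (0, snd z) = 2 * g z"
proof -
  obtain x y where xy: "z = (x, y)" by fastforce
  have "((\<lambda>s. g (x, s *\<^sub>R y)) has_derivative (\<lambda>h. dderiv g z (0, h *\<^sub>R y))) (at 1)"
  proof -
    have "((\<lambda>s. (x, s *\<^sub>R y)) has_derivative (\<lambda>h. (0, h *\<^sub>R y))) (at 1)"
      by (auto intro!: derivative_eq_intros)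
    from has_derivative_compose[OF this, of g "dderiv g z"] smooth_onD(1)[OF g z]
    show ?thesis by (simp add: xy)
  qed
  moreover have "((\<lambda>s. g (x, s *\<^sub>R y)) has_derivative (\<lambda>h. h * (2 * g z))) (at 1)"
  proof (rule has_derivative_transform_within_open)
    show "((\<lambda>s::real. s\<^sup>2 * g z) has_derivative (\<lambda>h. h * (2 * g z))) (at 1)"
      by (auto intro!: derivative_eq_intros)
    show "open {0::real<..}" "(1::real) \<in> {0<..}" by auto
    show "s\<^sup>2 * g z = g (x, s *\<^sub>R y)" if "s \<in> {0<..}" for s
      using hom[of s] that by (simp add: xy)
  qed
  ultimately have "(\<lambda>h. dderiv g z (0, h *\<^sub>R y)) = (\<lambda>h. h * (2 * g z))"
    by (rule has_derivative_unique)
  from fun_cong[OF this, of 1] show ?thesis by (simp add: xy)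
qed

text \<open>The square root of a positive 2-homogeneous function extends continuously by 0 to the zero
  section. It is 1-homogeneous, so near the zero section it is bounded by a multiple of the norm
  of \<open>y\<close>.\<close>

lemma continuous_on_sqrt_extended:
  fixes k :: "'e::euclidean_space \<times> 'e \<Rightarrow> real"
  assumes U: "open U" and k: "smooth_on (U \<times> - {0}) k"
    and pos: "\<And>z. z \<in> U \<times> - {0} \<Longrightarrow> k z > 0"
    and euler: "\<And>z. z \<in> U \<times> - {0} \<Longrightarrow> dderiv k z (0, snd z) = 2 * k z"
  shows "continuous_on (U \<times> UNIV) (\<lambda>z. if snd z = 0 then 0 else sqrt (k z))"
proof -
  let ?g = "\<lambda>z. if snd z = 0 then 0 else sqrt (k z)"
  let ?D = "U \<times> - {0 :: 'e}"
  have D: "open ?D" using U by (intro open_Times open_Compl closed_singleton)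
  have "isCont ?g (x, y)" if x: "x \<in> U" for x y
  proof (cases "y = 0")
    case False
    have "continuous_on ?D (\<lambda>z. sqrt (k z))"
      using smooth_onD(3)[OF k] by (rule continuous_on_real_sqrt)
    moreover have "?g z = sqrt (k z)" if "z \<in> ?D" for z using that by auto
    ultimately have "continuous_on ?D ?g" by (simp cong: continuous_on_cong)
    then show ?thesis using continuous_on_eq_continuous_at[OF D] x False by auto
  next
    case True
    obtain r where r: "r > 0" "cball x r \<subseteq> U" using U x by (auto simp: open_contains_cball)
    let ?K = "cball x r \<times> sphere (0 :: 'e) 1"
    have "compact ?K" by (intro compact_Times compact_cball compact_sphere)
    moreover have K: "?K \<subseteq> ?D" using r by auto
    ultimately have "compact (k ` ?K)"
      by (intro compact_continuous_image continuous_on_subset[OF smooth_onD(3)[OF k]])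
    then obtain M where M: "\<And>z. z \<in> ?K \<Longrightarrow> norm (k z) \<le> M"
      using compact_imp_bounded[of "k ` ?K"] unfolding bounded_iff by blast
    \<comment> \<open>on the fibre, homogeneity reduces the estimate to the unit sphere\<close>
    have bound: "norm (?g z) \<le> sqrt M * norm (snd z)" if z: "fst z \<in> ball x r" for z
    proof (cases "snd z = 0")
      case False
      obtain p q where pq: "z = (p, q)" by fastforce
      define u where "u = (1 / norm q) *\<^sub>R q"
      have q: "q \<noteq> 0" "q = norm q *\<^sub>R u" "norm u = 1" using False by (auto simp: pq u_def)
      have p: "p \<in> U" "(p, u) \<in> ?K" using z r q(3) by (auto simp: pq)
      have "u \<noteq> 0" using q(3) by auto
      then have "k (p, norm q *\<^sub>R u) = (norm q)\<^sup>2 * k (p, u)"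
        using q(1) by (intro homogeneous_of_euler[OF k euler p(1)]) auto
      then have "k z = (norm q)\<^sup>2 * k (p, u)" using q(2) pq by simp
      then have "sqrt (k z) = norm q * sqrt (k (p, u))" by (simp add: real_sqrt_mult)
      moreover have "sqrt (k (p, u)) \<le> sqrt M" "k (p, u) > 0"
        using M[OF p(2)] pos[OF subsetD[OF K p(2)]] by auto
      ultimately show ?thesis using False pq
        by (simp add: mult.commute[of _ "norm q"] mult_left_mono abs_mult)
    qed simp
    have "(?g \<longlongrightarrow> 0) (at (x, y))"
    proof (rule tendsto_0_le)
      show "((\<lambda>z. norm (snd z)) \<longlongrightarrow> 0) (at (x, y))"
        using True by (auto intro!: tendsto_eq_intros)
      have "\<forall>\<^sub>F z in at (x, y). fst z \<in> ball x r"
        using r(1) by (intro topological_tendstoD[OF tendsto_fst[OF tendsto_ident_at]]) auto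
      then show "\<forall>\<^sub>F z in at (x, y). norm (?g z) \<le> norm (norm (snd z)) * sqrt M"
        by (rule eventually_mono) (use bound in \<open>simp add: mult.commute\<close>)
    qed
    then show ?thesis using True by (simp add: isCont_def)
  qed
  then show ?thesis by (intro continuous_at_imp_continuous_on) auto
qed

text \<open>Regularity of \<open>L\<close> as a Lagrangian.\<close>

definition fiber_nondegenerate :: "('e::euclidean_space \<times> 'e \<Rightarrow> real) \<Rightarrow> 'e \<times> 'e \<Rightarrow> bool" where
  "fiber_nondegenerate L z \<longleftrightarrow>
    (\<forall>b. (\<forall>a. dderiv (\<lambda>x. dderiv L x (0, a)) z (0, b) = 0) \<longrightarrow> b = 0)"

lemma ext_d_dJ:
  "ext_d (dL_fun JJ L) z w w' =
    dderiv (\<lambda>x. dderiv L x (0, fst w')) z w - dderiv (\<lambda>x. dderiv L x (0, fst w)) z w'"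
  by (simp add: ext_d_def dL_fun_def JJ_def)

lemma dL_form_cong:
  assumes D: "open D" "z \<in> D" and eq: "\<And>x u. x \<in> D \<Longrightarrow> \<beta> x u = \<gamma> x u"
  shows "dL_form L \<beta> z w w' = dL_form L \<gamma> z w w'"
proof -
  have "dderiv (\<lambda>x. \<beta> x u) z = dderiv (\<lambda>x. \<gamma> x u) z"
    "dderiv (\<lambda>x. \<beta> x (L x u)) z = dderiv (\<lambda>x. \<gamma> x (L x u)) z" for u
    by (rule dderiv_cong[OF D(1) eq D(2)], assumption)+
  then show ?thesis by (simp add: dL_form_def ext_d_def)
qed

context
  fixes D :: "('e::euclidean_space \<times> 'e) set" and L :: "'e \<times> 'e \<Rightarrow> real" and z :: "'e \<times> 'e"
  assumes D: "open D" and L: "smooth_on D L" and z: "z \<in> D"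
begin

lemma linear_dderiv2: "linear (\<lambda>a. dderiv (\<lambda>x. dderiv L x (0, a)) z w)"
proof -
  have "linear (\<lambda>a :: 'e. (0 :: 'e, a))" by (rule linearI) auto
  from linear_compose[OF this linear_dderiv[OF smooth_onD(2)[OF L] z, of w]]
  show ?thesis by (simp add: schwarz[OF D L z, of _ w] o_def)
qed

lemma linear_ext_d_dJ: "linear (\<lambda>w. ext_d (dL_fun JJ L) z w w')"
proof -
  have "linear (\<lambda>w. dderiv (\<lambda>x. dderiv L x (0, fst w)) z w')"
    using linear_compose[OF linear_fst linear_dderiv2] by (simp add: o_def)
  with linear_dderiv[OF smooth_onD(2)[OF L] z, of "(0, fst w')"] show ?thesis
    unfolding ext_d_dJ by (rule linear_compose_sub)
qed

lemma ext_d_dJ_swap: "ext_d (dL_fun JJ L) z w w' = - ext_d (dL_fun JJ L) z w' w"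
  by (simp add: ext_d_dJ)

text \<open>With respect to the splitting of the tangent space into \<open>x\<close>- and \<open>y\<close>-directions, \<open>dd\<^sub>J L\<close> has a
  block form in which the vertical block vanishes and the mixed blocks are the fibre Hessian of
  \<open>L\<close> up to sign.\<close>

lemma form_rank_full_iff:
  "form_rank (ext_d (dL_fun JJ L) z) = 2 * DIM('e) \<longleftrightarrow> fiber_nondegenerate L z"
proof -
  let ?B = "ext_d (dL_fun JJ L) z"
  define T where "T = (\<lambda>w. \<Sum>b\<in>Basis. ?B w b *\<^sub>R b)"
  have linT: "linear T"
  proof -
    have "linear (\<lambda>r::real. r *\<^sub>R b)" for b :: "'e \<times> 'e"
      by (rule linearI) (auto simp: scaleR_left_distrib)
    from linear_compose[OF linear_ext_d_dJ this] show ?thesis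
      unfolding T_def by (intro linear_compose_sum ballI) (simp add: o_def)
  qed
  have lin2: "linear (?B w)" for w
  proof -
    have "?B w = (\<lambda>w'. - ?B w' w)" by (rule ext) (rule ext_d_dJ_swap)
    then show ?thesis using linear_compose_neg[OF linear_ext_d_dJ[of w]] by simp
  qed
  have T0: "T w = 0 \<longleftrightarrow> (\<forall>w'. ?B w w' = 0)" for w
  proof
    assume "T w = 0"
    then have "?B w b = 0" if "b \<in> Basis" for b
      using that inner_sum_left_Basis[of b "?B w"] by (simp add: T_def)
    then show "\<forall>w'. ?B w w' = 0"
      using linear_eq_stdbasis[OF lin2[of w] linear_zero] by metis
  next
    assume "\<forall>w'. ?B w w' = 0"
    then have "?B w b = 0" for b by blast
    then show "T w = 0" by (simp add: T_def)
  qed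
  have "form_rank ?B = 2 * DIM('e) \<longleftrightarrow> dim (range T) = DIM('e \<times> 'e)"
    unfolding form_rank_def T_def by (simp add: mult_2)
  also have "\<dots> \<longleftrightarrow> inj T"
  proof
    assume "dim (range T) = DIM('e \<times> 'e)"
    then have "span (range T) = UNIV" by (simp only: dim_eq_full)
    moreover have "span (range T) = range T"
      using linear_subspace_image[OF linT subspace_UNIV] by (simp only: span_eq_iff)
    ultimately have "surj T" by simp
    then show "inj T" using linear_surjective_imp_injective[OF linT] by simp
  next
    assume "inj T"
    then show "dim (range T) = DIM('e \<times> 'e)"
      using dim_image_eq[OF linT, of UNIV] by simp
  qed
  also have "\<dots> \<longleftrightarrow> (\<forall>w. (\<forall>w'. ?B w w' = 0) \<longrightarrow> w = 0)"
    using linear_injective_0[OF linT] T0 by auto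
  also have "\<dots> \<longleftrightarrow> fiber_nondegenerate L z"
  proof
    assume l: "\<forall>w. (\<forall>w'. ?B w w' = 0) \<longrightarrow> w = 0"
    show "fiber_nondegenerate L z"
      unfolding fiber_nondegenerate_def
    proof (intro allI impI)
      fix b assume b: "\<forall>a. dderiv (\<lambda>x. dderiv L x (0, a)) z (0, b) = 0"
      have "dderiv (\<lambda>x. dderiv L x (0, 0)) z w' = 0" for w'
        using linear_0[OF linear_dderiv2] .
      with b have "\<forall>w'. ?B (0, b) w' = 0" by (simp add: ext_d_dJ)
      with l show "b = 0" by (metis prod.inject zero_prod_def)
    qed
  next
    assume r: "fiber_nondegenerate L z"
    show "\<forall>w. (\<forall>w'. ?B w w' = 0) \<longrightarrow> w = 0"
    proof (intro allI impI)
      fix w assume w: "\<forall>w'. ?B w w' = 0"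
      obtain a b where ab: "w = (a, b)" by fastforce
      have 0: "dderiv (\<lambda>x. dderiv L x (0, 0)) z w' = 0" for w'
        using linear_0[OF linear_dderiv2] .
      have "dderiv (\<lambda>x. dderiv L x (0, b')) z (0, a) = 0" for b'
        using spec[OF w, of "(0, b')"] schwarz[OF D L z, of "(0, b')" "(0, a)"]
        by (simp add: ext_d_dJ ab 0)
      with r have a: "a = 0" unfolding fiber_nondegenerate_def by blast
      have "dderiv (\<lambda>x. dderiv L x (0, a')) z (0, b) = 0" for a'
        using spec[OF w, of "(a', 0)"] by (simp add: ext_d_dJ ab a 0)
      with r have "b = 0" unfolding fiber_nondegenerate_def by blast
      with a ab show "w = 0" by (simp add: zero_prod_def)
    qed
  qed
  finally show ?thesis .
qed

lemma fiber_nondegenerate_scale: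
  assumes "c \<noteq> 0" "\<And>x. x \<in> D \<Longrightarrow> g x = c * L x"
  shows "fiber_nondegenerate g z \<longleftrightarrow> fiber_nondegenerate L z"
proof -
  have 1: "dderiv g x w = c * dderiv L x w" if "x \<in> D" for x w
    using dderiv_cong[OF D assms(2) that] dderiv_linear[OF bounded_linear_mult_right L that] by simp
  have "dderiv (\<lambda>x. dderiv g x v) z w = c * dderiv (\<lambda>x. dderiv L x v) z w" for v w
    using dderiv_cong[OF D 1 z] dderiv_linear[OF bounded_linear_mult_right smooth_onD(2)[OF L] z] by simp
  then show ?thesis using assms(1) by (simp add: fiber_nondegenerate_def)
qed

end

lemma rank_y_hessian_iff:
  fixes L :: "(real ^ 'n::finite) \<times> (real ^ 'n) \<Rightarrow> real"
  assumes D: "open D" and L: "smooth_on D L" and z: "z \<in> D"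
  shows "rank (y_hessian L z) = CARD('n) \<longleftrightarrow> fiber_nondegenerate L z"
proof -
  let ?H = "\<lambda>a b. dderiv (\<lambda>x. dderiv L x (0, a)) z (0, b)"
  have lin1: "linear (\<lambda>a. ?H a b)" for b by (rule linear_dderiv2[OF D L z])
  have sym: "?H a b = ?H b a" for a b by (rule schwarz[OF D L z])
  have expand: "?H a b = (\<Sum>i\<in>UNIV. a $ i * ?H (axis i 1) b)" for a b
  proof -
    have "?H a b = ?H (\<Sum>i\<in>UNIV. a $ i *\<^sub>R axis i 1) b"
      using basis_expansion[of a] by (simp add: scalar_mult_eq_scaleR)
    also have "\<dots> = (\<Sum>i\<in>UNIV. ?H (a $ i *\<^sub>R axis i 1) b)"
      by (rule linear_sum[OF lin1])
    also have "\<dots> = (\<Sum>i\<in>UNIV. a $ i * ?H (axis i 1) b)"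
      by (simp only: linear_scale[OF lin1] real_scaleR_def)
    finally show ?thesis .
  qed
  have mult: "(y_hessian L z *v b) $ i = (1/2) * ?H b (axis i 1)" for b i
    by (subst expand) (simp add: matrix_vector_mult_def y_hessian_def sum_distrib_left mult_ac)
  have "rank (y_hessian L z) = CARD('n) \<longleftrightarrow> inj ((*v) (y_hessian L z))"
    using full_rank_injective by metis
  also have "\<dots> \<longleftrightarrow> (\<forall>b. y_hessian L z *v b = 0 \<longrightarrow> b = 0)"
    using linear_injective_0[OF matrix_vector_mul_linear] by blast
  also have "\<dots> \<longleftrightarrow> (\<forall>b. (\<forall>i. ?H (axis i 1) b = 0) \<longrightarrow> b = 0)"
    by (simp add: vec_eq_iff[of "_ *v _"] mult sym[of _ "axis _ _"])
  also have "\<dots> \<longleftrightarrow> fiber_nondegenerate L z"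
  proof -
    have "(\<forall>i. ?H (axis i 1) b = 0) \<longleftrightarrow> (\<forall>a. ?H a b = 0)" for b
    proof (intro iffI allI)
      fix a assume "\<forall>i. ?H (axis i 1) b = 0"
      then show "?H a b = 0" by (subst expand) simp
    qed blast
    then show ?thesis unfolding fiber_nondegenerate_def by simp
  qed
  finally show ?thesis .
qed

section \<open>Metrizability in induced coordinates\<close>

context local_spray
begin

text \<open>The derivative of Euler's relation. Freezing the direction \<open>y\<close> before differentiating costs the
  last term.\<close>

lemma dderiv_euler:
  fixes L :: "'e \<times> 'e \<Rightarrow> real"
  assumes L: "smooth_on D L" and euler: "\<And>z. z \<in> D \<Longrightarrow> dderiv L z (0, snd z) = 2 * L z"
    and z: "z \<in> D"
  shows "dderiv (\<lambda>x. dderiv L x (0, snd z)) z w = 2 * dderiv L z w - dderiv L z (0, snd w)"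
proof -
  have "2 * dderiv L z w = dderiv (\<lambda>x. 2 * L x) z w"
    using dderiv_linear[OF bounded_linear_mult_right L z] by simp
  also have "\<dots> = dderiv (\<lambda>x. dderiv L x (0, snd x)) z w"
    using dderiv_cong[of D "\<lambda>x. 2 * L x" "\<lambda>x. dderiv L x (0, snd x)", OF open_D _ z] euler by simp
  also have "\<dots> = dderiv (\<lambda>x. dderiv L x (0, snd z)) z w + dderiv L z (dderiv (\<lambda>x. (0, snd x)) z w)"
    by (rule dderiv_field[OF open_D z L]) (intro smooth_on_Pair smooth_on_const smooth_y open_D)
  also have "dderiv (\<lambda>x. (0 :: 'e, snd x)) z w = (0, snd w)"
    by (subst dderiv_Pair[OF z smooth_on_const[OF open_D] smooth_y]) (simp add: dderiv_const dderiv_snd)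
  finally show ?thesis by simp
qed

text \<open>By Euler's relation the geodesic equation is equivalent to \<open>S(L\<^sub>a) = \<partial>\<^sub>a L\<close> for all constant
  vectors \<open>a\<close> in the \<open>x\<close>-directions. Either side of the claim implies \<open>S(L) = 0\<close>. Given that, the
  rule for exchanging \<open>S\<close> with a vertical derivative reads
  \<open>S(L\<^sub>a) + \<delta>\<^sub>a L + L\<^bsub>P a\<^esub> = 0\<close>, and \<open>L\<^bsub>P a\<^esub> = \<delta>\<^sub>a L - \<partial>\<^sub>a L\<close>.\<close>

lemma geodesic_iff_horizontal:
  fixes L :: "'e \<times> 'e \<Rightarrow> real"
  assumes L: "smooth_on D L" and euler: "\<And>z. z \<in> D \<Longrightarrow> dderiv L z (0, snd z) = 2 * L z"
  shows "(\<forall>z\<in>D. \<forall>w. ext_d (dL_fun JJ L) z (S z) w = - dderiv L z w) \<longleftrightarrow>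
    (\<forall>z\<in>D. \<forall>a. dderiv L z (hor a z) = 0)" (is "?l \<longleftrightarrow> ?r")
proof -
  note split = dderiv_hor_split[OF _ L]
  have ext: "ext_d (dL_fun JJ L) z (S z) w = - dderiv L z w \<longleftrightarrow>
      dderiv (\<lambda>x. dderiv L x (0, fst w)) z (S z) = dderiv L z (fst w, 0)" if z: "z \<in> D" for z w
    using dderiv_euler[OF L euler z, of w] dderiv_plus[OF z L, of "(fst w, 0)" "(0, snd w)"]
    by (simp add: ext_d_dJ fst_S[OF z])
  have S: "dderiv L z (S z) = dderiv L z (snd z, 0) + dderiv L z (0, f z)" if "z \<in> D" for z
    using dderiv_plus[OF that L, of "(snd z, 0)" "(0, f z)"] by (simp add: S_eq[OF that])
  have zero: "dderiv (\<lambda>x. dderiv L x (S x)) z w = 0"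
    if "\<And>x. x \<in> D \<Longrightarrow> dderiv L x (S x) = 0" "z \<in> D" for z w
    using dderiv_cong[OF open_D, of "\<lambda>x. dderiv L x (S x)" "\<lambda>_. 0"] that by (simp add: dderiv_const)
  show ?thesis
  proof
    assume l: ?l
    have eq: "dderiv (\<lambda>x. dderiv L x (0, a)) z (S z) = dderiv L z (a, 0)" if "z \<in> D" for z a
      using iffD1[OF ext[OF that] spec[OF bspec[OF l that]], of "(a, 0)"] by simp
    have SL: "dderiv L z (S z) = 0" if z: "z \<in> D" for z
      using eq[OF z, of "snd z"] S[OF z] dderiv_euler[OF L euler z, of "S z"] by (simp add: f_def)
    show ?r
    proof (intro ballI allI)
      fix z a assume z: "z \<in> D"
      from swap_S_ver[OF z L, of a] zero[OF SL z] show "dderiv L z (hor a z) = 0"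
        using eq[OF z, of a] split[OF z, of a] by simp
    qed
  next
    assume r: ?r
    then have SL: "dderiv L z (S z) = 0" if "z \<in> D" for z
      using that hor_y by metis
    have "dderiv (\<lambda>x. dderiv L x (0, a)) z (S z) = dderiv L z (a, 0)" if z: "z \<in> D" for z a
      using swap_S_ver[OF z L, of a] zero[OF SL z, of "(0, a)"] split[OF z, of a] r z by simp
    then show ?l using ext by blast
  qed
qed

text \<open>Apply \<open>[S, \<delta>\<^sub>a] = \<delta>\<^bsub>- P a\<^esub> + \<Phi> a\<close> to \<open>L\<close>: all horizontal fields, among them \<open>S = \<delta>\<^sub>y\<close>, annihilate it.\<close>

lemma horizontal_dderiv_\<Phi>:
  fixes L :: "'e \<times> 'e \<Rightarrow> real"
  assumes L: "smooth_on D L" and hor: "\<And>z a. z \<in> D \<Longrightarrow> dderiv L z (hor a z) = 0" and z: "z \<in> D"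
  shows "dderiv L z (0, \<Phi> a z) = 0"
proof -
  have "dderiv (\<lambda>x. dderiv L x (hor a x)) z = dderiv (\<lambda>x. 0) z"
    by (rule dderiv_cong[OF open_D _ z]) (rule hor)
  moreover have "dderiv (\<lambda>x. dderiv L x (S x)) z = dderiv (\<lambda>x. 0) z"
    by (rule dderiv_cong[OF open_D _ z]) (metis hor hor_y)
  ultimately show ?thesis
    using swap_S_hor[OF z L, of a] hor[OF z] by (simp add: dderiv_const)
qed

lemma euler_ricci_scalar:
  assumes z: "z \<in> D"
  shows "dderiv (ricci_scalar S) z (0, snd z) = 2 * ricci_scalar S z"
proof -
  have bl: "bounded_linear (\<lambda>r. r / (real DIM('e) - 1))" by (rule bounded_linear_divide)
  have bi: "bounded_linear (\<lambda>r. r \<bullet> b)" for b :: 'e by (rule bounded_linear_inner_left)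
  have sm: "smooth_on D (\<lambda>x. \<Phi> b x \<bullet> b)" for b by (rule smooth_on_linear[OF open_D bi smooth_\<Phi>])
  have "dderiv (Ric S) z (0, snd z) = dderiv (\<lambda>x. \<Sum>b\<in>Basis. \<Phi> b x \<bullet> b) z (0, snd z)"
    using dderiv_cong[OF open_D Ric_eq z] by simp
  also have "\<dots> = (\<Sum>b\<in>Basis. dderiv (\<lambda>x. \<Phi> b x \<bullet> b) z (0, snd z))"
    by (rule dderiv_sum[OF z sm])
  also have "\<dots> = 2 * Ric S z"
    by (simp add: dderiv_linear[OF bi smooth_\<Phi> z] euler_\<Phi>[OF z] Ric_eq[OF z] sum_distrib_left)
  finally show ?thesis
    unfolding ricci_scalar_def[abs_def] using dderiv_linear[OF bl smooth_Ric z] by simp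
qed

text \<open>The trace of the tensor \<open>F\<^sup>2 J - F d\<^sub>J F \<otimes> \<C>\<close> is \<open>(n - 1) F\<^sup>2\<close>; here \<open>L = F\<^sup>2\<close>.\<close>

lemma ricci_scalar_of_flag_curvature:
  fixes L :: "'e \<times> 'e \<Rightarrow> real"
  assumes z: "z \<in> D" and dim: "DIM('e) \<ge> 2" and L: "smooth_on D L"
    and euler: "dderiv L z (0, snd z) = 2 * L z"
    and \<Phi>: "\<And>w. jacobi_endo S z w = r *\<^sub>R (L z *\<^sub>R JJ z w - (dderiv L z (0, fst w) / 2) *\<^sub>R CC z)"
  shows "ricci_scalar S z = r * L z"
proof -
  have "\<Phi> b z = r *\<^sub>R (L z *\<^sub>R b - (dderiv L z (0, b) / 2) *\<^sub>R snd z)" for b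
    using \<Phi>[of "(b, 0)"] by (simp add: jacobi_endo_eq[OF z] JJ_def CC_def)
  then have "Ric S z = (\<Sum>b\<in>Basis. r * (L z - dderiv L z (0, b) / 2 * (snd z \<bullet> b)))"
    unfolding Ric_eq[OF z] by (intro sum.cong) (auto simp: inner_diff_left)
  also have "\<dots> = r * (real DIM('e) * L z - (\<Sum>b\<in>Basis. (snd z \<bullet> b) * dderiv L z (0, b)) / 2)"
    by (simp add: sum_distrib_left[symmetric] sum_subtractf sum_divide_distrib mult.commute)
  also have "(\<Sum>b\<in>Basis. (snd z \<bullet> b) * dderiv L z (0, b)) = dderiv L z (0, snd z)"
  proof -
    have "linear (\<lambda>b. (0 :: 'e, b :: 'e))" by (rule linearI) auto
    from linear_compose[OF this linear_dderiv[OF L z]] have l: "linear (\<lambda>b. dderiv L z (0, b))"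
      by (simp add: o_def)
    have "dderiv L z (0, \<Sum>b\<in>Basis. (snd z \<bullet> b) *\<^sub>R b) = (\<Sum>b\<in>Basis. dderiv L z (0, (snd z \<bullet> b) *\<^sub>R b))"
      by (rule linear_sum[OF l])
    also have "\<dots> = (\<Sum>b\<in>Basis. (snd z \<bullet> b) * dderiv L z (0, b))"
      by (simp only: linear_scale[OF l] real_scaleR_def)
    finally show ?thesis by (simp add: euclidean_representation)
  qed
  finally have "Ric S z = (real DIM('e) - 1) * (r * L z)" by (simp add: euler algebra_simps)
  then show ?thesis using dim by (simp add: ricci_scalar_def)
qed

end

section \<open>Isotropic sprays in induced coordinates\<close>

locale local_isotropic = local_spray +
  fixes \<alpha> :: "'a \<times> 'a \<Rightarrow> 'a \<times> 'a \<Rightarrow> real"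
  assumes dim: "DIM('a) \<ge> 2"
    and smooth_\<alpha>: "smooth_on (U \<times> - {0}) (\<lambda>z. \<alpha> z w)"
    and linear_\<alpha>: "z \<in> U \<times> - {0} \<Longrightarrow> linear (\<alpha> z)"
    and semibasic_\<alpha>: "z \<in> U \<times> - {0} \<Longrightarrow> \<alpha> z (JJ z w) = 0"
    and isotropic: "z \<in> U \<times> - {0} \<Longrightarrow>
      jacobi_endo S z w = ricci_scalar S z *\<^sub>R JJ z w - \<alpha> z w *\<^sub>R CC z"
    and closed_\<alpha>: "z \<in> U \<times> - {0} \<Longrightarrow> dL_form JJ \<alpha> z w w' = 0"
begin

abbreviation R where "R \<equiv> ricci_scalar S"

lemma \<Phi>_\<alpha>: "z \<in> D \<Longrightarrow> \<Phi> a z = R z *\<^sub>R a - \<alpha> z (a, 0) *\<^sub>R snd z"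
  using isotropic[of z "(a, 0)"] by (simp add: jacobi_endo_eq JJ_def CC_def)

text \<open>This is \<open>\<Phi>(S) = 0\<close>.\<close>

lemma R_\<alpha>: "z \<in> D \<Longrightarrow> R z = \<alpha> z (snd z, 0)"
  using \<Phi>_\<alpha>[of z "snd z"] \<Phi>_y[of z]
  by (auto simp: scaleR_left_diff_distrib[symmetric])

lemma \<alpha>_ver: "z \<in> D \<Longrightarrow> \<alpha> z (a, b) = \<alpha> z (a, 0)"
  using linear_add[OF linear_\<alpha>, of z "(a, 0)" "(0, b)"] semibasic_\<alpha>[of z "(b, 0)"]
  by (simp add: JJ_def)

text \<open>The right hand side is invariantly defined, which will make \<open>R\<close> a global function.\<close>

lemma R_\<alpha>_S: "z \<in> D \<Longrightarrow> R z = \<alpha> z (S z)"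
  using R_\<alpha>[of z] \<alpha>_ver[of z "snd z" "f z"] by (simp add: S_eq)

lemma \<alpha>_sym:
  assumes z: "z \<in> D"
  shows "dderiv (\<lambda>x. \<alpha> x (a, 0)) z (0, b) = dderiv (\<lambda>x. \<alpha> x (b, 0)) z (0, a)"
proof -
  have 0: "dderiv (\<lambda>x. \<alpha> x (JJ x w)) z = dderiv (\<lambda>x. 0) z" for w
    by (rule dderiv_cong[OF open_D _ z]) (rule semibasic_\<alpha>)
  have 1: "dderiv (\<lambda>x. \<alpha> x (0, c)) z = dderiv (\<lambda>x. 0) z" for c
    by (rule dderiv_cong[OF open_D _ z]) (use semibasic_\<alpha>[of _ "(c, 0)"] in \<open>simp add: JJ_def\<close>)
  show ?thesis
    using closed_\<alpha>[OF z, of "(a, 0)" "(b, 0)"] unfolding dL_form_def ext_d_def 0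
    by (simp add: JJ_def 1 dderiv_const)
qed

text \<open>Since \<open>\<Phi>\<close> and its trace are 2-homogeneous, so is \<open>\<alpha> \<otimes> \<C>\<close>, and \<open>\<C>\<close> accounts for one degree.\<close>

lemma euler_\<alpha>:
  assumes z: "z \<in> D"
  shows "dderiv (\<lambda>x. \<alpha> x (a, 0)) z (0, snd z) = \<alpha> z (a, 0)"
proof -
  have s1: "smooth_on D (\<lambda>x. R x *\<^sub>R a)" "smooth_on D (\<lambda>x. \<alpha> x (a, 0) *\<^sub>R snd x)"
    by (intro smooth_on_scaleR smooth_ricci_scalar smooth_on_const smooth_\<alpha> smooth_y open_D)+
  have "dderiv (\<Phi> a) z (0, snd z) = dderiv (\<lambda>x. R x *\<^sub>R a - \<alpha> x (a, 0) *\<^sub>R snd x) z (0, snd z)"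
    using dderiv_cong[OF open_D \<Phi>_\<alpha> z] by simp
  also have "\<dots> = (2 * R z) *\<^sub>R a - (\<alpha> z (a, 0) + dderiv (\<lambda>x. \<alpha> x (a, 0)) z (0, snd z)) *\<^sub>R snd z"
    by (simp add: dderiv_diff[OF z s1] dderiv_scaleR[OF z smooth_ricci_scalar smooth_on_const[OF open_D]]
        dderiv_scaleR[OF z smooth_\<alpha> smooth_y] dderiv_const dderiv_snd euler_ricci_scalar[OF z]
        scaleR_left_distrib)
  finally have "(\<alpha> z (a, 0) + dderiv (\<lambda>x. \<alpha> x (a, 0)) z (0, snd z)) *\<^sub>R snd z = (2 * \<alpha> z (a, 0)) *\<^sub>R snd z"
    unfolding euler_\<Phi>[OF z] \<Phi>_\<alpha>[OF z] by (auto simp: scaleR_right_diff_distrib)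
  from this[unfolded scaleR_cancel_right] z show ?thesis by (elim disjE) (simp, auto)
qed

text \<open>Differentiate \<open>R = \<alpha>(y)\<close> in a fibre direction: symmetry of \<open>\<partial>\<alpha>\<^sub>b / \<partial>y\<^sup>a\<close> and 1-homogeneity show
  that both terms of the product rule equal \<open>\<alpha>\<^sub>a\<close>.\<close>

lemma dderiv_R_ver:
  assumes z: "z \<in> D"
  shows "dderiv R z (0, a) = 2 * \<alpha> z (a, 0)"
proof -
  have lin: "linear (\<lambda>b :: 'a. (b, 0 :: 'a))" "linear (\<lambda>b :: 'a. (0 :: 'a, b))" by (auto intro!: linearI)
  have ex: "(\<Sum>b\<in>Basis. (y \<bullet> b) * k b) = k y" if "linear k" for k :: "'a \<Rightarrow> real" and y
    using linear_sum[OF that, of "\<lambda>b. (y \<bullet> b) *\<^sub>R b" Basis] linear_scale[OF that]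
    by (simp add: euclidean_representation)
  have "R x = (\<Sum>b\<in>Basis. (snd x \<bullet> b) * \<alpha> x (b, 0))" if "x \<in> D" for x
    using ex[OF linear_compose[OF lin(1) linear_\<alpha>[OF that], unfolded o_def], of "snd x"] R_\<alpha>[OF that]
    by simp
  then have "dderiv R z (0, a) = dderiv (\<lambda>x. \<Sum>b\<in>Basis. (snd x \<bullet> b) * \<alpha> x (b, 0)) z (0, a)"
    using dderiv_cong[of D R, OF open_D _ z] by simp
  also have "\<dots> = (\<Sum>b\<in>Basis. (snd z \<bullet> b) * dderiv (\<lambda>x. \<alpha> x (b, 0)) z (0, a) + (a \<bullet> b) * \<alpha> z (b, 0))"
    (is "_ = ?sum")
  proof -
    have s: "smooth_on D (\<lambda>x. snd x \<bullet> b)" for b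
      by (intro smooth_on_inner smooth_on_const smooth_y open_D)
    have "dderiv (\<lambda>x. snd x \<bullet> b) z (0, a) = a \<bullet> b" for b
      using dderiv_linear[OF bounded_linear_inner_left smooth_y z] by (simp add: dderiv_snd)
    then show ?thesis
      by (simp add: dderiv_sum[OF z smooth_on_mult[OF open_D s smooth_\<alpha>]] dderiv_mult[OF z s smooth_\<alpha>])
  qed
  also have "\<dots> = (\<Sum>b\<in>Basis. (snd z \<bullet> b) * dderiv (\<lambda>x. \<alpha> x (a, 0)) z (0, b)) + \<alpha> z (a, 0)"
    by (simp add: sum.distrib \<alpha>_sym[OF z, of _ a] ex[OF linear_compose[OF lin(1) linear_\<alpha>[OF z], unfolded o_def]])
  also have "\<dots> = 2 * \<alpha> z (a, 0)"
    using ex[OF linear_compose[OF lin(2) linear_dderiv[OF smooth_\<alpha> z], unfolded o_def], of "snd z" "(a, 0)"]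
    by (simp add: euler_\<alpha>[OF z])
  finally show ?thesis .
qed

lemma \<Phi>_R: "z \<in> D \<Longrightarrow> \<Phi> a z = R z *\<^sub>R a - (dderiv R z (0, a) / 2) *\<^sub>R snd z"
  by (simp add: \<Phi>_\<alpha> dderiv_R_ver)

lemma smooth_R_ver: "smooth_on D (\<lambda>x. dderiv R x (0, a))"
  by (rule smooth_onD(2)[OF smooth_ricci_scalar])

lemma \<Omega>_R:
  assumes z: "z \<in> D"
  shows "\<Omega> a b z = (1/2) *\<^sub>R (dderiv R z (0, a) *\<^sub>R b - dderiv R z (0, b) *\<^sub>R a)"
proof -
  have s1: "smooth_on D (\<lambda>x. R x *\<^sub>R b)" and s2: "smooth_on D (\<lambda>x. dderiv R x (0, b) / 2)" for b
    using smooth_on_linear[OF open_D bounded_linear_divide smooth_R_ver]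
    by (auto intro!: smooth_on_scaleR smooth_ricci_scalar smooth_on_const open_D)
  have "dderiv (\<Phi> b) z (0, a) = dderiv R z (0, a) *\<^sub>R b - ((dderiv R z (0, b) / 2) *\<^sub>R a
      + (dderiv (\<lambda>x. dderiv R x (0, b)) z (0, a) / 2) *\<^sub>R snd z)" for a b
  proof -
    have "dderiv (\<Phi> b) z (0, a) = dderiv (\<lambda>x. R x *\<^sub>R b - (dderiv R x (0, b) / 2) *\<^sub>R snd x) z (0, a)"
      using dderiv_cong[OF open_D \<Phi>_R z] by simp
    then show ?thesis
      by (simp add: dderiv_diff[OF z s1 smooth_on_scaleR[OF open_D s2 smooth_y]]
          dderiv_scaleR[OF z smooth_ricci_scalar smooth_on_const[OF open_D]]
          dderiv_scaleR[OF z s2 smooth_y] dderiv_const dderiv_snd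
          dderiv_linear[OF bounded_linear_divide smooth_R_ver z])
  qed
  note d\<Phi> = this
  have "3 *\<^sub>R \<Omega> a b z = 3 *\<^sub>R ((1/2) *\<^sub>R (dderiv R z (0, a) *\<^sub>R b - dderiv R z (0, b) *\<^sub>R a))"
    unfolding \<Omega>_eq[OF z] d\<Phi> schwarz[OF open_D smooth_ricci_scalar z, of "(0, a)" "(0, b)"]
    by (rule euclidean_eqI) (simp add: inner_simps field_simps)
  from this[unfolded scaleR_cancel_left] show ?thesis by (elim disjE) simp_all
qed

text \<open>In the Bianchi identity the terms with derivatives of \<open>P\<close> cancel, because
  \<open>\<Omega> a b = (1/2) (R\<^sub>a b - R\<^sub>b a)\<close> and derivatives of \<open>P\<close> in fibre directions are symmetric. What
  remains is a linear relation between \<open>a\<close>, \<open>b\<close>, \<open>c\<close> in which \<open>b\<close> has the coefficient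
  \<open>\<delta>\<^sub>c R\<^sub>a - \<delta>\<^sub>a R\<^sub>c\<close>. In dimension at least 3 there is a vector \<open>b\<close> outside the span of \<open>a\<close> and
  \<open>c\<close>.\<close>

lemma mixed_sym:
  assumes dim3: "DIM('a) \<ge> 3" and z: "z \<in> D"
  shows "dderiv (\<lambda>x. dderiv R x (0, a)) z (hor c z) = dderiv (\<lambda>x. dderiv R x (0, c)) z (hor a z)"
proof (rule ccontr)
  define q where "q a c = dderiv (\<lambda>x. dderiv R x (0, a)) z (hor c z)" for a c
  assume "\<not> ?thesis"
  then have neq: "q a c - q c a \<noteq> 0" by (simp add: q_def)
  have "card {a, c} \<le> 2" by (simp add: card_insert_if)
  with dim_le_card'[of "{a, c}"] dim3 have "dim {a, c} \<noteq> DIM('a)" by simp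
  then obtain b where b: "b \<notin> span {a, c}" using dim_eq_full[of "{a, c}"] by blast
  have d\<Omega>: "dderiv (\<Omega> a b) z (hor c z) = (1/2) *\<^sub>R (q a c *\<^sub>R b - q b c *\<^sub>R a)" for a b c
  proof -
    have s: "smooth_on D (\<lambda>x. dderiv R x (0, a) *\<^sub>R b)" for a b
      by (intro smooth_on_scaleR smooth_R_ver smooth_on_const open_D)
    have "dderiv (\<Omega> a b) z w = dderiv (\<lambda>x. (1/2) *\<^sub>R (dderiv R x (0, a) *\<^sub>R b - dderiv R x (0, b) *\<^sub>R a)) z w" for w
      using dderiv_cong[OF open_D \<Omega>_R z] by simp
    then show ?thesis
      by (simp add: dderiv_linear[OF bounded_linear_scaleR_right smooth_on_diff[OF open_D s s] z]
          dderiv_diff[OF z s s] dderiv_scaleR[OF z smooth_R_ver smooth_on_const[OF open_D]] dderiv_const q_def)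
  qed
  have dP: "dderiv (P c) z (0, \<Omega> a b z) =
      (1/2) *\<^sub>R (dderiv R z (0, a) *\<^sub>R dderiv (P c) z (0, b) - dderiv R z (0, b) *\<^sub>R dderiv (P c) z (0, a))" for a b c
  proof -
    have "(0, \<Omega> a b z) = (1/2) *\<^sub>R (dderiv R z (0, a) *\<^sub>R (0, b) - dderiv R z (0, b) *\<^sub>R (0 :: 'a, a))"
      by (simp add: \<Omega>_R[OF z])
    then show ?thesis
      by (simp only: dderiv_scale[OF z smooth_P] dderiv_minus[OF z smooth_P])
  qed
  have "(q a c - q c a) *\<^sub>R b = (q b c - q c b) *\<^sub>R a + (q a b - q b a) *\<^sub>R c"
    using bianchi[OF z, of a b c]
    unfolding d\<Omega> dP scaleR_right_distrib[symmetric] scaleR_cancel_left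
    by (simp add: dderiv_P_sym[OF z, of b a] dderiv_P_sym[OF z, of c a] dderiv_P_sym[OF z, of c b]
        algebra_simps)
  also have "\<dots> \<in> span {a, c}" by (intro span_add span_scale span_base) auto
  finally have "(1 / (q a c - q c a)) *\<^sub>R ((q a c - q c a) *\<^sub>R b) \<in> span {a, c}" by (rule span_scale)
  with neq b show False by simp
qed

text \<open>The lemma of Schur for isotropic metrizable sprays, with \<open>L = F\<^sup>2\<close>.\<close>

theorem schur:
  fixes L :: "'a \<times> 'a \<Rightarrow> real"
  assumes dim3: "DIM('a) \<ge> 3"
    and L: "smooth_on D L" and euler: "\<And>z. z \<in> D \<Longrightarrow> dderiv L z (0, snd z) = 2 * L z"
    and pos: "\<And>z. z \<in> D \<Longrightarrow> L z > 0"
    and hor0: "\<And>z a. z \<in> D \<Longrightarrow> dderiv L z (hor a z) = 0"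
    and z: "z \<in> D"
  shows "dderiv R z (hor c z) = 0"
proof -
  note sR = smooth_ricci_scalar
  let ?L = "\<lambda>a x. dderiv L x (0, a)" and ?R = "\<lambda>a x. dderiv R x (0, a)"
  define \<rho> where "\<rho> a x = dderiv R x (hor a x)" for a x
  have s\<rho>: "smooth_on D (\<rho> a)" for a
    unfolding \<rho>_def by (intro smooth_on_dderiv_field sR smooth_hor open_D)
  \<comment> \<open>\<open>dL \<circ> \<Phi> = 0\<close>\<close>
  have RL: "?R a x * L x = R x * ?L a x" if x: "x \<in> D" for a x
  proof -
    have "(0, \<Phi> a x) = R x *\<^sub>R (0, a) - (?R a x / 2) *\<^sub>R (0 :: 'a, snd x)"
      using \<Phi>_R[OF x] by simp
    then have "0 = R x * ?L a x - ?R a x / 2 * (2 * L x)"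
      using horizontal_dderiv_\<Phi>[OF L hor0 x, of a] euler[OF x]
      by (simp only: dderiv_minus[OF x L] dderiv_scale[OF x L] real_scaleR_def)
    then show ?thesis by simp
  qed
  \<comment> \<open>\<open>\<delta>\<^sub>c L = 0\<close> differentiated along the fibre\<close>
  have Lac: "dderiv (?L a) x (hor c x) + dderiv L x (0, dderiv (P c) x (0, a)) = 0" if x: "x \<in> D" for a c x
  proof -
    have "dderiv (\<lambda>x. dderiv L x (hor c x)) x = dderiv (\<lambda>x. 0) x"
      by (rule dderiv_cong[OF open_D _ x]) (rule hor0)
    then show ?thesis using swap_ver_hor[OF x L, of c a] by (simp add: dderiv_const)
  qed
  \<comment> \<open>the relation \<open>RL\<close> differentiated along \<open>\<delta>\<^sub>c\<close>\<close>
  have dRL: "dderiv (?R a) x (hor c x) * L x = \<rho> c x * ?L a x + R x * dderiv (?L a) x (hor c x)"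
    if x: "x \<in> D" for a c x
  proof -
    have "dderiv (\<lambda>x. ?R a x * L x) x (hor c x) = dderiv (\<lambda>x. R x * ?L a x) x (hor c x)"
      using dderiv_cong[OF open_D RL x] by simp
    then show ?thesis
      by (simp add: dderiv_mult[OF x smooth_R_ver L] dderiv_mult[OF x sR smooth_onD(2)[OF L]] hor0[OF x] \<rho>_def)
  qed
  have \<rho>_sym: "\<rho> c x * ?L a x = \<rho> a x * ?L c x" if x: "x \<in> D" for a c x
  proof -
    have "dderiv (?L a) x (hor c x) = dderiv (?L c) x (hor a x)"
      using Lac[OF x, of a c] Lac[OF x, of c a] dderiv_P_sym[OF x, of a c] by simp
    then show ?thesis
      using dRL[OF x, of a c] dRL[OF x, of c a] mixed_sym[OF dim3 x, of a c] by simp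
  qed
  \<comment> \<open>Hence \<open>\<rho> c / L\<close>, the derivative of \<open>R / L\<close> along \<open>\<delta>\<^sub>c\<close>, is constant on the fibres.\<close>
  have \<rho>_ver: "L x * dderiv (\<rho> c) x (0, a) = \<rho> c x * ?L a x" if x: "x \<in> D" for a c x
  proof -
    have "dderiv (\<rho> c) x (0, a) = dderiv (?R a) x (hor c x) + ?R (dderiv (P c) x (0, a)) x"
      unfolding \<rho>_def[abs_def] by (rule swap_ver_hor[OF x sR])
    then have "L x * dderiv (\<rho> c) x (0, a) =
        dderiv (?R a) x (hor c x) * L x + ?R (dderiv (P c) x (0, a)) x * L x"
      by (simp add: algebra_simps)
    also have "\<dots> = \<rho> c x * ?L a x + R x * (dderiv (?L a) x (hor c x) + ?L (dderiv (P c) x (0, a)) x)"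
      by (simp only: dRL[OF x] RL[OF x]) (simp add: algebra_simps)
    finally show ?thesis by (simp add: Lac[OF x])
  qed
  obtain p y where py: "z = (p, y)" by fastforce
  with z have p: "p \<in> U" "y \<noteq> 0" by auto
  define \<mu> where "\<mu> a = \<rho> a z / L z" for a
  have \<mu>: "\<rho> a (p, y') = \<mu> a * L (p, y')" if "y' \<noteq> 0" for a y'
    using fiber_proportional[OF dim s\<rho> L _ \<rho>_ver p(1) that p(2), of a] pos p that
      pos[of "(p, y')"]
    by (force simp: \<mu>_def py field_simps)
  have lin: "linear \<mu>"
  proof -
    have "linear (\<lambda>a. hor a z)" unfolding hor_def
      using linear_P[OF z] by (auto intro!: linearI simp: P_plus[OF z] P_scale[OF z])
    from linear_compose[OF this linear_dderiv[OF sR z]] have "linear (\<lambda>a. \<rho> a z)"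
      by (simp add: \<rho>_def o_def)
    from linear_compose_scale_right[OF this, of "1 / L z"] show ?thesis
      by (simp add: \<mu>_def[abs_def] divide_inverse mult.commute)
  qed
  \<comment> \<open>a linear form on a space of dimension at least 2 has a nontrivial kernel\<close>
  have "\<exists>y'. y' \<noteq> 0 \<and> \<mu> y' = 0"
  proof (rule ccontr)
    assume "\<not> ?thesis"
    then have "inj \<mu>" using linear_injective_0[OF lin] by blast
    then have "dim (range \<mu>) = DIM('a)" using dim_image_eq[OF lin, of UNIV] by simp
    with dim_subset_UNIV[of "range \<mu>"] dim show False by simp
  qed
  then obtain y' where y': "y' \<noteq> 0" "\<mu> y' = 0" by blast
  then have z': "(p, y') \<in> D" using p by auto
  have "\<rho> c (p, y') * (2 * L (p, y')) = 0"
    using \<rho>_sym[OF z', of c y'] \<mu>[OF y'(1), of y'] euler[OF z'] y'(2) by simp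
  then have "\<mu> c = 0" using \<mu>[OF y'(1), of c] pos[OF z'] by simp
  then show ?thesis using \<mu>[OF p(2), of c] by (simp add: \<rho>_def py)
qed

end

section \<open>Induced charts of the tangent bundle\<close>

lemma chart_inv_in: "x \<in> chart_im c \<Longrightarrow> chart_inv c x \<in> fst c"
  and chart_inv_right: "x \<in> chart_im c \<Longrightarrow> snd c (chart_inv c x) = x"
  unfolding chart_im_def chart_inv_def by (auto intro: inv_into_into f_inv_into_f)

lemma chart_inv_eqI: "inj_on (snd c) (fst c) \<Longrightarrow> p \<in> fst c \<Longrightarrow> snd c p = x \<Longrightarrow> chart_inv c x = p"
  unfolding chart_inv_def by (metis inv_into_f_f)

locale atlas =
  fixes A :: "('m::{t2_space, second_countable_topology}, 'e::euclidean_space) chart set"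
  assumes atlas: "smooth_atlas A"
begin

lemma open_dom: "c \<in> A \<Longrightarrow> open (fst c)"
  and open_im: "c \<in> A \<Longrightarrow> open (chart_im c)"
  and homeo: "c \<in> A \<Longrightarrow> homeomorphism (fst c) (chart_im c) (snd c) (chart_inv c)"
  and cover: "\<exists>c\<in>A. p \<in> fst c"
  and smooth_transition: "c \<in> A \<Longrightarrow> c' \<in> A \<Longrightarrow> smooth_on (snd c ` (fst c \<inter> fst c')) (transition c c')"
  using atlas unfolding smooth_atlas_def by blast+

lemma chart_inv_left: "c \<in> A \<Longrightarrow> p \<in> fst c \<Longrightarrow> chart_inv c (snd c p) = p"
  using homeomorphism_apply1[OF homeo] .

lemma in_chart_im: "p \<in> fst c \<Longrightarrow> snd c p \<in> chart_im c"
  unfolding chart_im_def by blast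

lemma open_image_chart:
  assumes c: "c \<in> A" and W: "open W" "W \<subseteq> fst c"
  shows "open (snd c ` W)"
proof -
  have "snd c ` W = chart_im c \<inter> chart_inv c -` W"
    using W(2) chart_inv_left[OF c] chart_inv_right[of _ c]
    by (force simp: in_chart_im image_iff)
  also have "open \<dots>"
    using homeomorphism_cont2[OF homeo[OF c]] open_im[OF c] W(1) by (rule continuous_open_preimage)
  finally show ?thesis .
qed

abbreviation T where "T c c' p \<equiv> dderiv (transition c c') (snd c p)"

lemma transition_derivative:
  assumes "c \<in> A" "c' \<in> A" "p \<in> fst c" "p \<in> fst c'"
  shows "(transition c c' has_derivative T c c' p) (at (snd c p))"
  using smooth_onD(1)[OF smooth_transition[OF assms(1,2)], of "snd c p"] assms(3,4) by blast

lemma linear_T: "c \<in> A \<Longrightarrow> c' \<in> A \<Longrightarrow> p \<in> fst c \<Longrightarrow> p \<in> fst c' \<Longrightarrow> linear (T c c' p)"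
  using has_derivative_linear[OF transition_derivative] .

lemma transition_apply: "c \<in> A \<Longrightarrow> p \<in> fst c \<Longrightarrow> transition c c' (snd c p) = snd c' p"
  by (simp add: transition_def chart_inv_left)

lemma T_refl:
  assumes c: "c \<in> A" "p \<in> fst c"
  shows "T c c p w = w"
proof -
  have "dderiv (transition c c) (snd c p) = dderiv (\<lambda>x. x) (snd c p)"
    by (rule dderiv_cong[OF open_im[OF c(1)] _ in_chart_im[OF c(2)]])
      (simp add: transition_def chart_inv_right)
  then show ?thesis using dderiv_eq[OF has_derivative_ident] by metis
qed

text \<open>The cocycle condition, which makes tangent vectors given by chart components well defined.\<close>

lemma T_compose:
  assumes c: "c \<in> A" "c' \<in> A" "c'' \<in> A" and p: "p \<in> fst c" "p \<in> fst c'" "p \<in> fst c''"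
  shows "T c c'' p w = T c' c'' p (T c c' p w)"
proof -
  let ?O = "snd c ` (fst c \<inter> fst c' \<inter> fst c'')"
  have O: "open ?O" by (rule open_image_chart[OF c(1)]) (auto intro!: open_Int open_dom c)
  have "dderiv (transition c c'') (snd c p) = dderiv (\<lambda>x. transition c' c'' (transition c c' x)) (snd c p)"
    by (rule dderiv_cong[OF O]) (use p in \<open>auto simp: transition_def chart_inv_left c\<close>)
  moreover have "((\<lambda>x. transition c' c'' (transition c c' x)) has_derivative
      (\<lambda>w. T c' c'' p (T c c' p w))) (at (snd c p))"
    by (rule has_derivative_compose[OF transition_derivative])
      (use transition_derivative c p in \<open>auto simp: transition_apply\<close>)
  ultimately show ?thesis using dderiv_eq by metis
qed

lemma tangent_space_iff:
  "v \<in> tangent_space A p \<longleftrightarrow>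
     (\<forall>c\<in>A. \<forall>c'\<in>A. p \<in> fst c \<and> p \<in> fst c' \<longrightarrow> v c' = T c c' p (v c)) \<and>
     (\<forall>c. \<not> (c \<in> A \<and> p \<in> fst c) \<longrightarrow> v c = 0)"
  unfolding tangent_space_def dderiv_def by simp

text \<open>The tangent vector at \<open>p\<close> with components \<open>y\<close> in the chart \<open>c\<close>, and the point of the tangent
  bundle with induced coordinates \<open>z\<close>.\<close>

definition vec_at where
  "vec_at c p y = (\<lambda>c'. if c' \<in> A \<and> p \<in> fst c' then T c c' p y else 0)"

definition pt where "pt c z = (chart_inv c (fst z), vec_at c (chart_inv c (fst z)) (snd z))"

lemma vec_at_self: "c \<in> A \<Longrightarrow> p \<in> fst c \<Longrightarrow> vec_at c p y c = y"
  by (simp add: vec_at_def T_refl)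

lemma vec_at_tangent: "c \<in> A \<Longrightarrow> p \<in> fst c \<Longrightarrow> vec_at c p y \<in> tangent_space A p"
  unfolding tangent_space_iff by (auto simp: vec_at_def intro: T_compose)

lemma tangent_eq_vec_at:
  assumes "c \<in> A" "p \<in> fst c" "v \<in> tangent_space A p"
  shows "v = vec_at c p (v c)"
proof
  fix c'
  show "v c' = vec_at c p (v c) c'"
  proof (cases "c' \<in> A \<and> p \<in> fst c'")
    case True
    then have "v c' = T c c' p (v c)" using assms unfolding tangent_space_iff by blast
    with True show ?thesis by (simp add: vec_at_def)
  next
    case False
    then have "v c' = 0" using assms unfolding tangent_space_iff by blast
    with False show ?thesis by (auto simp: vec_at_def)
  qed
qed

lemma vec_at_eq_0_iff:
  assumes "c \<in> A" "p \<in> fst c"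
  shows "vec_at c p y = (\<lambda>_. 0) \<longleftrightarrow> y = 0"
proof
  assume "vec_at c p y = (\<lambda>_. 0)"
  then show "y = 0" using vec_at_self[OF assms, of y] by simp
qed (auto simp: vec_at_def linear_0[OF linear_T] assms)

lemma vec_at_scale:
  "c \<in> A \<Longrightarrow> p \<in> fst c \<Longrightarrow> vec_at c p (r *\<^sub>R y) = (\<lambda>c'. r *\<^sub>R vec_at c p y c')"
  unfolding vec_at_def by (rule ext) (auto simp: linear_scale[OF linear_T])

lemma tangent_bundle_iff: "(p, v) \<in> tangent_bundle A \<longleftrightarrow> v \<in> tangent_space A p"
  unfolding tangent_bundle_def using cover by auto

lemma slit_bundle_iff: "(p, v) \<in> slit_bundle A \<longleftrightarrow> v \<in> tangent_space A p \<and> v \<noteq> (\<lambda>_. 0)"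
  unfolding slit_bundle_def by (auto simp: tangent_bundle_iff)

lemma inj_tangent_chart: "c \<in> A \<Longrightarrow> inj_on (snd (tangent_chart A c)) (fst (tangent_chart A c))"
  unfolding tangent_chart_def
  by (rule inj_onI) (clarsimp simp: tangent_bundle_iff, metis chart_inv_left tangent_eq_vec_at)

lemma inj_slit_chart: "c \<in> A \<Longrightarrow> inj_on (snd (slit_chart A c)) (fst (slit_chart A c))"
proof -
  assume c: "c \<in> A"
  have "snd (slit_chart A c) = snd (tangent_chart A c)" "fst (slit_chart A c) \<subseteq> fst (tangent_chart A c)"
    unfolding tangent_chart_def slit_chart_def slit_bundle_def by auto
  with inj_on_subset[OF inj_tangent_chart[OF c]] show ?thesis by simp
qed

lemma pt_tangent:
  assumes "c \<in> A" "fst z \<in> chart_im c"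
  shows "pt c z \<in> fst (tangent_chart A c)" "snd (tangent_chart A c) (pt c z) = z"
  using chart_inv_in[OF assms(2)] chart_inv_right[OF assms(2)] assms(1)
  unfolding tangent_chart_def pt_def
  by (auto simp: tangent_bundle_iff vec_at_tangent vec_at_self)

lemma pt_slit:
  assumes "c \<in> A" "z \<in> chart_im c \<times> - {0}"
  shows "pt c z \<in> fst (slit_chart A c)" "snd (slit_chart A c) (pt c z) = z"
  using pt_tangent[OF assms(1), of z] assms chart_inv_in[of "fst z" c]
  unfolding tangent_chart_def slit_chart_def slit_bundle_def pt_def
  by (auto simp: vec_at_eq_0_iff)

lemma slit_chart_im: "c \<in> A \<Longrightarrow> chart_im (slit_chart A c) = chart_im c \<times> - {0}"
proof
  assume c: "c \<in> A"
  show "chart_im (slit_chart A c) \<subseteq> chart_im c \<times> - {0}"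
  proof
    fix z assume "z \<in> chart_im (slit_chart A c)"
    then obtain p v where *: "z = (snd c p, v c)" "v \<in> tangent_space A p" "v \<noteq> (\<lambda>_. 0)" "p \<in> fst c"
      unfolding chart_im_def slit_chart_def by (auto simp: slit_bundle_iff)
    then show "z \<in> chart_im c \<times> - {0}"
      using vec_at_eq_0_iff[OF c *(4), of "v c"]
      by (simp add: in_chart_im tangent_eq_vec_at[OF c *(4,2), symmetric])
  qed
  show "chart_im c \<times> - {0} \<subseteq> chart_im (slit_chart A c)"
    using pt_slit[OF c] unfolding chart_im_def[of "slit_chart A c"] by (metis image_eqI subsetI)
qed

lemma slit_chart_inv: "c \<in> A \<Longrightarrow> z \<in> chart_im c \<times> - {0} \<Longrightarrow> chart_inv (slit_chart A c) z = pt c z"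
  using chart_inv_eqI[OF inj_slit_chart pt_slit] .

lemma tangent_chart_im: "c \<in> A \<Longrightarrow> chart_im (tangent_chart A c) = chart_im c \<times> UNIV"
proof
  assume c: "c \<in> A"
  show "chart_im (tangent_chart A c) \<subseteq> chart_im c \<times> UNIV"
    unfolding chart_im_def tangent_chart_def by auto
  show "chart_im c \<times> UNIV \<subseteq> chart_im (tangent_chart A c)"
  proof
    fix z assume "z \<in> chart_im c \<times> (UNIV :: 'e set)"
    then have "fst z \<in> chart_im c" by auto
    note z = pt_tangent[OF c this]
    show "z \<in> chart_im (tangent_chart A c)"
      using imageI[OF z(1), of "snd (tangent_chart A c)"] unfolding chart_im_def[of "tangent_chart A c"] z(2) .
  qed
qed

lemma tangent_chart_inv: "c \<in> A \<Longrightarrow> fst z \<in> chart_im c \<Longrightarrow> chart_inv (tangent_chart A c) z = pt c z"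
  using chart_inv_eqI[OF inj_tangent_chart pt_tangent] .

lemma slit_eq_pt:
  assumes "c \<in> A" "(p, v) \<in> slit_bundle A" "p \<in> fst c"
  shows "(snd c p, v c) \<in> chart_im c \<times> - {0}" "(p, v) = pt c (snd c p, v c)"
proof -
  have v: "v \<in> tangent_space A p" "v \<noteq> (\<lambda>_. 0)" using assms(2) by (auto simp: slit_bundle_iff)
  note eq = tangent_eq_vec_at[OF assms(1,3) v(1), symmetric]
  have "v c \<noteq> 0"
    using trans[OF eq[symmetric] iffD2[OF vec_at_eq_0_iff[OF assms(1,3)]]] v(2) by blast
  then show "(snd c p, v c) \<in> chart_im c \<times> - {0}"
    using in_chart_im[OF assms(3)] by simp
  show "(p, v) = pt c (snd c p, v c)"
    by (simp only: pt_def fst_conv snd_conv chart_inv_left[OF assms(1,3)] eq)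
qed

subsection \<open>Change of induced coordinates\<close>

definition overlap where "overlap c c' = snd c ` (fst c \<inter> fst c')"

definition \<tau> where "\<tau> c c' z = (transition c c' (fst z), dderiv (transition c c') (fst z) (snd z))"

lemma open_overlap: "c \<in> A \<Longrightarrow> c' \<in> A \<Longrightarrow> open (overlap c c' \<times> - {0 :: 'e})"
  unfolding overlap_def
  by (intro open_Times open_Compl closed_singleton open_image_chart open_Int open_dom) auto

lemma overlap_pt:
  assumes c: "c \<in> A" "c' \<in> A" and z: "z \<in> overlap c c' \<times> - {0}"
  shows "z \<in> chart_im c \<times> - {0}" "pt c z \<in> fst (slit_chart A c')"
    "\<tau> c c' z = snd (slit_chart A c') (pt c z)"
    "\<tau> c c' z \<in> chart_im c' \<times> - {0}" "pt c' (\<tau> c c' z) = pt c z"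
proof -
  obtain p y where p: "z = (snd c p, y)" "p \<in> fst c" "p \<in> fst c'" "y \<noteq> 0"
    using z unfolding overlap_def by auto
  show z': "z \<in> chart_im c \<times> - {0}" using p by (simp add: in_chart_im)
  have pt: "pt c z = (p, vec_at c p y)" by (simp add: pt_def p chart_inv_left c)
  have slit: "(p, vec_at c p y) \<in> slit_bundle A"
    using p c by (simp add: slit_bundle_iff vec_at_tangent vec_at_eq_0_iff)
  show "pt c z \<in> fst (slit_chart A c')" using slit p(3) by (simp add: pt slit_chart_def)
  show \<tau>: "\<tau> c c' z = snd (slit_chart A c') (pt c z)"
    unfolding pt by (simp add: \<tau>_def slit_chart_def p transition_apply[OF c(1)] vec_at_def c)
  show "\<tau> c c' z \<in> chart_im c' \<times> - {0}" "pt c' (\<tau> c c' z) = pt c z"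
  proof -
    have "\<tau> c c' z = (snd c' p, vec_at c p y c')" unfolding \<tau> pt by (simp add: slit_chart_def)
    then show "\<tau> c c' z \<in> chart_im c' \<times> - {0}" "pt c' (\<tau> c c' z) = pt c z"
      using slit_eq_pt[OF c(2) slit p(3)] unfolding pt by simp_all
  qed
qed

text \<open>The term \<open>N\<close> involves second derivatives of the coordinate change; it matters only that it vanishes on
  vertical vectors, so that the derivative of \<open>\<tau>\<close> respects \<open>J\<close>.\<close>

lemma \<tau>_has_derivative:
  assumes c: "c \<in> A" "c' \<in> A" and z: "z \<in> overlap c c' \<times> - {0}"
  obtains N where "(\<tau> c c' has_derivative
      (\<lambda>w. (dderiv (transition c c') (fst z) (fst w), N (fst w) + dderiv (transition c c') (fst z) (snd w)))) (at z)"
    "N 0 = 0"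
proof -
  let ?O = "overlap c c'" and ?f = "transition c c'"
  have O: "open ?O" unfolding overlap_def
    by (intro open_image_chart open_Int open_dom c) auto
  have s: "smooth_on ?O ?f" unfolding overlap_def by (rule smooth_transition[OF c])
  have x: "fst z \<in> ?O" using z by auto
  define N where "N = dderiv (\<lambda>x. dderiv ?f x (snd z)) (fst z)"
  have expand: "dderiv ?f (fst u) (snd u) = (\<Sum>b\<in>Basis. (snd u \<bullet> b) *\<^sub>R dderiv ?f (fst u) b)"
    if "u \<in> ?O \<times> - {0}" for u using dderiv_expand[OF O s] that by auto
  have fst': "(fst has_derivative fst) (at z)" "(snd has_derivative snd) (at z)"
    by (auto intro!: bounded_linear_imp_has_derivative bounded_linear_fst bounded_linear_snd)
  have d1: "((\<lambda>u. ?f (fst u)) has_derivative (\<lambda>w. dderiv ?f (fst z) (fst w))) (at z)"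
    by (rule has_derivative_compose[OF fst'(1) smooth_onD(1)[OF s x]])
  have d2: "((\<lambda>u. dderiv ?f (fst u) b) has_derivative (\<lambda>w. dderiv (\<lambda>x. dderiv ?f x b) (fst z) (fst w))) (at z)" for b
    by (rule has_derivative_compose[OF fst'(1) smooth_onD(1)[OF smooth_onD(2)[OF s] x]])
  have N: "N w = (\<Sum>b\<in>Basis. (snd z \<bullet> b) *\<^sub>R dderiv (\<lambda>x. dderiv ?f x b) (fst z) w)" for w
  proof -
    have "N w = dderiv (\<lambda>x. \<Sum>b\<in>Basis. (snd z \<bullet> b) *\<^sub>R dderiv ?f x b) (fst z) w"
      unfolding N_def using dderiv_cong[OF O dderiv_expand[OF O s] x] by simp
    also have "\<dots> = (\<Sum>b\<in>Basis. (snd z \<bullet> b) *\<^sub>R dderiv (\<lambda>x. dderiv ?f x b) (fst z) w)"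
      by (rule dderiv_eq)
        (intro has_derivative_sum has_derivative_scaleR_right smooth_onD(1)[OF smooth_onD(2)[OF s] x])
    finally show ?thesis .
  qed
  have "((\<lambda>u. \<Sum>b\<in>Basis. (snd u \<bullet> b) *\<^sub>R dderiv ?f (fst u) b) has_derivative
      (\<lambda>w. \<Sum>b\<in>Basis. (snd z \<bullet> b) *\<^sub>R dderiv (\<lambda>x. dderiv ?f x b) (fst z) (fst w)
        + (snd w \<bullet> b) *\<^sub>R dderiv ?f (fst z) b)) (at z)"
    by (intro has_derivative_sum has_derivative_scaleR d2 has_derivative_inner_left fst')
  then have d3: "((\<lambda>u. dderiv ?f (fst u) (snd u)) has_derivative
      (\<lambda>w. N (fst w) + dderiv ?f (fst z) (snd w))) (at z)"
    using has_derivative_transform_within_open[OF _ open_overlap[OF c] z expand[symmetric]]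
    by (simp add: sum.distrib N dderiv_expand[OF O s x, of "snd _"])
  show thesis
  proof
    show "(\<tau> c c' has_derivative (\<lambda>w. (dderiv ?f (fst z) (fst w), N (fst w) + dderiv ?f (fst z) (snd w)))) (at z)"
      unfolding \<tau>_def[abs_def] by (rule has_derivative_Pair[OF d1 d3])
    show "N 0 = 0" unfolding N_def
      by (rule linear_0[OF linear_dderiv[OF smooth_onD(2)[OF s] x]])
  qed
qed

lemma slit_transition_derivative:
  assumes c: "c \<in> A" "c' \<in> A" and z: "z \<in> overlap c c' \<times> - {0}"
  shows "fst (dderiv (transition (slit_chart A c) (slit_chart A c')) z w) =
    dderiv (transition c c') (fst z) (fst w)"
proof -
  obtain N where N: "(\<tau> c c' has_derivative
      (\<lambda>w. (dderiv (transition c c') (fst z) (fst w), N (fst w) + dderiv (transition c c') (fst z) (snd w)))) (at z)"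
    using \<tau>_has_derivative[OF c z] by blast
  have "dderiv (transition (slit_chart A c) (slit_chart A c')) z = dderiv (\<tau> c c') z"
    by (rule dderiv_cong[OF open_overlap[OF c] _ z])
      (simp add: transition_def overlap_pt[OF c] slit_chart_inv[OF c(1)])
  then show ?thesis using dderiv_eq[OF N, of w] by simp
qed

lemma dderiv_local_fun:
  fixes F :: "_ \<Rightarrow> real"
  assumes c: "c \<in> A" "c' \<in> A" and z: "z \<in> overlap c c' \<times> - {0}"
    and F: "smooth_on (chart_im c' \<times> - {0}) (local_fun F (slit_chart A c'))"
  shows "dderiv (local_fun F (slit_chart A c)) z (0, a) =
    dderiv (local_fun F (slit_chart A c')) (\<tau> c c' z) (0, dderiv (transition c c') (fst z) a)"
proof -
  obtain N where N: "(\<tau> c c' has_derivative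
      (\<lambda>w. (dderiv (transition c c') (fst z) (fst w), N (fst w) + dderiv (transition c c') (fst z) (snd w)))) (at z)"
    and N0: "N 0 = 0"
    using \<tau>_has_derivative[OF c z] by blast
  have "fst z \<in> snd c ` (fst c \<inter> fst c')" using z by (auto simp: overlap_def)
  then have T0: "dderiv (transition c c') (fst z) 0 = 0"
    using linear_0[OF linear_dderiv[OF smooth_transition[OF c]]] by blast
  have "dderiv (local_fun F (slit_chart A c)) z = dderiv (\<lambda>u. local_fun F (slit_chart A c') (\<tau> c c' u)) z"
    by (rule dderiv_cong[OF open_overlap[OF c] _ z])
      (simp add: local_fun_def slit_chart_inv c overlap_pt(1,4,5)[OF c])
  moreover have d: "((\<lambda>u. local_fun F (slit_chart A c') (\<tau> c c' u)) has_derivative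
     (\<lambda>w. dderiv (local_fun F (slit_chart A c')) (\<tau> c c' z)
       (dderiv (transition c c') (fst z) (fst w), N (fst w) + dderiv (transition c c') (fst z) (snd w)))) (at z)"
    by (rule has_derivative_compose[OF N smooth_onD(1)[OF F overlap_pt(4)[OF c z]]])
  ultimately show ?thesis using dderiv_eq[OF d, of "(0, a)"] by (simp add: N0 T0)
qed

end

section \<open>Sprays and Finsler functions on a manifold\<close>

locale spray_manifold = atlas A
  for A :: "('m::{t2_space, second_countable_topology}, 'n::finite) mchart set" +
  fixes S :: "('m, 'n) tmfield"
  assumes dim3: "CARD('n) \<ge> 3" and spray: "spray A S"
begin

abbreviation "slit c \<equiv> slit_chart A c"
abbreviation "loc c \<equiv> local_vf S (slit_chart A c)"
abbreviation "sdom c \<equiv> chart_im c \<times> - {0 :: real ^ 'n}"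

lemma ball_slit_atlas:
  "(\<forall>c\<in>slit_atlas A. \<forall>z\<in>chart_im c. Q c z) \<longleftrightarrow> (\<forall>c\<in>A. \<forall>z\<in>sdom c. Q (slit c) z)"
  unfolding slit_atlas_def by (simp add: slit_chart_im cong: ball_cong)

lemma open_dom_slit: "c \<in> A \<Longrightarrow> open (sdom c)"
  by (intro open_Times open_im open_Compl closed_singleton)

lemma local_spray_loc: "c \<in> A \<Longrightarrow> local_spray (chart_im c) (loc c)"
proof
  assume c: "c \<in> A"
  show "open (chart_im c)" by (rule open_im[OF c])
  show "smooth_on (sdom c) (loc c)"
    using spray c unfolding spray_def smooth_vector_field_def slit_atlas_def
    by (auto simp: slit_chart_im)
  fix z assume z: "z \<in> sdom c"
  have "JJ z (loc c z) = CC z \<and> lie_bracket CC (loc c) z = loc c z"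
    using spray c z unfolding spray_def ball_slit_atlas by blast
  then show "fst (loc c z) = snd z" "lie_bracket CC (loc c) z = loc c z"
    by (auto simp: JJ_def CC_def)
qed

lemma ricci_constant_iff:
  "ricci_constant A S \<longleftrightarrow>
    (\<forall>c\<in>A. \<forall>z\<in>sdom c. \<forall>a. dderiv (ricci_scalar (loc c)) z (local_spray.hor (loc c) a z) = 0)"
proof -
  have "dL_fun (hproj (loc c)) g z w = dderiv g z (local_spray.hor (loc c) (fst w) z)"
    if "c \<in> A" "z \<in> sdom c" for c z w and g :: "_ \<Rightarrow> real"
    using local_spray.hproj_eq[OF local_spray_loc[OF that(1)] that(2)] by (simp add: dL_fun_def)
  then show ?thesis
    unfolding ricci_constant_def ball_slit_atlas by (simp cong: ball_cong)
qed

subsection \<open>Finsler functions in a chart\<close>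

context
  fixes F c
  assumes F: "finsler_function A F" and c: "c \<in> A"
begin

abbreviation "F_loc \<equiv> local_fun F (slit c)"
abbreviation "F2_loc \<equiv> \<lambda>z. (local_fun F (slit_chart A c) z)\<^sup>2"

lemma smooth_finsler: "smooth_on (sdom c) F_loc"
  using F c unfolding finsler_function_def smooth_fun_def slit_atlas_def
  by (auto simp: slit_chart_im)

lemma smooth_finsler_square: "smooth_on (sdom c) F2_loc"
  unfolding power2_eq_square by (intro smooth_on_mult open_dom_slit[OF c] smooth_finsler)

lemma finsler_pos: "z \<in> sdom c \<Longrightarrow> F_loc z > 0"
  using F pt_slit(1)[OF c, of z] slit_chart_inv[OF c, of z]
  unfolding finsler_function_def local_fun_def by (auto simp: slit_chart_def)

lemma finsler_homogeneous:
  assumes z: "z \<in> sdom c" and t: "t > 0"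
  shows "F_loc (fst z, t *\<^sub>R snd z) = t * F_loc z"
proof -
  let ?p = "chart_inv c (fst z)"
  have p: "?p \<in> fst c" using z by (auto intro: chart_inv_in)
  have z': "(fst z, t *\<^sub>R snd z) \<in> sdom c" using z t by auto
  have "(?p, vec_at c ?p (snd z)) \<in> tangent_bundle A"
    by (simp add: tangent_bundle_iff vec_at_tangent c p)
  then have "F (?p, \<lambda>c'. t *\<^sub>R vec_at c ?p (snd z) c') = t * F (?p, vec_at c ?p (snd z))"
    using F t unfolding finsler_function_def by fastforce
  then show ?thesis
    by (simp add: local_fun_def slit_chart_inv[OF c z] slit_chart_inv[OF c z'] pt_def vec_at_scale[OF c p])
qed

lemma euler_finsler_square: "z \<in> sdom c \<Longrightarrow> dderiv F2_loc z (0, snd z) = 2 * F2_loc z"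
  by (rule euler_of_homogeneous[OF smooth_finsler_square]) (auto simp: finsler_homogeneous power_mult_distrib)

lemma finsler_dJ: "z \<in> sdom c \<Longrightarrow> F_loc z * dL_fun JJ F_loc z w = dderiv F2_loc z (0, fst w) / 2"
  unfolding power2_eq_square
  by (simp add: dderiv_mult[OF _ smooth_finsler smooth_finsler] dL_fun_def JJ_def)

lemma nondegenerate_finsler_square: "z \<in> sdom c \<Longrightarrow> fiber_nondegenerate F2_loc z"
proof -
  assume z: "z \<in> sdom c"
  have "rank (y_hessian F2_loc z) = CARD('n)"
    using F c z unfolding finsler_function_def ball_slit_atlas by blast
  then show ?thesis using rank_y_hessian_iff[OF open_dom_slit[OF c] smooth_finsler_square z] by blast
qed

end

lemma metrizable_iff:
  "metrizable_by A S F \<longleftrightarrow> finsler_function A F \<and>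
    (\<forall>c\<in>A. \<forall>z\<in>sdom c. \<forall>a. dderiv (\<lambda>z. (local_fun F (slit c) z)\<^sup>2) z (local_spray.hor (loc c) a z) = 0)"
  unfolding metrizable_by_def ball_slit_atlas
  using local_spray.geodesic_iff_horizontal[OF local_spray_loc smooth_finsler_square euler_finsler_square]
  by (metis (no_types, lifting))

lemma scalar_flag_curvature_iff:
  assumes F: "finsler_function A F"
  shows "scalar_flag_curvature A S F \<kappa> \<longleftrightarrow> smooth_fun (slit_atlas A) \<kappa> \<and>
     (\<forall>c\<in>A. \<forall>z\<in>sdom c. \<forall>w. jacobi_endo (loc c) z w = local_fun \<kappa> (slit c) z *\<^sub>R
        ((local_fun F (slit c) z)\<^sup>2 *\<^sub>R JJ z w
          - (dderiv (\<lambda>z. (local_fun F (slit c) z)\<^sup>2) z (0, fst w) / 2) *\<^sub>R CC z))"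
  unfolding scalar_flag_curvature_def ball_slit_atlas by (simp add: finsler_dJ[OF F] cong: ball_cong)

lemma constant_curvatureD:
  assumes F: "finsler_function A F" and k: "scalar_flag_curvature A S F (\<lambda>_. k)"
    and c: "c \<in> A" and z: "z \<in> sdom c"
  shows "jacobi_endo (loc c) z w = k *\<^sub>R ((local_fun F (slit c) z)\<^sup>2 *\<^sub>R JJ z w
      - (dderiv (\<lambda>z. (local_fun F (slit c) z)\<^sup>2) z (0, fst w) / 2) *\<^sub>R CC z)"
proof -
  have "jacobi_endo (loc c) z w = local_fun (\<lambda>_. k) (slit c) z *\<^sub>R ((local_fun F (slit c) z)\<^sup>2 *\<^sub>R JJ z w
      - (dderiv (\<lambda>z. (local_fun F (slit c) z)\<^sup>2) z (0, fst w) / 2) *\<^sub>R CC z)"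
    using k c z unfolding scalar_flag_curvature_iff[OF F] by blast
  then show ?thesis by (simp only: local_fun_def[of "\<lambda>_. k"])
qed

lemma ricci_scalar_of_constant_curvature:
  assumes F: "finsler_function A F" and k: "scalar_flag_curvature A S F (\<lambda>_. k)"
    and c: "c \<in> A" and z: "z \<in> sdom c"
  shows "ricci_scalar (loc c) z = k * (local_fun F (slit c) z)\<^sup>2"
proof (rule local_spray.ricci_scalar_of_flag_curvature[OF local_spray_loc[OF c] z _ smooth_finsler_square[OF F c] euler_finsler_square[OF F c z]])
  show "2 \<le> DIM(real ^ 'n)" using dim3 by simp
  show "jacobi_endo (loc c) z w = k *\<^sub>R ((local_fun F (slit c) z)\<^sup>2 *\<^sub>R JJ z w
      - (dderiv (\<lambda>z. (local_fun F (slit c) z)\<^sup>2) z (0, fst w) / 2) *\<^sub>R CC z)" for w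
    by (rule constant_curvatureD[OF F k c z])
qed

lemma smooth_fun_const: "smooth_fun (slit_atlas A) (\<lambda>_. k)" "smooth_fun A (\<lambda>_. k)"
  unfolding smooth_fun_def slit_atlas_def local_fun_def
  by (auto intro!: smooth_on_const open_im open_dom_slit simp: slit_chart_im)

lemma constant_curvature_einstein:
  assumes "finsler_function A F" and "scalar_flag_curvature A S F (\<lambda>_. k)"
  shows "einstein_metric A S F"
  unfolding einstein_metric_def ball_slit_atlas
  using smooth_fun_const(2)[of k] ricci_scalar_of_constant_curvature[OF assms]
  by (intro exI[of _ "\<lambda>_. k"]) auto

subsection \<open>Metrics of constant curvature give the characterization\<close>

lemma smooth_Ric_loc: "c \<in> A \<Longrightarrow> smooth_on (sdom c) (Ric (loc c))"
  by (rule local_spray.smooth_Ric[OF local_spray_loc])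

lemma Ric_eq_scalar: "Ric (loc c) z = (real CARD('n) - 1) * ricci_scalar (loc c) z"
  using dim3 by (simp add: ricci_scalar_def)

lemma constant_curvature_full_rank:
  assumes F: "finsler_function A F" and k: "scalar_flag_curvature A S F (\<lambda>_. k)" "k \<noteq> 0"
  shows "ricci_full_rank A S"
  unfolding ricci_full_rank_def ball_slit_atlas
proof (intro ballI)
  fix c z assume c: "c \<in> A" and z: "z \<in> sdom c"
  have "fiber_nondegenerate (Ric (loc c)) z \<longleftrightarrow> fiber_nondegenerate (\<lambda>z. (local_fun F (slit c) z)\<^sup>2) z"
    by (rule fiber_nondegenerate_scale[OF open_dom_slit[OF c] smooth_finsler_square[OF F c] z, of "(real CARD('n) - 1) * k"])
      (use dim3 k(2) in \<open>auto simp: Ric_eq_scalar ricci_scalar_of_constant_curvature[OF F k(1) c]\<close>)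
  then show "form_rank (ext_d (dL_fun JJ (Ric (loc c))) z) = 2 * CARD('n)"
    using form_rank_full_iff[OF open_dom_slit[OF c] smooth_Ric_loc[OF c] z] nondegenerate_finsler_square[OF F c z]
    by simp
qed

text \<open>The form \<open>(k/2) d\<^sub>J F\<^sup>2 = k F d\<^sub>J F\<close>, the \<open>\<alpha>\<close> of a metric of constant flag curvature \<open>k\<close>.\<close>

definition half_dJ_square :: "(('m, 'n) tm \<Rightarrow> real) \<Rightarrow> real \<Rightarrow> ('m, 'n) tmform" where
  "half_dJ_square F k u c w = (k / 2) * dderiv (\<lambda>z. (local_fun F c z)\<^sup>2) (snd c u) (0, fst w)"

lemma local_half_dJ_square:
  assumes "c \<in> A" "z \<in> sdom c"
  shows "local_form (half_dJ_square F k) (slit c) z w =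
    (k / 2) * dderiv (\<lambda>z. (local_fun F (slit c) z)\<^sup>2) z (0, fst w)"
  unfolding local_form_def half_dJ_square_def
  by (subst chart_inv_right) (use assms in \<open>auto simp: slit_chart_im\<close>)

text \<open>The transformation law holds because coordinate changes map vertical vectors to vertical
  vectors by the derivative of the change of base coordinates.\<close>

lemma semibasic_half_dJ_square:
  assumes F: "finsler_function A F"
  shows "semibasic A (half_dJ_square F k)"
proof -
  have mem: "\<exists>z. z \<in> sdom c \<and> u = pt c z \<and> snd (slit c) u = z" if "c \<in> A" "u \<in> fst (slit c)" for c u
    using slit_eq_pt[OF that(1), of "fst u" "snd u"] that(2)
    by (auto simp: slit_chart_def case_prod_unfold)
  have lin: "linear (half_dJ_square F k u (slit c))" if c: "c \<in> A" and u: "u \<in> fst (slit c)" for c u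
  proof -
    obtain z where z: "z \<in> sdom c" "snd (slit c) u = z" using mem[OF c u] by blast
    have "linear (\<lambda>w :: (real ^ 'n) \<times> (real ^ 'n). (0 :: real ^ 'n, fst w))" by (rule linearI) auto
    from linear_compose_scale_right[OF linear_compose[OF this linear_dderiv[OF smooth_finsler_square[OF F c] z(1)]], of "k / 2"]
    show ?thesis
      unfolding half_dJ_square_def[abs_def] z(2) by (simp add: o_def)
  qed
  have change: "half_dJ_square F k u (slit c) w = half_dJ_square F k u (slit c')
      (frechet_derivative (transition (slit c) (slit c')) (at (snd (slit c) u)) w)"
    if c: "c \<in> A" "c' \<in> A" and u: "u \<in> fst (slit c)" "u \<in> fst (slit c')" for c c' u w
  proof -
    obtain z where z: "z \<in> sdom c" "u = pt c z" "snd (slit c) u = z" using mem[OF c(1) u(1)] by blast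
    have "fst z \<in> snd c ` (fst c \<inter> fst c')"
      using u z(2) chart_inv_right[of "fst z" c] z(1) by (force simp: slit_chart_def pt_def image_iff)
    then have zo: "z \<in> overlap c c' \<times> - {0}" using z(1) by (auto simp: overlap_def)
    have \<tau>: "snd (slit c') u = \<tau> c c' z" using overlap_pt(3)[OF c zo] z(2) by simp
    have \<tau>D: "\<tau> c c' z \<in> sdom c'" by (rule overlap_pt(4)[OF c zo])
    have eq: "local_fun F (slit c) z = local_fun F (slit c') (\<tau> c c' z)"
      using overlap_pt(5)[OF c zo] slit_chart_inv[OF c(1) z(1)] slit_chart_inv[OF c(2) \<tau>D]
      by (simp add: local_fun_def)
    have sq: "dderiv (\<lambda>z. (local_fun F (slit c) z)\<^sup>2) z (0, a) =
        2 * (local_fun F (slit c) z * dderiv (local_fun F (slit c)) z (0, a))" if "c \<in> A" "z \<in> sdom c" for c z a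
      using finsler_dJ[OF F that, of "(a, 0)"] by (simp add: dL_fun_def JJ_def)
    show ?thesis
      unfolding half_dJ_square_def z(3) \<tau> dderiv_def[symmetric] slit_transition_derivative[OF c zo]
        sq[OF c(1) z(1)] sq[OF c(2) \<tau>D] dderiv_local_fun[OF c zo smooth_finsler[OF F c(2)]] eq ..
  qed
  have smooth: "smooth_on (sdom c) (\<lambda>z. local_form (half_dJ_square F k) (slit c) z w)" if c: "c \<in> A" for c w
    by (rule iffD2[OF smooth_on_cong[OF open_dom_slit[OF c] local_half_dJ_square[OF c]]])
      (assumption, intro smooth_on_mult smooth_on_const smooth_onD(2) smooth_finsler_square F c open_dom_slit)
  have zero: "local_form (half_dJ_square F k) (slit c) z (JJ z w) = 0" if "c \<in> A" "z \<in> sdom c" for c z w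
    using dderiv_zero[OF that(2) smooth_finsler_square[OF F that(1)]]
    by (simp add: local_half_dJ_square[OF that] JJ_def zero_prod_def)
  have "smooth_one_form (slit_atlas A) (half_dJ_square F k)"
    unfolding smooth_one_form_def slit_atlas_def ball_simps
  proof (intro conjI ballI allI)
    show "linear (half_dJ_square F k u (slit c))" if "c \<in> A" "u \<in> fst (slit c)" for c u
      by (rule lin[OF that])
    show "half_dJ_square F k u (slit c) w = half_dJ_square F k u (slit c')
        (frechet_derivative (transition (slit c) (slit c')) (at (snd (slit c) u)) w)"
      if "c \<in> A" "c' \<in> A" "u \<in> fst (slit c) \<inter> fst (slit c')" for c c' u w
      by (rule change) (use that in auto)
    show "smooth_on (chart_im (slit c)) (\<lambda>z. local_form (half_dJ_square F k) (slit c) z w)"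
      if "c \<in> A" for c w
      unfolding slit_chart_im[OF that] by (rule smooth[OF that])
  qed
  then show ?thesis
    unfolding semibasic_def ball_slit_atlas using zero by blast
qed

lemma constant_curvature_isotropic:
  assumes F: "finsler_function A F" and k: "scalar_flag_curvature A S F (\<lambda>_. k)"
  shows "isotropic_with A S (half_dJ_square F k)" "dJ_closed A (half_dJ_square F k)"
proof -
  have "jacobi_endo (loc c) z w = ricci_scalar (loc c) z *\<^sub>R JJ z w
      - local_form (half_dJ_square F k) (slit c) z w *\<^sub>R CC z" if c: "c \<in> A" and z: "z \<in> sdom c" for c z w
  proof -
    show ?thesis
      unfolding constant_curvatureD[OF F k c z]
        ricci_scalar_of_constant_curvature[OF F k c z] local_half_dJ_square[OF c z]
      by (simp add: scaleR_right_diff_distrib)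
  qed
  then show "isotropic_with A S (half_dJ_square F k)"
    unfolding isotropic_with_def ball_slit_atlas using semibasic_half_dJ_square[OF F] by blast
  show "dJ_closed A (half_dJ_square F k)"
    unfolding dJ_closed_def ball_slit_atlas
  proof (intro ballI allI)
    fix c z w w' assume c: "c \<in> A" and z: "z \<in> sdom c"
    let ?L = "\<lambda>z. (local_fun F (slit c) z)\<^sup>2"
    note sL = smooth_finsler_square[OF F c] and D = open_dom_slit[OF c]
    have s: "dderiv (\<lambda>x. (k / 2) * dderiv ?L x v) z u = (k / 2) * dderiv (\<lambda>x. dderiv ?L x v) z u" for u v
      by (rule dderiv_linear[OF bounded_linear_mult_right smooth_onD(2)[OF sL] z])
    have 0: "dderiv (\<lambda>x. dderiv ?L x (0, 0)) z u = 0" for u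
      using linear_0[OF linear_dderiv2[OF D sL z]] .
    have "dL_form JJ (local_form (half_dJ_square F k) (slit c)) z w w' =
        dL_form JJ (\<lambda>x u. (k / 2) * dderiv ?L x (0, fst u)) z w w'"
      by (rule dL_form_cong[OF D z local_half_dJ_square[OF c]])
    also have "\<dots> = 0"
      unfolding dL_form_def ext_d_def
      by (simp only: s JJ_def fst_conv 0) (simp add: schwarz[OF D sL z, of "(0, fst w)" "(0, fst w')"])
    finally show "dL_form JJ (local_form (half_dJ_square F k) (slit c)) z w w' = 0" .
  qed
qed

end

section \<open>Isotropic sprays on a manifold\<close>

locale isotropic_manifold = spray_manifold A S
  for A :: "('m::{t2_space, second_countable_topology}, 'n::finite) mchart set"
    and S :: "('m, 'n) tmfield" +
  fixes \<alpha> :: "('m, 'n) tmform"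
  assumes isotropic: "isotropic_with A S \<alpha>" and dJ_closed: "dJ_closed A \<alpha>"
begin

lemma local_isotropic_loc: "c \<in> A \<Longrightarrow> local_isotropic (chart_im c) (loc c) (local_form \<alpha> (slit c))"
proof -
  assume c: "c \<in> A"
  have sb: "semibasic A \<alpha>" using isotropic by (simp add: isotropic_with_def)
  show ?thesis
  proof (intro local_isotropic.intro local_spray_loc[OF c] local_isotropic_axioms.intro)
    show "2 \<le> DIM(real ^ 'n)" using dim3 by simp
    fix w :: "(real ^ 'n) \<times> (real ^ 'n)"
    show "smooth_on (sdom c) (\<lambda>z. local_form \<alpha> (slit c) z w)"
      using sb c unfolding semibasic_def smooth_one_form_def slit_atlas_def ball_simps slit_chart_im[OF c, symmetric]
      by blast
  next
    fix z w w' assume z: "z \<in> sdom c"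
    show "linear (local_form \<alpha> (slit c) z)"
      using sb c pt_slit(1)[OF c z] unfolding semibasic_def smooth_one_form_def slit_atlas_def
      by (auto simp: local_form_def[abs_def] slit_chart_inv[OF c z])
    show "local_form \<alpha> (slit c) z (JJ z w) = 0"
      using sb c z unfolding semibasic_def ball_slit_atlas by blast
    show "jacobi_endo (loc c) z w = ricci_scalar (loc c) z *\<^sub>R JJ z w - local_form \<alpha> (slit c) z w *\<^sub>R CC z"
      using isotropic c z unfolding isotropic_with_def ball_slit_atlas by blast
    show "dL_form JJ (local_form \<alpha> (slit c)) z w w' = 0"
      using dJ_closed c z unfolding dJ_closed_def ball_slit_atlas by blast
  qed
qed

text \<open>The implication from (i) to (v), by the lemma of Schur in each chart.\<close>

theorem metrizable_imp_ricci_constant: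
  assumes F: "metrizable_by A S F"
  shows "ricci_constant A S"
  unfolding ricci_constant_iff
proof (intro ballI allI)
  fix c z a assume c: "c \<in> A" and z: "z \<in> sdom c"
  have fin: "finsler_function A F"
    and hor: "\<And>z a. z \<in> sdom c \<Longrightarrow>
      dderiv (\<lambda>z. (local_fun F (slit c) z)\<^sup>2) z (local_spray.hor (loc c) a z) = 0"
    using F c unfolding metrizable_iff by blast+
  show "dderiv (ricci_scalar (loc c)) z (local_spray.hor (loc c) a z) = 0"
  proof (rule local_isotropic.schur[OF local_isotropic_loc[OF c] _ smooth_finsler_square[OF fin c] euler_finsler_square[OF fin c] _ hor z])
    show "3 \<le> DIM(real ^ 'n)" using dim3 by simp
    show "0 < (local_fun F (slit c) z)\<^sup>2" if "z \<in> sdom c" for z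
      using finsler_pos[OF fin c that] by simp
  qed
qed

subsection \<open>The Ricci scalar as a function on the slit tangent bundle\<close>

text \<open>Well defined by \<open>R = \<alpha>(S)\<close>: a 1-form evaluated on a vector field does not depend on the chart.\<close>

definition global_ricci_scalar :: "('m, 'n) tm \<Rightarrow> real" where
  "global_ricci_scalar u = (let c = SOME c. c \<in> A \<and> fst u \<in> fst c in \<alpha> u (slit c) (S u (slit c)))"

lemma global_ricci_scalar_chart:
  assumes c: "c \<in> A" and z: "z \<in> sdom c"
  shows "ricci_scalar (loc c) z = global_ricci_scalar (pt c z)"
proof -
  let ?u = "pt c z"
  define c' where "c' = (SOME c. c \<in> A \<and> fst ?u \<in> fst c)"
  have fu: "fst ?u \<in> fst c" using z by (auto simp: pt_def intro: chart_inv_in)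
  then have c': "c' \<in> A" "fst ?u \<in> fst c'"
    using someI[of "\<lambda>c. c \<in> A \<and> fst ?u \<in> fst c" c] c unfolding c'_def by auto
  have u: "?u \<in> fst (slit c)" by (rule pt_slit(1)[OF c z])
  then have u': "?u \<in> fst (slit c')" using c'(2) by (auto simp: slit_chart_def)
  have "S ?u \<in> tangent_space (slit_atlas A) ?u"
    using spray u c unfolding spray_def smooth_vector_field_def slit_atlas_def by blast
  then have S: "S ?u (slit c') = frechet_derivative (transition (slit c) (slit c')) (at (snd (slit c) ?u)) (S ?u (slit c))"
    using u u' c c'(1) unfolding tangent_space_def slit_atlas_def by blast
  have "semibasic A \<alpha>" using isotropic by (simp add: isotropic_with_def)
  then have "\<alpha> ?u (slit c) w = \<alpha> ?u (slit c')
      (frechet_derivative (transition (slit c) (slit c')) (at (snd (slit c) ?u)) w)" for w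
    using u u' c c'(1) unfolding semibasic_def smooth_one_form_def slit_atlas_def by blast
  then have "\<alpha> ?u (slit c) (S ?u (slit c)) = global_ricci_scalar ?u"
    unfolding global_ricci_scalar_def Let_def c'_def[symmetric] S .
  then show ?thesis
    using local_isotropic.R_\<alpha>_S[OF local_isotropic_loc[OF c] z]
    by (simp add: local_form_def local_vf_def slit_chart_inv[OF c z])
qed

lemma smooth_R: "c \<in> A \<Longrightarrow> smooth_on (sdom c) (ricci_scalar (loc c))"
  by (rule local_spray.smooth_ricci_scalar[OF local_spray_loc])

text \<open>On a punctured fibre the sign is constant by connectedness, so a point of the manifold
  determines a sign. The points of either sign form an open set, and the manifold is connected.\<close>

lemma ricci_scalar_sign:
  assumes nv: "nonvanishing_ricci A S" and conn: "connected (UNIV :: 'm set)"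
  obtains \<epsilon> :: real where "\<epsilon> = 1 \<or> \<epsilon> = -1"
    "\<And>c z. c \<in> A \<Longrightarrow> z \<in> sdom c \<Longrightarrow> \<epsilon> * ricci_scalar (loc c) z > 0"
proof -
  let ?R = "\<lambda>c. ricci_scalar (loc c)"
  have nz: "?R c z \<noteq> 0" if "c \<in> A" "z \<in> sdom c" for c z
  proof -
    have "Ric (loc c) z \<noteq> 0" using nv that unfolding nonvanishing_ricci_def ball_slit_atlas by blast
    then show ?thesis using Ric_eq_scalar[of c z] by auto
  qed
  have fiber: "?R c (x, y') > 0" if c: "c \<in> A" and x: "x \<in> chart_im c" and y: "y \<noteq> 0" "y' \<noteq> 0"
    and pos: "?R c (x, y) > 0" for c x y y'
  proof (rule ccontr)
    assume "\<not> ?thesis"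
    then have neg: "?R c (x, y') \<le> 0" by simp
    have "continuous_on (- {0}) (\<lambda>y. ?R c (x, y))"
      by (rule continuous_on_compose2[OF smooth_onD(3)[OF smooth_R[OF c]]])
        (use x in \<open>auto intro!: continuous_intros\<close>)
    moreover have "connected (- {0 :: real ^ 'n})"
      using dim3 by (intro connected_punctured_universe) simp
    ultimately have conn: "connected ((\<lambda>y. ?R c (x, y)) ` (- {0}))"
      by (rule connected_continuous_image)
    have "0 \<in> (\<lambda>y. ?R c (x, y)) ` (- {0})"
      by (rule connectedD_interval[OF conn _ _ neg less_imp_le[OF pos]]) (use y in auto)
    then show False using nz[OF c] x by force
  qed
  define V where "V \<epsilon> = (\<Union>c\<in>A. \<Union>y\<in>- {0}. {p \<in> fst c. \<epsilon> * ?R c (snd c p, y) > 0})" for \<epsilon> :: real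
  have "open (V \<epsilon>)" for \<epsilon>
    unfolding V_def
  proof (intro open_UN ballI)
    fix c and y :: "real ^ 'n" assume c: "c \<in> A" and y: "y \<in> - {0}"
    have "continuous_on (fst c) (\<lambda>p. \<epsilon> * ?R c (snd c p, y))"
      by (intro continuous_on_mult continuous_on_const
          continuous_on_compose2[OF smooth_onD(3)[OF smooth_R[OF c]]] continuous_on_Pair
          homeomorphism_cont1[OF homeo[OF c]])
        (use y in \<open>auto simp: in_chart_im\<close>)
    then have "open (fst c \<inter> (\<lambda>p. \<epsilon> * ?R c (snd c p, y)) -` {0<..})"
      by (intro continuous_open_preimage open_dom[OF c] open_greaterThan)
    moreover have "fst c \<inter> (\<lambda>p. \<epsilon> * ?R c (snd c p, y)) -` {0<..} = {p \<in> fst c. \<epsilon> * ?R c (snd c p, y) > 0}"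
      by auto
    ultimately show "open {p \<in> fst c. \<epsilon> * ?R c (snd c p, y) > 0}" by simp
  qed
  moreover have "V 1 \<union> V (-1) = UNIV"
  proof (rule set_eqI, simp)
    fix p
    obtain c where c: "c \<in> A" "p \<in> fst c" using cover by blast
    obtain y :: "real ^ 'n" where y: "y \<noteq> 0" using SOME_Basis nonzero_Basis by blast
    from nz[OF c(1), of "(snd c p, y)"] y in_chart_im[OF c(2)]
    have "?R c (snd c p, y) > 0 \<or> - ?R c (snd c p, y) > 0" by auto
    then show "p \<in> V 1 \<or> p \<in> V (- 1)" using c y unfolding V_def by force
  qed
  moreover have "V 1 \<inter> V (-1) = {}"
  proof (rule ccontr)
    assume "V 1 \<inter> V (-1) \<noteq> {}"
    then obtain p where p: "p \<in> V 1" "p \<in> V (-1)" by blast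
    have V: "\<exists>c y. c \<in> A \<and> p \<in> fst c \<and> y \<noteq> 0 \<and> s * ?R c (snd c p, y) > 0" if "p \<in> V s" for s
      using that unfolding V_def UN_iff mem_Collect_eq Compl_iff singleton_iff by blast
    obtain c y where c: "c \<in> A" "p \<in> fst c" "y \<noteq> 0" "?R c (snd c p, y) > 0"
      using V[OF p(1)] by (simp only: mult_1) blast
    obtain c' y' where c': "c' \<in> A" "p \<in> fst c'" "y' \<noteq> 0" "-1 * ?R c' (snd c' p, y') > 0"
      using V[OF p(2)] by blast
    define v where "v = vec_at c' p y'"
    have v: "(p, v) \<in> slit_bundle A"
      using c' by (simp add: v_def slit_bundle_iff vec_at_tangent vec_at_eq_0_iff)
    have vc': "v c' = y'" using c' by (simp add: v_def vec_at_self)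
    \<comment> \<open>The vector with components \<open>y'\<close> in \<open>c'\<close> has some components in \<open>c\<close>; there \<open>R\<close> is positive by
       constancy of sign on the fibre.\<close>
    note e = slit_eq_pt[OF c(1) v c(2)] slit_eq_pt[OF c'(1) v c'(2)]
    have "?R c (snd c p, v c) = ?R c' (snd c' p, v c')"
      unfolding global_ricci_scalar_chart[OF c(1) e(1)] global_ricci_scalar_chart[OF c'(1) e(3)] e(2)[symmetric] e(4)[symmetric] ..
    moreover have "?R c (snd c p, v c) > 0"
      using fiber[OF c(1) in_chart_im[OF c(2)] c(3) _ c(4)] e(1) by auto
    ultimately show False using c'(4) by (simp add: vc')
  qed
  ultimately have "V 1 = {} \<or> V (-1) = {}"
    using connectedD[OF conn, of "V 1" "V (-1)"] by auto
  then obtain \<epsilon> :: real where \<epsilon>: "\<epsilon> = 1 \<or> \<epsilon> = -1" "V (- \<epsilon>) = {}" by force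
  show thesis
  proof
    fix c z assume c: "c \<in> A" and z: "z \<in> sdom c"
    obtain x y where xy: "z = (x, y)" by fastforce
    have "chart_inv c x \<notin> V (- \<epsilon>)" using \<epsilon> by simp
    then have "\<not> - \<epsilon> * ?R c (snd c (chart_inv c x), y) > 0"
      using c z chart_inv_in[of x c] xy unfolding V_def by auto
    then have "\<epsilon> * ?R c z \<ge> 0" using z by (simp add: chart_inv_right xy)
    moreover have "\<epsilon> * ?R c z \<noteq> 0" using nz[OF c z] \<epsilon>(1) by auto
    ultimately show "\<epsilon> * ?R c z > 0" by linarith
  qed (rule \<epsilon>(1))
qed

text \<open>The implication from (v) to (iv), with \<open>F = \<surd>\<bar>R\<bar>\<close> and \<open>k\<close> the sign of \<open>R\<close>.\<close>

theorem ricci_constant_imp_constant_curvature: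
  assumes nv: "nonvanishing_ricci A S" and conn: "connected (UNIV :: 'm set)"
    and rank: "ricci_full_rank A S" and rc: "ricci_constant A S"
  shows "\<exists>F k. metrizable_by A S F \<and> scalar_flag_curvature A S F (\<lambda>_. k) \<and> k \<noteq> 0"
proof -
  let ?R = "\<lambda>c. ricci_scalar (loc c)"
  obtain \<epsilon> :: real where \<epsilon>: "\<epsilon> = 1 \<or> \<epsilon> = -1"
    and pos: "\<And>c z. c \<in> A \<Longrightarrow> z \<in> sdom c \<Longrightarrow> \<epsilon> * ?R c z > 0"
    using ricci_scalar_sign[OF nv conn] by blast
  have \<epsilon>2: "\<epsilon> * (\<epsilon> * r) = r" "\<epsilon> \<noteq> 0" for r using \<epsilon> by auto
  have smooth: "smooth_on (sdom c) (\<lambda>z. \<epsilon> * ?R c z)" if "c \<in> A" for c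
    by (intro smooth_on_mult smooth_on_const smooth_R open_dom_slit that)
  have dR: "dderiv (\<lambda>z. \<epsilon> * ?R c z) z w = \<epsilon> * dderiv (?R c) z w" if "c \<in> A" "z \<in> sdom c" for c z w
    by (rule dderiv_linear[OF bounded_linear_mult_right smooth_R[OF that(1)] that(2)])
  have euler: "dderiv (\<lambda>z. \<epsilon> * ?R c z) z (0, snd z) = 2 * (\<epsilon> * ?R c z)" if "c \<in> A" "z \<in> sdom c" for c z
    by (simp add: dR[OF that] local_spray.euler_ricci_scalar[OF local_spray_loc[OF that(1)] that(2)])
  define F :: "('m, 'n) tm \<Rightarrow> real" where "F u = (if snd u = (\<lambda>_. 0) then 0 else sqrt (\<epsilon> * global_ricci_scalar u))" for u
  have F_pt: "F (pt c z) = (if snd z = 0 then 0 else sqrt (\<epsilon> * ?R c z))" if "c \<in> A" "fst z \<in> chart_im c" for c z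
  proof -
    have "snd (pt c z) = (\<lambda>_. 0) \<longleftrightarrow> snd z = 0"
      using vec_at_eq_0_iff[OF that(1) chart_inv_in[OF that(2)], of "snd z"] by (simp add: pt_def)
    moreover have "?R c z = global_ricci_scalar (pt c z)" if "snd z \<noteq> 0"
      by (rule global_ricci_scalar_chart[OF \<open>c \<in> A\<close>]) (use that \<open>fst z \<in> chart_im c\<close> in \<open>simp add: mem_Times_iff\<close>)
    ultimately show ?thesis by (simp add: F_def)
  qed
  have F_slit: "local_fun F (slit c) z = sqrt (\<epsilon> * ?R c z)" if "c \<in> A" "z \<in> sdom c" for c z
    using F_pt[OF that(1), of z] that(2) by (auto simp: local_fun_def slit_chart_inv[OF that] split: if_splits)
  have F_sq: "(local_fun F (slit c) z)\<^sup>2 = \<epsilon> * ?R c z" if "c \<in> A" "z \<in> sdom c" for c z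
    using pos[OF that] by (simp add: F_slit[OF that])
  have dF: "dderiv (\<lambda>z. (local_fun F (slit c) z)\<^sup>2) z = dderiv (\<lambda>z. \<epsilon> * ?R c z) z" if "c \<in> A" "z \<in> sdom c" for c z
    by (rule dderiv_cong[OF open_dom_slit[OF that(1)] F_sq[OF that(1)] that(2)])
  have F_smooth: "smooth_on (sdom c) (local_fun F (slit c))" if c: "c \<in> A" for c
  proof -
    have eq: "local_fun F (slit c) z = (\<epsilon> * ?R c z) powr (1 / 2)" if "z \<in> sdom c" for z
      using pos[OF c that] by (simp add: F_slit[OF c that] powr_half_sqrt)
    have sm: "smooth_on (sdom c) (\<lambda>z. (\<epsilon> * ?R c z) powr (1 / 2))"
      by (rule smooth_on_powr[OF open_dom_slit[OF c] smooth[OF c] pos[OF c]])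
    show ?thesis by (rule iffD2[OF smooth_on_cong[OF open_dom_slit[OF c] eq]]) (assumption, rule sm)
  qed
  have fin: "finsler_function A F"
    unfolding finsler_function_def ball_slit_atlas
  proof (intro conjI ballI)
    fix c assume c: "c \<in> A"
    have "continuous_on (chart_im c \<times> UNIV) (\<lambda>z. if snd z = 0 then 0 else sqrt (\<epsilon> * ?R c z))"
      by (rule continuous_on_sqrt_extended[OF open_im[OF c] smooth[OF c] pos[OF c] euler[OF c]])
    moreover have "local_fun F (tangent_chart A c) z = (if snd z = 0 then 0 else sqrt (\<epsilon> * ?R c z))"
      if "z \<in> chart_im c \<times> UNIV" for z
      using that tangent_chart_inv[OF c, of z] F_pt[OF c, of z] by (auto simp: local_fun_def)
    ultimately show "continuous_on (chart_im (tangent_chart A c)) (local_fun F (tangent_chart A c))"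
      unfolding tangent_chart_im[OF c] by (simp cong: continuous_on_cong)
  next
    show "smooth_fun (slit_atlas A) F"
      unfolding smooth_fun_def slit_atlas_def using F_smooth by (auto simp: slit_chart_im)
  next
    fix u assume u: "u \<in> slit_bundle A"
    obtain p v where pv: "u = (p, v)" by fastforce
    obtain c where c: "c \<in> A" "p \<in> fst c" using cover by blast
    note e = slit_eq_pt[OF c(1) u[unfolded pv] c(2)]
    show "0 < F u"
      using F_pt[OF c(1), of "(snd c p, v c)"] pos[OF c(1) e(1)] e by (simp add: pv)
  next
    fix u assume u: "u \<in> tangent_bundle A"
    obtain p v where pv: "u = (p, v)" by fastforce
    have v: "v \<in> tangent_space A p" using u by (simp add: pv tangent_bundle_iff)
    obtain c where c: "c \<in> A" "p \<in> fst c" using cover by blast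
    have pt: "(p, \<lambda>c'. r *\<^sub>R v c') = pt c (snd c p, r *\<^sub>R v c)" for r
    proof -
      have "(\<lambda>c'. r *\<^sub>R v c') = (\<lambda>c'. r *\<^sub>R vec_at c p (v c) c')"
        using tangent_eq_vec_at[OF c v] by metis
      also have "\<dots> = vec_at c p (r *\<^sub>R v c)" by (rule vec_at_scale[OF c, symmetric])
      finally show ?thesis by (simp only: pt_def fst_conv snd_conv chart_inv_left[OF c])
    qed
    have "F (p, \<lambda>c'. r *\<^sub>R v c') = r * F (p, v)" if r: "r \<ge> 0" for r
    proof (cases "r = 0 \<or> v c = 0")
      case True
      then show ?thesis
        using F_pt[OF c(1), of "(snd c p, r *\<^sub>R v c)"] F_pt[OF c(1), of "(snd c p, 1 *\<^sub>R v c)"]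
          in_chart_im[OF c(2)] pt[of r] pt[of 1] by auto
    next
      case False
      with r have r: "r > 0" and vc: "v c \<noteq> 0" by auto
      have "\<epsilon> * ?R c (snd c p, r *\<^sub>R v c) = r\<^sup>2 * (\<epsilon> * ?R c (snd c p, v c))"
        by (rule homogeneous_of_euler[OF smooth[OF c(1)] euler[OF c(1)] in_chart_im[OF c(2)] vc r])
      then show ?thesis
        using F_pt[OF c(1), of "(snd c p, r *\<^sub>R v c)"] F_pt[OF c(1), of "(snd c p, 1 *\<^sub>R v c)"]
          in_chart_im[OF c(2)] pt[of r] pt[of 1] r vc \<epsilon>2(2)
        by (simp add: real_sqrt_mult)
    qed
    then show "case u of (p, v) \<Rightarrow> \<forall>r\<ge>0. F (p, \<lambda>c. r *\<^sub>R v c) = r * F (p, v)" by (simp add: pv)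
  next
    fix c z assume c: "c \<in> A" and z: "z \<in> sdom c"
    let ?L = "\<lambda>z. (local_fun F (slit c) z)\<^sup>2"
    have sL: "smooth_on (sdom c) ?L"
      unfolding power2_eq_square by (intro smooth_on_mult open_dom_slit[OF c] F_smooth[OF c])
    have "form_rank (ext_d (dL_fun JJ (Ric (loc c))) z) = 2 * CARD('n)"
      using rank c z unfolding ricci_full_rank_def ball_slit_atlas by blast
    then have "fiber_nondegenerate (Ric (loc c)) z"
      using form_rank_full_iff[OF open_dom_slit[OF c] smooth_Ric_loc[OF c] z] by simp
    also have "fiber_nondegenerate (Ric (loc c)) z \<longleftrightarrow> fiber_nondegenerate ?L z"
      by (rule fiber_nondegenerate_scale[OF open_dom_slit[OF c] sL z, of "(real CARD('n) - 1) * \<epsilon>"])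
        (use dim3 \<epsilon>2(2) in \<open>auto simp: Ric_eq_scalar F_sq[OF c] \<epsilon>2(1) mult.assoc\<close>)
    finally show "rank (y_hessian ?L z) = CARD('n)"
      using rank_y_hessian_iff[OF open_dom_slit[OF c] sL z] by blast
  qed
  have met: "metrizable_by A S F"
    unfolding metrizable_iff
    using fin rc unfolding ricci_constant_iff by (auto simp: dF dR)
  have "scalar_flag_curvature A S F (\<lambda>_. \<epsilon>)"
    unfolding scalar_flag_curvature_iff[OF fin]
  proof (intro conjI ballI allI smooth_fun_const)
    fix c z w assume c: "c \<in> A" and z: "z \<in> sdom c"
    have "jacobi_endo (loc c) z w = (0, ?R c z *\<^sub>R fst w - (dderiv (?R c) z (0, fst w) / 2) *\<^sub>R snd z)"
      by (simp add: local_spray.jacobi_endo_eq[OF local_spray_loc[OF c] z]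
          local_isotropic.\<Phi>_R[OF local_isotropic_loc[OF c] z])
    then show "jacobi_endo (loc c) z w = local_fun (\<lambda>_. \<epsilon>) (slit c) z *\<^sub>R
        ((local_fun F (slit c) z)\<^sup>2 *\<^sub>R JJ z w
          - (dderiv (\<lambda>z. (local_fun F (slit c) z)\<^sup>2) z (0, fst w) / 2) *\<^sub>R CC z)"
      unfolding F_sq[OF c z] dF[OF c z] dR[OF c z] local_fun_def[of "\<lambda>_. \<epsilon>"]
      by (simp add: JJ_def CC_def scaleR_right_diff_distrib \<epsilon>2)
  qed
  with met \<epsilon>2(2) show ?thesis by blast
qed

end

theorem theorem4p2:
  fixes A :: "('m::{t2_space, second_countable_topology}, 'n::finite) mchart set"
    and S :: "('m, 'n) tmfield"
  assumes "smooth_atlas A"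
    and "connected (UNIV :: 'm set)"
    and "CARD('n) \<ge> 3"
    and "spray A S"
    and "nonvanishing_ricci A S"
  shows
    "let characterization =
           ((\<exists>\<alpha>. isotropic_with A S \<alpha> \<and> dJ_closed A \<alpha>) \<and> ricci_full_rank A S);
         conditions =
           [\<exists>F. metrizable_by A S F,
            \<exists>F \<kappa>. metrizable_by A S F \<and> scalar_flag_curvature A S F \<kappa> \<and>
              (\<forall>u\<in>slit_bundle A. \<kappa> u \<noteq> 0),
            \<exists>F. metrizable_by A S F \<and> einstein_metric A S F,
            \<exists>F k. metrizable_by A S F \<and> scalar_flag_curvature A S F (\<lambda>_. k) \<and> k \<noteq> 0,
            ricci_constant A S]
     in (characterization \<longrightarrow> all_equivalent conditions) \<and>
        (all_equivalent conditions \<and> (\<exists>P\<in>set conditions. P) \<longrightarrow> characterization)"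
proof -
  interpret spray_manifold A S
    by unfold_locales (use assms in auto)
  let ?i = "\<exists>F. metrizable_by A S F"
  let ?ii = "\<exists>F \<kappa>. metrizable_by A S F \<and> scalar_flag_curvature A S F \<kappa> \<and> (\<forall>u\<in>slit_bundle A. \<kappa> u \<noteq> 0)"
  let ?iii = "\<exists>F. metrizable_by A S F \<and> einstein_metric A S F"
  let ?iv = "\<exists>F k. metrizable_by A S F \<and> scalar_flag_curvature A S F (\<lambda>_. k) \<and> k \<noteq> 0"
  let ?v = "ricci_constant A S"
  let ?char = "(\<exists>\<alpha>. isotropic_with A S \<alpha> \<and> dJ_closed A \<alpha>) \<and> ricci_full_rank A S"
  have met: "finsler_function A F" if "metrizable_by A S F" for F
    using that by (simp add: metrizable_by_def)
  have iv_ii: "?iv \<Longrightarrow> ?ii" by blast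
  have iv_iii: "?iv \<Longrightarrow> ?iii" using constant_curvature_einstein met by blast
  have i_v: "?i \<Longrightarrow> ?v" and v_iv: "?v \<Longrightarrow> ?iv" if characterized: "?char"
  proof -
    obtain \<alpha> where \<alpha>: "isotropic_with A S \<alpha>" "dJ_closed A \<alpha>" using characterized by blast
    then interpret isotropic_manifold A S \<alpha> by unfold_locales
    show "?i \<Longrightarrow> ?v" using metrizable_imp_ricci_constant by blast
    show "?v \<Longrightarrow> ?iv"
      using ricci_constant_imp_constant_curvature[OF assms(5,2)] characterized by blast
  qed
  have iv_char: "?iv \<Longrightarrow> ?char"
    using constant_curvature_isotropic constant_curvature_full_rank met by blast
  have equiv: "all_equivalent [?i, ?ii, ?iii, ?iv, ?v]" if ?char
    unfolding all_equivalent_def using iv_ii iv_iii i_v[OF that] v_iv[OF that] by (simp, blast)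
  have iv: "?iv" if some: "all_equivalent [?i, ?ii, ?iii, ?iv, ?v] \<and> (\<exists>P\<in>set [?i, ?ii, ?iii, ?iv, ?v]. P)"
  proof -
    obtain P where P: "P \<in> set [?i, ?ii, ?iii, ?iv, ?v]" P using some by (elim conjE bexE)
    have mem: "?iv \<in> set [?i, ?ii, ?iii, ?iv, ?v]" by (simp only: list.set insert_iff simp_thms)
    have "P \<longleftrightarrow> ?iv"
      by (rule bspec[OF bspec[OF conjunct1[OF some, unfolded all_equivalent_def] P(1)] mem])
    with P(2) show ?iv by (rule iffD1[rotated])
  qed
  show ?thesis
    unfolding Let_def by (intro conjI[OF impI impI]) (rule equiv, assumption, rule iv_char[OF iv], assumption)
qed

end
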